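(* Let $s>\frac d2$, $\sigma>0$, $M\ge 1$ and $T>0$. There exist constants $C$ and $K_0$, depending only on $s,\sigma,M,T$ and $d$, such that the following holds. Assume that the exact solution $(\psi,u,\dot u)$ of the Zakharov system $$i\partial_t\psi=-\Delta\psi+u\psi,\qquad \partial_t u=\dot u,\qquad \partial_t\dot u=\Delta u+\Delta|\psi|^2$$ on $\mathbb{T}^d$ satisfies $$\|\psi(t)\|_{s+2+\sigma}+|\!|\!|(u(t),\dot u(t))|\!|\!|_{s+\sigma}\le M\qquad\text{for } 0\le t-t_0\le T.$$ Then, for $K\ge K_0$, the solution $(\psi^K,u^K,\dot u^K)$ of the Fourier collocation semi-discretization in space with discretization parameter $K$ (defined in the context) satisfies $$\|\psi(t)-\psi^K(t)\|_{s+2}+|\!|\!|(u(t),\dot u(t))-(u^K(t),\dot u^K(t))|\!|\!|_{s}\le C K^{-\sigma}\qquad\text{for } 0\le t-t_0\le T.$$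
   Context: Notation: $\mathbb{T}^d=\mathbb{R}^d/(2\pi\mathbb{Z}^d)$; $\psi(t)=\psi(\cdot,t)$ is complex-valued, $u(t),\dot u(t)$ are real-valued functions on $\mathbb{T}^d$. For $v(x)=\sum_{j\in\mathbb{Z}^d}v_j e^{ij\cdot x}$ put $\|v\|_s=\big(\sum_{j}\max(|j|,1)^{2s}|v_j|^2\big)^{1/2}$, where $|j|^2=j_1^2+\dots+j_d^2$; $H^s=H^s(\mathbb{T}^d)$ is the corresponding Sobolev space. On $H^{s+1}\times H^s$ use $|\!|\!|(v,\dot v)|\!|\!|_s=(\|v\|_{s+1}^2+\|\dot v\|_s^2)^{1/2}$. For an integer $K\ge1$ let $\mathcal K=\{-K,\dots,K-1\}^d$. A trigonometric polynomial of degree $K$ is a function $\sum_{j\in\mathcal K}v_je^{ij\cdot x}$. $\mathcal I$ denotes trigonometric interpolation: $\mathcal I(v)$ is the unique trigonometric polynomial of degree $K$ that agrees with $v$ at the points $x_k=k\pi/K$, $k\in\mathcal K$. Fourier collocation: $\psi^K(t),u^K(t),\dot u^K(t)$ are trigonometric polynomials of degree $K$ solving $$i\partial_t\psi^K=-\Delta\psi^K+\mathcal I(u^K\psi^K),\quad \partial_tu^K=\dot u^K,\quad \partial_t\dot u^K=\Delta u^K+\Delta\mathcal I(|\psi^K|^2),$$ with $\psi^K(t_0)=\mathcal I(\psi(t_0))$, $u^K(t_0)=\mathcal I(u(t_0))$, $\dot u^K(t_0)=\mathcal I(\dot u(t_0))$. *)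

theory Defs
  imports "HOL-Analysis.Analysis"
begin

text \<open>
  The torus is \<open>(\<real>/2\<pi>\<int>)\<^sup>d\<close> with \<open>d = CARD('n)\<close>. Functions on it are \<open>2\<pi>\<close>-periodic functions on
  \<open>real^'n\<close>, frequencies are elements of \<open>int^'n\<close>.
\<close>

definition freq :: "int^'n \<Rightarrow> real^'n" where
  "freq j = (\<chi> i. real_of_int (j $ i))"

definition periodic :: "(real^'n \<Rightarrow> 'a) \<Rightarrow> bool" where
  "periodic v \<longleftrightarrow> (\<forall>x k. v (x + (2 * pi) *\<^sub>R freq k) = v x)"

definition fourier_exp :: "int^'n \<Rightarrow> real^'n \<Rightarrow> complex" where
  "fourier_exp j x = exp (\<i> * complex_of_real (freq j \<bullet> x))"

definition torus_cell :: "(real^'n) set" where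
  "torus_cell = cbox (\<chi> i. - pi) (\<chi> i. pi)"

definition fourier_coeff :: "(real^'n \<Rightarrow> complex) \<Rightarrow> int^'n \<Rightarrow> complex" where
  "fourier_coeff v j =
     (LINT x:torus_cell|lborel. v x * fourier_exp (- j) x) / (2 * complex_of_real pi) ^ CARD('n)"

text \<open>
  \<open>H\<^sup>s\<close> for \<open>s \<ge> 0\<close>. Summability is part of membership because \<^const>\<open>infsum\<close> returns 0 on families
  that are not summable, so \<open>sobolev_norm s v\<close> is meaningful only for \<open>v \<in> sobolev s\<close>.
\<close>

definition sobolev_term :: "real \<Rightarrow> (real^'n \<Rightarrow> complex) \<Rightarrow> int^'n \<Rightarrow> real" where
  "sobolev_term s v j = max (norm (freq j)) 1 powr (2 * s) * (cmod (fourier_coeff v j))\<^sup>2"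

definition sobolev :: "real \<Rightarrow> (real^'n \<Rightarrow> complex) set" where
  "sobolev s = {v. periodic v \<and> v \<in> borel_measurable lborel
     \<and> set_integrable lborel torus_cell (\<lambda>x. (cmod (v x))\<^sup>2)
     \<and> sobolev_term s v summable_on UNIV}"

definition sobolev_norm :: "real \<Rightarrow> (real^'n \<Rightarrow> complex) \<Rightarrow> real" where
  "sobolev_norm s v = sqrt (\<Sum>\<^sub>\<infinity>j\<in>UNIV. sobolev_term s v j)"

definition pair_norm :: "real \<Rightarrow> (real^'n \<Rightarrow> complex) \<Rightarrow> (real^'n \<Rightarrow> complex) \<Rightarrow> real" where
  "pair_norm s v w = sqrt ((sobolev_norm (s + 1) v)\<^sup>2 + (sobolev_norm s w)\<^sup>2)"

text \<open>
  Exact solutions on the time interval \<open>[t0, t0 + T]\<close>; \<open>w\<close> plays the role of the time derivative of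
  \<open>u\<close>. At the regularity considered, \<open>\<Delta> u\<close> need not be a function, so the equations are understood
  in the sense of distributions on the torus, i.e. tested against the exponentials
  \<open>exp (- i j \<bullet> x)\<close>; \<open>laplace_coeff v j\<close> is the \<open>j\<close>-th Fourier coefficient of the distribution
  \<open>\<Delta> v\<close>. Members of \<open>H\<^sup>r\<close> with \<open>r > d/2\<close> are identified with their continuous representatives, which
  matters because interpolation uses point values.
\<close>

definition laplace_coeff :: "(real^'n \<Rightarrow> complex) \<Rightarrow> int^'n \<Rightarrow> complex" where
  "laplace_coeff v j = - complex_of_real ((norm (freq j))\<^sup>2) * fourier_coeff v j"

definition torus_continuous :: "(real^'n \<Rightarrow> 'a::topological_space) \<Rightarrow> bool" where
  "torus_continuous v \<longleftrightarrow> periodic v \<and> continuous_on UNIV v"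

abbreviation cfun :: "(real^'n \<Rightarrow> real) \<Rightarrow> real^'n \<Rightarrow> complex" where
  "cfun v \<equiv> (\<lambda>x. complex_of_real (v x))"

definition zakharov_solution ::
  "real \<Rightarrow> real \<Rightarrow> (real \<Rightarrow> real^'n \<Rightarrow> complex) \<Rightarrow> (real \<Rightarrow> real^'n \<Rightarrow> real)
    \<Rightarrow> (real \<Rightarrow> real^'n \<Rightarrow> real) \<Rightarrow> bool" where
  "zakharov_solution t0 T \<psi> u w \<longleftrightarrow>
     (\<forall>t\<in>{t0..t0 + T}.
        torus_continuous (\<psi> t) \<and> torus_continuous (u t) \<and> torus_continuous (w t) \<and>
        (\<forall>j.
          ((\<lambda>\<tau>. \<i> * fourier_coeff (\<psi> \<tau>) j) has_vector_derivative
             - laplace_coeff (\<psi> t) j + fourier_coeff (\<lambda>x. complex_of_real (u t x) * \<psi> t x) j)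
             (at t within {t0..t0 + T}) \<and>
          ((\<lambda>\<tau>. fourier_coeff (cfun (u \<tau>)) j) has_vector_derivative
             fourier_coeff (cfun (w t)) j)
             (at t within {t0..t0 + T}) \<and>
          ((\<lambda>\<tau>. fourier_coeff (cfun (w \<tau>)) j) has_vector_derivative
             laplace_coeff (cfun (u t)) j + laplace_coeff (cfun (\<lambda>x. (cmod (\<psi> t x))\<^sup>2)) j)
             (at t within {t0..t0 + T})))"

definition modes :: "nat \<Rightarrow> (int^'n) set" where
  "modes K = {j. \<forall>i. - int K \<le> j $ i \<and> j $ i \<le> int K - 1}"

lemma finite_modes: "finite (modes K :: (int^'n) set)"
proof -
  have "modes K \<subseteq> (\<lambda>f. \<chi> i. f i) ` (UNIV \<rightarrow>\<^sub>E {- int K..int K - 1} :: ('n \<Rightarrow> int) set)"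
  proof
    fix j :: "int^'n" assume "j \<in> modes K"
    then have "(\<lambda>i. j $ i) \<in> (UNIV \<rightarrow>\<^sub>E {- int K..int K - 1})"
      by (auto simp: modes_def)
    moreover have "j = (\<chi> i. j $ i)" by (simp add: vec_eq_iff)
    ultimately show "j \<in> (\<lambda>f. \<chi> i. f i) ` (UNIV \<rightarrow>\<^sub>E {- int K..int K - 1})" by blast
  qed
  moreover have "finite (UNIV \<rightarrow>\<^sub>E {- int K..int K - 1} :: ('n \<Rightarrow> int) set)"
    by (rule finite_PiE) auto
  ultimately show ?thesis by (meson finite_imageI finite_subset)
qed

definition trig_poly :: "nat \<Rightarrow> (real^'n \<Rightarrow> complex) set" where
  "trig_poly K = {p. \<exists>c. p = (\<lambda>x. \<Sum>j\<in>modes K. c j * fourier_exp j x)}"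

definition grid_point :: "nat \<Rightarrow> int^'n \<Rightarrow> real^'n" where
  "grid_point K k = (pi / real K) *\<^sub>R freq k"

definition interp :: "nat \<Rightarrow> (real^'n \<Rightarrow> complex) \<Rightarrow> real^'n \<Rightarrow> complex" where
  "interp K v =
     (THE p. p \<in> trig_poly K \<and> (\<forall>k\<in>modes K. p (grid_point K k) = v (grid_point K k)))"

definition partial_deriv :: "'n \<Rightarrow> (real^'n \<Rightarrow> complex) \<Rightarrow> real^'n \<Rightarrow> complex" where
  "partial_deriv i f x = vector_derivative (\<lambda>h. f (x + h *\<^sub>R axis i 1)) (at 0)"

text \<open>The classical Laplacian; only applied to trigonometric polynomials below.\<close>

definition laplacian :: "(real^'n \<Rightarrow> complex) \<Rightarrow> real^'n \<Rightarrow> complex" where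
  "laplacian f x = (\<Sum>i\<in>UNIV. partial_deriv i (partial_deriv i f) x)"

text \<open>
  The components \<open>uK\<close> and \<open>wK\<close> are complex-valued: since \<open>modes K\<close> contains the frequency \<open>-K\<close> but not
  \<open>K\<close>, the interpolant of a real function is real on the grid but in general not off the grid.
\<close>

definition collocation_solution ::
  "nat \<Rightarrow> real \<Rightarrow> real \<Rightarrow> (real^'n \<Rightarrow> complex) \<Rightarrow> (real^'n \<Rightarrow> complex) \<Rightarrow> (real^'n \<Rightarrow> complex)
    \<Rightarrow> (real \<Rightarrow> real^'n \<Rightarrow> complex) \<Rightarrow> (real \<Rightarrow> real^'n \<Rightarrow> complex)
    \<Rightarrow> (real \<Rightarrow> real^'n \<Rightarrow> complex) \<Rightarrow> bool" where
  "collocation_solution K t0 T \<psi>0 u0 w0 \<psi>K uK wK \<longleftrightarrow>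
     \<psi>K t0 = interp K \<psi>0 \<and> uK t0 = interp K u0 \<and> wK t0 = interp K w0 \<and>
     (\<forall>t\<in>{t0..t0 + T}.
        \<psi>K t \<in> trig_poly K \<and> uK t \<in> trig_poly K \<and> wK t \<in> trig_poly K \<and>
        (\<forall>x.
          ((\<lambda>\<tau>. \<i> * \<psi>K \<tau> x) has_vector_derivative
             - laplacian (\<psi>K t) x + interp K (\<lambda>y. uK t y * \<psi>K t y) x)
             (at t within {t0..t0 + T}) \<and>
          ((\<lambda>\<tau>. uK \<tau> x) has_vector_derivative wK t x) (at t within {t0..t0 + T}) \<and>
          ((\<lambda>\<tau>. wK \<tau> x) has_vector_derivative
             laplacian (uK t) x + laplacian (interp K (cfun (\<lambda>y. (cmod (\<psi>K t y))\<^sup>2))) x)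
             (at t within {t0..t0 + T})))"

end

theory Submission imports Defs "HOL-Probability.Discrete_Topology" begin

text \<open>
  Everything is done with Fourier coefficients. The exact solution becomes a system of ordinary
  differential equations for sequences on the lattice in which products are convolutions
  (\<open>exact_system\<close>), and the collocation method becomes a finite system in which each convolution is
  folded onto the retained modes by aliasing (\<open>numeric_system\<close>). Sobolev bounds are weighted square-sum
  bounds (\<open>hbound\<close>). For \<open>s > d/2\<close> they are stable under convolution (\<open>hbound_conv\<close>) and under aliasing
  (\<open>hbound_alias\<close>), and cutting off or folding back the modes outside \<open>modes K\<close> costs a factor
  \<open>K powr - \<sigma>\<close> when \<open>\<sigma>\<close> further derivatives are available (\<open>hbound_tail\<close>, \<open>hbound_alias_error\<close>). This gives
  the consistency estimate \<open>bilinear_error\<close> for products.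

  The obstacle is a loss of derivatives. The error \<open>e\<close> of \<open>\<psi>\<close> is wanted in \<open>H\<close> of order \<open>s + 2\<close>, because
  the wave equation is forced by the Laplacian of \<open>|\<psi>|\<^sup>2\<close>, but the Schroedinger equation is forced by the
  product \<open>u \<psi>\<close>, and the error of \<open>u\<close> is controlled only in order \<open>s + 1\<close>. The remedy is to estimate
  the time derivative \<open>h\<close> of \<open>e\<close> in place of its space derivatives. Differentiating the equation in time
  shows that \<open>h\<close> solves a Schroedinger equation forced by the error of \<open>w \<psi> + u \<psi>'\<close>, which is
  needed in order \<open>s\<close> only; and the undifferentiated equation expresses the Laplacian of \<open>e\<close> by \<open>h\<close> and
  the error of \<open>u \<psi>\<close>, which returns the two missing derivatives (\<open>recover_two_derivatives\<close>).

  With \<open>\<eta>\<close> and \<open>\<omega>\<close> the errors of \<open>u\<close> and of its time derivative \<open>w\<close>, the energy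
  \<open>E = |e|\<^sup>2 + |h|\<^sup>2 + |\<eta>|\<^sup>2 + |\<omega>|\<^sup>2\<close>, with norms of orders \<open>s\<close>, \<open>s\<close>, \<open>s + 1\<close>, \<open>s\<close> over the retained modes, satisfies
  \<open>E' \<le> L (E + K powr (- 2 \<sigma>))\<close> as long as the error is at most 1 (\<open>static_estimates\<close>,
  \<open>error_energy_derivative\<close>). Over the retained modes the numerical solution is compared with the Fourier
  truncation of the exact one and not with its interpolant: truncation commutes with the Laplacian and
  with time differentiation, so that only products produce defects. The Gronwall inequality yields an
  error of size \<open>K powr - \<sigma>\<close> (\<open>conditional_error_bound\<close>). For large \<open>K\<close> this is below \<open>1/2\<close>, hence by
  continuity the error never reaches 1 (\<open>bootstrap\<close>, \<open>coefficient_error_bound\<close>).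

  Existence of the collocation solution comes from the same estimate. The right-hand side of the
  collocation system is quadratic, and clipping the coefficients at a fixed radius makes it globally
  Lipschitz, so that the clipped system has a solution up to the final time (\<open>clipped_solution\<close>). That
  solution satisfies the collocation equations as long as its error is at most 1, and the continuation
  argument shows that this is always the case.
\<close>

section \<open>Weighted sequence spaces on the integer lattice\<close>

definition wt :: "int^'n \<Rightarrow> real" where
  "wt j = max (norm (freq j)) 1"

lemma freq_zero [simp]: "freq 0 = 0"
  and freq_minus: "freq (- j) = - freq j"
  and freq_add: "freq (j + k) = freq j + freq k"
  by (simp_all add: freq_def vec_eq_iff)

lemma wt_ge_1 [simp]: "1 \<le> wt j" and wt_pos [simp]: "0 < wt j"
  by (auto simp: wt_def)

lemma wt_nonneg [simp]: "0 \<le> wt j"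
  using wt_pos[of j] by linarith

lemma wt_neq_0 [simp]: "wt j \<noteq> 0"
  using wt_pos[of j] by linarith

lemma wt_minus [simp]: "wt (- j) = wt j"
  by (simp add: wt_def freq_minus)

lemma wt_triangle: "wt (j + k) \<le> wt j + wt k"
  using norm_triangle_ineq[of "freq j" "freq k"] by (auto simp: wt_def freq_add)

lemma wt_triangle': "wt j \<le> wt (j - l) + wt l"
  using wt_triangle[of "j - l" l] by simp

lemma component_le_wt: "\<bar>real_of_int (j $ i)\<bar> \<le> wt j"
proof -
  have "\<bar>freq j $ i\<bar> \<le> norm (freq j)" by (rule component_le_norm_cart)
  then show ?thesis by (simp add: wt_def freq_def)
qed

lemma wt_powr_mono: "a \<le> b \<Longrightarrow> wt j powr a \<le> wt j powr b"
  by (rule powr_mono) auto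

lemma sum_int_powr_bounded:
  fixes p :: real assumes "p > 1"
  shows "\<exists>S>0. \<forall>N::nat. (\<Sum>k\<in>{- int N..int N - 1}. (1 + \<bar>real_of_int k\<bar>) powr (- p)) \<le> S"
proof -
  define g :: "nat \<Rightarrow> real" where "g n = real (Suc n) powr (- p)" for n
  have "summable (\<lambda>n. real n powr (- p))"
    using assms by (subst summable_real_powr_iff) auto
  then have sg: "summable g" unfolding g_def by (subst summable_Suc_iff)
  have gpos: "0 < g n" for n by (simp add: g_def)
  have "(\<Sum>k\<in>{- int N..int N - 1}. (1 + \<bar>real_of_int k\<bar>) powr (- p)) \<le> 2 * suminf g" for N
  proof -
    have sub: "{- int N..int N - 1} \<subseteq> int ` {..N} \<union> (\<lambda>n. - int n) ` {..N}"
    proof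
      fix k assume k: "k \<in> {- int N..int N - 1}"
      show "k \<in> int ` {..N} \<union> (\<lambda>n. - int n) ` {..N}"
      proof (cases "k \<ge> 0")
        case True then have "k = int (nat k)" "nat k \<le> N" using k by auto
        then show ?thesis by blast
      next
        case False then have "k = - int (nat (-k))" "nat (-k) \<le> N" using k by auto
        then show ?thesis by blast
      qed
    qed
    let ?h = "\<lambda>k. (1 + \<bar>real_of_int k\<bar>) powr (- p)"
    have "sum ?h {- int N..int N - 1} \<le> sum ?h (int ` {..N} \<union> (\<lambda>n. - int n) ` {..N})"
      by (rule sum_mono2) (use sub in auto)
    also have "\<dots> \<le> sum ?h (int ` {..N}) + sum ?h ((\<lambda>n. - int n) ` {..N})"
      by (subst sum.union_inter[symmetric]) (auto intro: sum_nonneg)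
    also have "sum ?h (int ` {..N}) = sum g {..N}"
      by (subst sum.reindex) (auto simp: g_def inj_on_def add.commute)
    also have "sum ?h ((\<lambda>n. - int n) ` {..N}) = sum g {..N}"
      by (subst sum.reindex) (auto simp: g_def inj_on_def add.commute)
    also have "sum g {..N} + sum g {..N} \<le> 2 * suminf g"
      using sum_le_suminf[OF sg, of "{..N}"] gpos by (auto intro: less_imp_le)
    finally show ?thesis .
  qed
  moreover have "2 * suminf g > 0" using suminf_pos[OF sg] gpos by auto
  ultimately show ?thesis by blast
qed

lemma finite_subset_modes:
  fixes F :: "(int^'n) set" assumes "finite F" shows "\<exists>N. F \<subseteq> modes N"
proof -
  define N where "N = nat (\<lceil>\<Sum>j\<in>F. wt j\<rceil> + 1)"
  have "F \<subseteq> modes N"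
  proof
    fix j assume "j \<in> F"
    then have "wt j \<le> (\<Sum>j\<in>F. wt j)" by (intro member_le_sum) (auto simp: assms)
    then have S: "\<bar>real_of_int (j $ i)\<bar> \<le> (\<Sum>j\<in>F. wt j)" for i
      using component_le_wt[of j i] by linarith
    have "- int N \<le> j $ i \<and> j $ i \<le> int N - 1" for i
      using S[of i] unfolding N_def by linarith
    then show "j \<in> modes N" by (simp add: modes_def)
  qed
  then show ?thesis ..
qed

lemma sum_prod_modes:
  fixes g :: "'n::finite \<Rightarrow> int \<Rightarrow> 'a::comm_semiring_1"
  shows "(\<Sum>j\<in>(modes N :: (int^'n) set). \<Prod>i\<in>UNIV. g i (j $ i)) = (\<Prod>i\<in>UNIV. \<Sum>k\<in>{- int N..int N - 1}. g i k)"
proof -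
  have bij: "bij_betw ((\<lambda>f. \<chi> i. f i)) (UNIV \<rightarrow>\<^sub>E {- int N..int N - 1}) (modes N :: (int^'n) set)"
    by (rule bij_betwI[where g="\<lambda>j i. j $ i"]) (auto simp: modes_def vec_eq_iff PiE_iff)
  have "(\<Sum>j\<in>(modes N :: (int^'n) set). \<Prod>i\<in>UNIV. g i (j $ i))
      = (\<Sum>f\<in>(UNIV \<rightarrow>\<^sub>E {- int N..int N - 1}). \<Prod>i\<in>(UNIV::'n set). g i (f i))"
    by (subst sum.reindex_bij_betw[OF bij, symmetric]) simp
  also have "\<dots> = (\<Prod>i\<in>(UNIV::'n set). \<Sum>k\<in>{- int N..int N - 1}. g i k)"
    by (rule prod_sum_PiE[symmetric]) auto
  finally show ?thesis .
qed

text \<open>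
  Since \<open>1 + |j\<^sub>i| \<le> 2 * wt j\<close> for every component, \<open>wt j powr - r\<close> is at most a constant times the product
  over the \<open>d\<close> components of \<open>(1 + |j\<^sub>i|) powr - (r / d)\<close>. Summed over a cube this is a \<open>d\<close>-th power of a
  one-dimensional sum, which is bounded because \<open>r / d > 1\<close>.
\<close>

lemma lattice_sum_bounded:
  fixes r :: real assumes "r > CARD('n::finite)"
  shows "\<exists>S>0. \<forall>F::(int^'n) set. finite F \<longrightarrow> (\<Sum>j\<in>F. wt j powr (- r)) \<le> S"
proof -
  let ?d = "real CARD('n)"
  define p where "p = r / ?d"
  have d: "?d > 0" by simp
  have p: "p > 1" using assms d by (simp add: p_def field_simps)
  have pd: "p * ?d = r" using d by (simp add: p_def)
  obtain S where S: "S > 0"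
    "\<And>N::nat. (\<Sum>k\<in>{- int N..int N - 1}. (1 + \<bar>real_of_int k\<bar>) powr (- p)) \<le> S"
    using sum_int_powr_bounded[OF p] by blast
  have pt: "wt j powr (- r) \<le> 2 powr r * (\<Prod>i\<in>UNIV. (1 + \<bar>real_of_int (j $ i)\<bar>) powr (- p))" for j :: "int^'n"
  proof -
    have "(\<Prod>i\<in>(UNIV::'n set). (2 * wt j) powr (- p)) \<le> (\<Prod>i\<in>UNIV. (1 + \<bar>real_of_int (j $ i)\<bar>) powr (- p))"
    proof (rule prod_mono, intro conjI)
      fix i
      have "1 + \<bar>real_of_int (j $ i)\<bar> \<le> 2 * wt j"
        using component_le_wt[of j i] wt_ge_1[of j] by linarith
      then show "(2 * wt j) powr (- p) \<le> (1 + \<bar>real_of_int (j $ i)\<bar>) powr (- p)"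
        using p by (intro powr_mono2') auto
    qed simp
    moreover have "(\<Prod>i\<in>(UNIV::'n set). (2 * wt j) powr (- p)) = (2 * wt j) powr (- r)"
    proof -
      have "((2 * wt j) powr (- p)) ^ CARD('n) = ((2 * wt j) powr (- p)) powr ?d"
        by (rule powr_realpow[symmetric]) (simp add: less_imp_neq[OF wt_pos, symmetric])
      also have "\<dots> = (2 * wt j) powr (- r)" unfolding powr_powr using pd by simp
      finally show ?thesis by simp
    qed
    moreover have "2 powr r * (2 * wt j) powr (- r) = wt j powr (- r)"
      by (simp add: powr_mult powr_minus)
    ultimately show ?thesis
      by (metis mult_left_mono powr_ge_zero)
  qed
  have "(\<Sum>j\<in>F. wt j powr (- r)) \<le> 2 powr r * S ^ CARD('n)" if F: "finite F" for F :: "(int^'n) set"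
  proof -
    obtain N where N: "F \<subseteq> modes N" using finite_subset_modes[OF F] by blast
    have "(\<Sum>j\<in>F. wt j powr (- r)) \<le> (\<Sum>j\<in>(modes N :: (int^'n) set). wt j powr (- r))"
      by (rule sum_mono2) (use N finite_modes in auto)
    also have "\<dots> \<le> (\<Sum>j\<in>(modes N :: (int^'n) set). 2 powr r * (\<Prod>i\<in>UNIV. (1 + \<bar>real_of_int (j $ i)\<bar>) powr (- p)))"
      by (intro sum_mono pt)
    also have "\<dots> = 2 powr r * (\<Sum>k\<in>{- int N..int N - 1}. (1 + \<bar>real_of_int k\<bar>) powr (- p)) ^ CARD('n)"
      by (subst sum_distrib_left[symmetric]) (subst sum_prod_modes, simp)
    also have "\<dots> \<le> 2 powr r * S ^ CARD('n)"
      by (intro mult_left_mono power_mono S sum_nonneg) auto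
    finally show ?thesis .
  qed
  then show ?thesis using S(1) by (intro exI[of _ "2 powr r * S ^ CARD('n)"]) auto
qed

text \<open>
  The norm of \<open>c\<close> in \<open>H\<^sup>s\<close> is at most \<open>B\<close>. Quantifying over finite sets makes the statement carry its own
  summability, and it makes it stable under pointwise limits (\<open>hbound_limit\<close>), so that bounds for infinite
  sums follow from bounds for finite ones.
\<close>

definition hbound :: "real \<Rightarrow> (int^'n \<Rightarrow> complex) \<Rightarrow> real \<Rightarrow> bool" where
  "hbound s c B \<longleftrightarrow> (\<forall>F. finite F \<longrightarrow> L2_set (\<lambda>j. wt j powr s * cmod (c j)) F \<le> B)"

lemma hboundD: "hbound s c B \<Longrightarrow> finite F \<Longrightarrow> L2_set (\<lambda>j. wt j powr s * cmod (c j)) F \<le> B"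
  by (simp add: hbound_def)

lemma hbound_nonneg: "hbound s c B \<Longrightarrow> 0 \<le> B"
  using hboundD[of s c B "{}"] by simp

lemma wt_term_sq: "(wt j powr s * cmod z)\<^sup>2 = wt j powr (2 * s) * (cmod z)\<^sup>2"
  by (simp add: power_mult_distrib power2_eq_square powr_add[symmetric])

lemma hbound_sq:
  "hbound s c B \<longleftrightarrow> 0 \<le> B \<and> (\<forall>F. finite F \<longrightarrow> (\<Sum>j\<in>F. wt j powr (2 * s) * (cmod (c j))\<^sup>2) \<le> B\<^sup>2)"
proof -
  have "L2_set (\<lambda>j. wt j powr s * cmod (c j)) F \<le> B \<longleftrightarrow> (\<Sum>j\<in>F. wt j powr (2 * s) * (cmod (c j))\<^sup>2) \<le> B\<^sup>2"
    if "0 \<le> B" for F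
    unfolding L2_set_def wt_term_sq real_sqrt_le_iff[symmetric, of _ "B\<^sup>2"] using that by simp
  then show ?thesis using hbound_nonneg unfolding hbound_def by blast
qed

text \<open>
  The common source of the monotonicity properties: a pointwise comparison of weighted coefficients.
\<close>

lemma hbound_compare:
  fixes c :: "int^'n \<Rightarrow> complex"
  assumes "hbound s d B" and "\<And>j. wt j powr s' * cmod (c j) \<le> A * (wt j powr s * cmod (d j))" and "0 \<le> A"
  shows "hbound s' c (A * B)"
  unfolding hbound_def
proof (intro allI impI)
  fix F :: "(int^'n) set" assume F: "finite F"
  have "L2_set (\<lambda>j. wt j powr s' * cmod (c j)) F \<le> L2_set (\<lambda>j. A * (wt j powr s * cmod (d j))) F"
    by (intro L2_set_mono assms) auto
  also have "\<dots> = A * L2_set (\<lambda>j. wt j powr s * cmod (d j)) F"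
    using assms(3) by (rule L2_set_right_distrib[symmetric])
  also have "\<dots> \<le> A * B" by (intro mult_left_mono hboundD assms F)
  finally show "L2_set (\<lambda>j. wt j powr s' * cmod (c j)) F \<le> A * B" .
qed

lemma hbound_mono: "hbound s c B \<Longrightarrow> B \<le> B' \<Longrightarrow> hbound s c B'"
  unfolding hbound_def by (meson order_trans)

lemma hbound_cmod_le: "hbound s d B \<Longrightarrow> (\<And>j. cmod (c j) \<le> cmod (d j)) \<Longrightarrow> hbound s c B"
  using hbound_compare[of s d B s c 1] by (simp add: mult_left_mono)

lemma hbound_weaken: "hbound s c B \<Longrightarrow> s' \<le> s \<Longrightarrow> hbound s' c B"
  using hbound_compare[of s c B s' c 1] by (simp add: mult_right_mono wt_powr_mono)

lemma hbound_add:
  fixes c :: "int^'n \<Rightarrow> complex"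
  assumes "hbound s c B" "hbound s d D" shows "hbound s (\<lambda>j. c j + d j) (B + D)"
  unfolding hbound_def
proof (intro allI impI)
  fix F :: "(int^'n) set" assume F: "finite F"
  have "L2_set (\<lambda>j. wt j powr s * cmod (c j + d j)) F
     \<le> L2_set (\<lambda>j. wt j powr s * cmod (c j) + wt j powr s * cmod (d j)) F"
    by (intro L2_set_mono) (auto simp: distrib_left[symmetric] norm_triangle_ineq intro!: mult_left_mono)
  also have "\<dots> \<le> L2_set (\<lambda>j. wt j powr s * cmod (c j)) F + L2_set (\<lambda>j. wt j powr s * cmod (d j)) F"
    by (rule L2_set_triangle_ineq)
  also have "\<dots> \<le> B + D" by (intro add_mono hboundD assms F)
  finally show "L2_set (\<lambda>j. wt j powr s * cmod (c j + d j)) F \<le> B + D" .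
qed

lemma hbound_uminus: "hbound s (\<lambda>j. - c j) B \<longleftrightarrow> hbound s c B"
  by (simp add: hbound_def)

lemma hbound_diff:
  assumes "hbound s c B" "hbound s d D" shows "hbound s (\<lambda>j. c j - d j) (B + D)"
  using hbound_add[of s c B "\<lambda>j. - d j" D] assms by (simp add: hbound_uminus)

lemma hbound_reflect:
  fixes c :: "int^'n \<Rightarrow> complex"
  assumes "hbound s c B" shows "hbound s (\<lambda>j. cnj (c (- j))) B"
  unfolding hbound_def
proof (intro allI impI)
  fix F :: "(int^'n) set" assume F: "finite F"
  have "L2_set (\<lambda>j. wt j powr s * cmod (cnj (c (- j)))) F = L2_set (\<lambda>j. wt j powr s * cmod (c j)) (uminus ` F)"
    unfolding L2_set_def by (subst sum.reindex) (auto simp: inj_on_def)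
  also have "\<dots> \<le> B" using hboundD[OF assms, of "uminus ` F"] F by simp
  finally show "L2_set (\<lambda>j. wt j powr s * cmod (cnj (c (- j)))) F \<le> B" .
qed

lemma hbound_coeff_le: "hbound s c B \<Longrightarrow> wt j powr s * cmod (c j) \<le> B"
  using hboundD[of s c B "{j}"] by simp

text \<open>
  Each finite square sum is continuous in the coefficients that enter it.
\<close>

lemma hbound_limit:
  fixes c :: "int^'n \<Rightarrow> complex"
  assumes "\<And>j. ((\<lambda>n. z n j) \<longlongrightarrow> c j) Fl" and "\<forall>\<^sub>F n in Fl. hbound s (z n) B" and "Fl \<noteq> bot"
  shows "hbound s c B"
  unfolding hbound_def
proof (intro allI impI)
  fix F :: "(int^'n) set" assume F: "finite F"
  have "((\<lambda>n. L2_set (\<lambda>j. wt j powr s * cmod (z n j)) F) \<longlongrightarrow> L2_set (\<lambda>j. wt j powr s * cmod (c j)) F) Fl"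
    unfolding L2_set_def by (intro tendsto_intros assms)
  then show "L2_set (\<lambda>j. wt j powr s * cmod (c j)) F \<le> B"
    by (rule tendsto_upperbound) (use assms(2,3) F in \<open>auto elim!: eventually_mono intro: hboundD\<close>)
qed

text \<open>
  The Sobolev embedding on the side of the coefficients: by the Cauchy-Schwarz inequality against
  \<open>wt j powr - s\<close>, which is square summable for \<open>s > d/2\<close>.
\<close>

lemma hbound_l1_bound:
  fixes s :: real assumes "s > real CARD('n::finite) / 2"
  shows "\<exists>C>0. \<forall>(c::int^'n \<Rightarrow> complex) B F. hbound s c B \<longrightarrow> finite F \<longrightarrow> (\<Sum>j\<in>F. cmod (c j)) \<le> C * B"
proof -
  have "2 * s > real CARD('n)" using assms by simp
  then obtain S where S: "S > 0" "\<And>F::(int^'n) set. finite F \<Longrightarrow> (\<Sum>j\<in>F. wt j powr (- (2 * s))) \<le> S"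
    using lattice_sum_bounded[of "2 * s", where 'n='n] by blast
  have "(\<Sum>j\<in>F. cmod (c j)) \<le> sqrt S * B" if c: "hbound s c B" and F: "finite F"
    for c :: "int^'n \<Rightarrow> complex" and B and F
  proof -
    have "(\<Sum>j\<in>F. cmod (c j)) = (\<Sum>j\<in>F. \<bar>wt j powr (- s)\<bar> * \<bar>wt j powr s * cmod (c j)\<bar>)"
      by (intro sum.cong) (auto simp: abs_mult powr_minus)
    also have "\<dots> \<le> L2_set (\<lambda>j. wt j powr (- s)) F * L2_set (\<lambda>j. wt j powr s * cmod (c j)) F"
      by (rule L2_set_mult_ineq)
    also have "\<dots> \<le> sqrt S * B"
    proof (rule mult_mono)
      have "L2_set (\<lambda>j. wt j powr (- s)) F = sqrt (\<Sum>j\<in>F. wt j powr (- (2 * s)))"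
        unfolding L2_set_def by (simp add: power2_eq_square powr_add[symmetric])
      also have "\<dots> \<le> sqrt S" using S(2)[OF F] by simp
      finally show "L2_set (\<lambda>j. wt j powr (- s)) F \<le> sqrt S" .
    qed (use c F S in \<open>auto intro: hboundD\<close>)
    finally show ?thesis .
  qed
  then show ?thesis using S(1) by (intro exI[of _ "sqrt S"]) auto
qed

abbreviation l1 :: "(int^'n \<Rightarrow> complex) \<Rightarrow> bool" where
  "l1 c \<equiv> (\<lambda>j. cmod (c j)) summable_on UNIV"

lemma hbound_l1:
  fixes c :: "int^'n \<Rightarrow> complex"
  assumes "s > real CARD('n::finite) / 2" "hbound s c B"
  shows "l1 c"
proof -
  obtain C where "\<And>F. finite F \<Longrightarrow> (\<Sum>j\<in>F. cmod (c j)) \<le> C * B"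
    using hbound_l1_bound[OF assms(1)] assms(2) by blast
  then have "bdd_above (sum (\<lambda>j. cmod (c j)) ` {F. F \<subseteq> UNIV \<and> finite F})"
    by (intro bdd_aboveI2[where M="C * B"]) simp
  then show ?thesis
    by (rule nonneg_bdd_above_summable_on[rotated]) simp
qed

section \<open>Convolution and aliasing\<close>

definition conv :: "(int^'n \<Rightarrow> complex) \<Rightarrow> (int^'n \<Rightarrow> complex) \<Rightarrow> int^'n \<Rightarrow> complex" where
  "conv x y j = (\<Sum>\<^sub>\<infinity>l\<in>UNIV. x (j - l) * y l)"

text \<open>
  The exponentials with frequencies in \<open>alias_class K j\<close> are those that coincide with the \<open>j\<close>-th one on
  the grid with spacing \<open>\<pi> / K\<close>. Hence \<open>aliased\<close> gives the coefficients of the interpolant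
  (\<open>expands_interp_coeff\<close>).
\<close>

definition alias_class :: "nat \<Rightarrow> int^'n \<Rightarrow> (int^'n) set" where
  "alias_class K j = {k. \<forall>i. 2 * int K dvd k $ i - j $ i}"

definition aliased :: "nat \<Rightarrow> (int^'n \<Rightarrow> complex) \<Rightarrow> int^'n \<Rightarrow> complex" where
  "aliased K x j = (\<Sum>\<^sub>\<infinity>k\<in>alias_class K j. x k)"

definition trunc :: "nat \<Rightarrow> (int^'n \<Rightarrow> complex) \<Rightarrow> int^'n \<Rightarrow> complex" where
  "trunc K x j = (if j \<in> modes K then x j else 0)"

lemma l1_summable: "l1 c \<Longrightarrow> c summable_on A"
  by (metis abs_summable_summable summable_on_subset_banach top_greatest)

lemma l1_compare: "l1 d \<Longrightarrow> (\<And>j. cmod (c j) \<le> cmod (d j)) \<Longrightarrow> l1 c"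
  using Infinite_Sum.abs_summable_on_comparison_test[of d UNIV c] by simp

lemma l1_scale: "l1 c \<Longrightarrow> l1 (\<lambda>j. a * c j)"
  using summable_on_cmult_right[of "\<lambda>j. cmod (c j)" UNIV "cmod a"] by (simp add: norm_mult)

lemma l1_bounded: assumes "l1 c" shows "\<exists>B. \<forall>j. cmod (c j) \<le> B"
proof -
  have "cmod (c j) \<le> (\<Sum>\<^sub>\<infinity>j\<in>UNIV. cmod (c j))" for j
    using finite_sum_le_infsum[OF assms, of "{j}"] by simp
  then show ?thesis by blast
qed

lemma l1_reindex: 
  fixes c :: "int^'n \<Rightarrow> complex"
  assumes "l1 c" "bij g" shows "l1 (\<lambda>j. c (g j))"
  using summable_on_reindex_bij_betw[of g UNIV UNIV "\<lambda>j. cmod (c j)"] assms by (simp add: o_def)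

lemma conv_summable:
  assumes "l1 x" "l1 y" shows "l1 (\<lambda>l. x (j - l) * y l)"
proof -
  obtain B where B: "\<And>j. cmod (x j) \<le> B" using l1_bounded[OF assms(1)] by blast
  have "l1 (\<lambda>l. complex_of_real B * y l)" by (rule l1_scale[OF assms(2)])
  then show ?thesis
    by (rule l1_compare)
       (use B norm_ge_zero order_trans in \<open>auto simp: norm_mult intro!: mult_right_mono intro: order_trans[OF B abs_ge_self]\<close>)
qed

lemma conv_tendsto:
  assumes "l1 x" "l1 y"
  shows "((\<lambda>G. \<Sum>l\<in>G. x (j - l) * y l) \<longlongrightarrow> conv x y j) (finite_subsets_at_top UNIV)"
  unfolding conv_def by (rule infsum_tendsto) (rule l1_summable[OF conv_summable[OF assms]])

lemma infsum_minus:
  fixes f g :: "'a \<Rightarrow> complex" assumes "f summable_on A" "g summable_on A"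
  shows "(\<Sum>\<^sub>\<infinity>x\<in>A. f x - g x) = infsum f A - infsum g A"
  using infsum_add[OF assms(1) summable_on_uminus[THEN iffD2, OF assms(2)]] by (simp add: infsum_uminus)

lemma conv_diff_left: "l1 x \<Longrightarrow> l1 x' \<Longrightarrow> l1 y \<Longrightarrow> conv (\<lambda>j. x j - x' j) y j = conv x y j - conv x' y j"
  unfolding conv_def by (simp add: left_diff_distrib infsum_minus l1_summable conv_summable)

lemma conv_diff_right: "l1 x \<Longrightarrow> l1 y \<Longrightarrow> l1 y' \<Longrightarrow> conv x (\<lambda>j. y j - y' j) j = conv x y j - conv x y' j"
  unfolding conv_def by (simp add: right_diff_distrib infsum_minus l1_summable conv_summable)

lemma alias_diff: "l1 x \<Longrightarrow> l1 y \<Longrightarrow> aliased K (\<lambda>j. x j - y j) j = aliased K x j - aliased K y j"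
  unfolding aliased_def by (simp add: infsum_minus l1_summable)

lemma wt_powr_sq: "(wt j powr a)\<^sup>2 = wt j powr (2 * a)"
  by (simp add: power2_eq_square powr_add[symmetric])

lemma modes_abs_le: "j \<in> modes K \<Longrightarrow> \<bar>j $ i\<bar> \<le> int K"
proof -
  assume "j \<in> modes K"
  then have "- int K \<le> j $ i \<and> j $ i \<le> int K - 1" by (simp add: modes_def)
  then show ?thesis by linarith
qed

text \<open>
  The larger of \<open>wt (j - l)\<close> and \<open>wt l\<close> is at least half of \<open>wt j\<close>, so it can absorb the weight of \<open>j\<close>.
\<close>

lemma weight_product_bound:
  assumes "s > 0"
  shows "wt j powr (2 * s) * (wt (j - l) powr (- (2 * s)) * wt l powr (- (2 * s)))
       \<le> 2 powr (2 * s) * (wt l powr (- (2 * s)) + wt (j - l) powr (- (2 * s)))"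
proof -
  let ?a = "wt (j - l)" and ?b = "wt l"
  have "wt j powr (2 * s) \<le> (2 * max ?a ?b) powr (2 * s)"
    using assms wt_triangle'[of j l] by (intro powr_mono2) (auto simp: max_def)
  also have "\<dots> = 2 powr (2 * s) * max ?a ?b powr (2 * s)" by (simp add: powr_mult)
  also have "\<dots> \<le> 2 powr (2 * s) * (?a powr (2 * s) + ?b powr (2 * s))"
    by (intro mult_left_mono) (auto simp: max_def)
  finally have "wt j powr (2 * s) * (?a powr (- (2 * s)) * ?b powr (- (2 * s)))
     \<le> 2 powr (2 * s) * (?a powr (2 * s) + ?b powr (2 * s)) * (?a powr (- (2 * s)) * ?b powr (- (2 * s)))"
    by (rule mult_right_mono) auto
  also have "\<dots> = 2 powr (2 * s) * (?b powr (- (2 * s)) + ?a powr (- (2 * s)))"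
    by (simp add: powr_minus field_simps)
  finally show ?thesis .
qed

text \<open>
  The algebra property of \<open>H\<^sup>s\<close>. Writing each summand of the convolution with the factor
  \<open>wt j powr s / (wt (j - l) powr s * wt l powr s)\<close> split off and applying the Cauchy-Schwarz inequality in \<open>l\<close>,
  the squares of these factors have a sum that is bounded uniformly in \<open>j\<close>, and the remaining double sum
  of squares factorises.
\<close>

lemma hbound_conv:
  fixes s :: real assumes s: "s > real CARD('n::finite) / 2"
  shows "\<exists>C>0. \<forall>(x::int^'n \<Rightarrow> complex) y X Y. hbound s x X \<longrightarrow> hbound s y Y \<longrightarrow> hbound s (conv x y) (C * X * Y)"
proof -
  have s0: "s > 0" using s by (smt (verit) divide_nonneg_nonneg of_nat_0_le_iff)
  have "2 * s > real CARD('n)" using s by simp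
  then obtain S where S: "S > 0" "\<And>F::(int^'n) set. finite F \<Longrightarrow> (\<Sum>j\<in>F. wt j powr (- (2 * s))) \<le> S"
    using lattice_sum_bounded[of "2 * s", where 'n='n] by blast
  define C2 where "C2 = 2 powr (2 * s) * (S + S)"
  have C2: "C2 > 0" using S by (simp add: C2_def)
  have "hbound s (conv x y) (sqrt C2 * X * Y)" if x: "hbound s x X" and y: "hbound s y Y"
    for x y :: "int^'n \<Rightarrow> complex" and X Y
  proof (rule hbound_limit[where z="\<lambda>G j. \<Sum>l\<in>G. x (j - l) * y l" and Fl="finite_subsets_at_top UNIV"])
    show "((\<lambda>G. \<Sum>l\<in>G. x (j - l) * y l) \<longlongrightarrow> conv x y j) (finite_subsets_at_top UNIV)" for j
      by (intro conv_tendsto hbound_l1[OF s x] hbound_l1[OF s y])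
    have X: "X \<ge> 0" and Y: "Y \<ge> 0" using x y hbound_nonneg by auto
    have "hbound s (\<lambda>j. \<Sum>l\<in>G. x (j - l) * y l) (sqrt C2 * X * Y)" if G: "finite G" for G
      unfolding hbound_sq
    proof (intro conjI allI impI)
      show "0 \<le> sqrt C2 * X * Y" using C2 X Y by simp
      fix F :: "(int^'n) set" assume F: "finite F"
      let ?X = "\<lambda>j. wt j powr s * cmod (x j)" and ?Y = "\<lambda>j. wt j powr s * cmod (y j)"
      \<comment> \<open>The part of the summand that is left when both sequences are weighted.\<close>
      let ?om = "\<lambda>j l. wt j powr s * (wt (j - l) powr (- s) * wt l powr (- s))"
      have pt: "wt j powr (2 * s) * (cmod (\<Sum>l\<in>G. x (j - l) * y l))\<^sup>2 \<le> C2 * (\<Sum>l\<in>G. (?X (j - l))\<^sup>2 * (?Y l)\<^sup>2)" for j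
      proof -
        have "wt j powr s * cmod (\<Sum>l\<in>G. x (j - l) * y l) \<le> wt j powr s * (\<Sum>l\<in>G. cmod (x (j - l)) * cmod (y l))"
          by (intro mult_left_mono sum_norm_le) (auto simp: norm_mult)
        also have "\<dots> = (\<Sum>l\<in>G. ?om j l * (?X (j - l) * ?Y l))"
          unfolding sum_distrib_left by (intro sum.cong) (auto simp: powr_minus field_simps)
        finally have "(wt j powr s * cmod (\<Sum>l\<in>G. x (j - l) * y l))\<^sup>2 \<le> (\<Sum>l\<in>G. ?om j l * (?X (j - l) * ?Y l))\<^sup>2"
          by (intro power_mono) auto
        also have "\<dots> \<le> (\<Sum>l\<in>G. (?om j l)\<^sup>2) * (\<Sum>l\<in>G. (?X (j - l) * ?Y l)\<^sup>2)"
          by (rule Cauchy_Schwarz_ineq_sum)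
        also have "\<dots> \<le> C2 * (\<Sum>l\<in>G. (?X (j - l) * ?Y l)\<^sup>2)"
        proof (rule mult_right_mono)
          have "(\<Sum>l\<in>G. (?om j l)\<^sup>2) = (\<Sum>l\<in>G. wt j powr (2 * s) * (wt (j - l) powr (- (2 * s)) * wt l powr (- (2 * s))))"
            by (simp add: power_mult_distrib wt_powr_sq)
          also have "\<dots> \<le> (\<Sum>l\<in>G. 2 powr (2 * s) * (wt l powr (- (2 * s)) + wt (j - l) powr (- (2 * s))))"
            by (intro sum_mono weight_product_bound s0)
          also have "\<dots> = 2 powr (2 * s) * ((\<Sum>l\<in>G. wt l powr (- (2 * s))) + (\<Sum>l\<in>(\<lambda>l. j - l) ` G. wt l powr (- (2 * s))))"
            by (subst sum.reindex) (auto simp: inj_on_def sum_distrib_left[symmetric] sum.distrib)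
          also have "\<dots> \<le> C2"
            unfolding C2_def by (intro mult_left_mono add_mono S) (auto simp: G)
          finally show "(\<Sum>l\<in>G. (?om j l)\<^sup>2) \<le> C2" .
        qed (auto intro: sum_nonneg)
        finally show ?thesis by (simp add: wt_powr_sq power_mult_distrib)
      qed
      have "(\<Sum>j\<in>F. wt j powr (2 * s) * (cmod (\<Sum>l\<in>G. x (j - l) * y l))\<^sup>2)
          \<le> (\<Sum>j\<in>F. C2 * (\<Sum>l\<in>G. (?X (j - l))\<^sup>2 * (?Y l)\<^sup>2))"
        by (intro sum_mono pt)
      also have "\<dots> = C2 * (\<Sum>l\<in>G. (\<Sum>j\<in>F. (?X (j - l))\<^sup>2) * (?Y l)\<^sup>2)"
        unfolding sum_distrib_left[symmetric] sum_distrib_right by (subst sum.swap) simp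
      also have "\<dots> \<le> C2 * (\<Sum>l\<in>G. X\<^sup>2 * (?Y l)\<^sup>2)"
      proof (intro mult_left_mono sum_mono mult_right_mono)
        fix l
        have "(\<Sum>j\<in>F. (?X (j - l))\<^sup>2) = (\<Sum>j\<in>(\<lambda>j. j - l) ` F. wt j powr (2 * s) * (cmod (x j))\<^sup>2)"
          by (subst sum.reindex) (auto simp: inj_on_def wt_term_sq)
        also have "\<dots> \<le> X\<^sup>2" using x F unfolding hbound_sq by simp
        finally show "(\<Sum>j\<in>F. (?X (j - l))\<^sup>2) \<le> X\<^sup>2" .
      qed (use C2 in auto)
      also have "\<dots> = C2 * X\<^sup>2 * (\<Sum>l\<in>G. wt l powr (2 * s) * (cmod (y l))\<^sup>2)"
        by (simp add: sum_distrib_left wt_term_sq mult.assoc)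
      also have "\<dots> \<le> C2 * X\<^sup>2 * Y\<^sup>2"
        using y G C2 unfolding hbound_sq by (intro mult_left_mono) auto
      also have "\<dots> = (sqrt C2 * X * Y)\<^sup>2" using C2 by (simp add: power_mult_distrib)
      finally show "(\<Sum>j\<in>F. wt j powr (2 * s) * (cmod (\<Sum>l\<in>G. x (j - l) * y l))\<^sup>2) \<le> (sqrt C2 * X * Y)\<^sup>2" .
    qed
    then show "\<forall>\<^sub>F G in finite_subsets_at_top UNIV. hbound s (\<lambda>j. \<Sum>l\<in>G. x (j - l) * y l) (sqrt C2 * X * Y)"
      by (auto simp: eventually_finite_subsets_at_top)
  qed simp
  then show ?thesis using C2 by (intro exI[of _ "sqrt C2"]) auto
qed

lemma wt_le_modes:
  assumes "j \<in> modes K" "K \<ge> 1" 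
  shows "wt (j::int^'n) \<le> sqrt (real CARD('n)) * real K"
proof -
  have "norm (freq j) = sqrt (\<Sum>i\<in>UNIV. (real_of_int (j $ i))\<^sup>2)"
    by (simp add: norm_vec_def L2_set_def freq_def)
  also have "\<dots> \<le> sqrt (\<Sum>i\<in>(UNIV::'n set). (real K)\<^sup>2)"
  proof (intro real_sqrt_le_mono sum_mono)
    fix i
    have "\<bar>j $ i\<bar> \<le> int K" by (rule modes_abs_le[OF assms(1)])
    then have "\<bar>real_of_int (j $ i)\<bar> \<le> \<bar>real K\<bar>" by linarith
    then show "(real_of_int (j $ i))\<^sup>2 \<le> (real K)\<^sup>2" by (simp add: abs_le_square_iff[symmetric])
  qed
  also have "\<dots> = sqrt (real CARD('n)) * real K" by (simp add: real_sqrt_mult)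
  finally have "norm (freq j) \<le> sqrt (real CARD('n)) * real K" .
  moreover have "1 * 1 \<le> sqrt (real CARD('n)) * real K"
    using assms by (intro mult_mono) auto
  ultimately show ?thesis by (simp add: wt_def)
qed

lemma wt_ge_off_modes:
  assumes "j \<notin> modes K" shows "real K \<le> wt j"
proof -
  obtain i where "\<not> (- int K \<le> j $ i \<and> j $ i \<le> int K - 1)" using assms by (auto simp: modes_def)
  then have "int K \<le> \<bar>j $ i\<bar>" by linarith
  then have "real K \<le> \<bar>real_of_int (j $ i)\<bar>" by linarith
  then show ?thesis using component_le_wt[of j i] by linarith
qed

text \<open>
  A component \<open>m\<^sub>i \<noteq> 0\<close> shifts by at least \<open>2 K |m\<^sub>i|\<close>, of which \<open>j\<close> can undo at most \<open>K \<le> K |m\<^sub>i|\<close>. The shifted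
  frequency therefore has size at least \<open>K |m|\<close>, whereas \<open>j\<close> itself has size at most \<open>sqrt d * K\<close>.
\<close>

lemma alias_class_shift:
  fixes j m :: "int^'n" assumes "j \<in> modes K" "K \<ge> 1"
  shows "wt j * wt m \<le> sqrt (real CARD('n)) * wt (j + (\<chi> i. 2 * int K * m $ i))"
proof (cases "m = 0")
  case True
  have "1 * wt j \<le> sqrt (real CARD('n)) * wt j" by (intro mult_right_mono) auto
  moreover have "j + (\<chi> i. 2 * int K * m $ i) = j" using True by (simp add: vec_eq_iff)
  moreover have "wt m = 1" using True by (simp add: wt_def)
  ultimately show ?thesis by simp
next
  case False
  let ?k = "j + (\<chi> i. 2 * int K * m $ i)"
  have cmp: "real K * \<bar>freq m $ i\<bar> \<le> \<bar>freq ?k $ i\<bar>" for i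
  proof -
    have j: "\<bar>j $ i\<bar> \<le> int K" by (rule modes_abs_le[OF assms(1)])
    have "int K * \<bar>m $ i\<bar> \<le> \<bar>j $ i + 2 * int K * m $ i\<bar>"
    proof (cases "m $ i = 0")
      case False
      then have "int K * 1 \<le> int K * \<bar>m $ i\<bar>" by (intro mult_left_mono) auto
      moreover have "\<bar>2 * int K * m $ i\<bar> = 2 * (int K * \<bar>m $ i\<bar>)" by (simp add: abs_mult)
      ultimately show ?thesis using j by linarith
    qed simp
    then have "real_of_int (int K * \<bar>m $ i\<bar>) \<le> real_of_int \<bar>j $ i + 2 * int K * m $ i\<bar>" by linarith
    then show ?thesis by (simp add: freq_def)
  qed
  have "norm (real K *\<^sub>R freq m) \<le> norm (freq ?k)"
    by (rule norm_le_componentwise_cart) (use cmp in \<open>simp add: abs_mult\<close>)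
  then have 1: "real K * norm (freq m) \<le> wt ?k" by (simp add: wt_def)
  obtain i where i: "m $ i \<noteq> 0" using False by (auto simp: vec_eq_iff)
  have "1 \<le> \<bar>freq m $ i\<bar>" using i by (simp add: freq_def)
  also have "\<dots> \<le> norm (freq m)" by (rule component_le_norm_cart)
  finally have 2: "wt m = norm (freq m)" by (simp add: wt_def)
  have "wt j * wt m \<le> sqrt (real CARD('n)) * real K * wt m"
    by (intro mult_right_mono wt_le_modes assms) auto
  also have "\<dots> \<le> sqrt (real CARD('n)) * wt ?k"
    using 1 2 by (simp add: mult.assoc mult_left_mono)
  finally show ?thesis .
qed

text \<open>
  The frequencies aliased to \<open>j\<close> are indexed by the lattice vectors \<open>m\<close> of their shifts, and by
  \<open>alias_class_shift\<close> their weights relative to that of \<open>j\<close> grow like \<open>wt m\<close>. So the sum reduces to the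
  lattice sum, uniformly in \<open>K\<close> and \<open>j\<close>.
\<close>

lemma alias_class_weight_sum:
  fixes s :: real assumes s: "s > real CARD('n::finite) / 2"
  shows "\<exists>C>0. \<forall>K\<ge>1. \<forall>j\<in>modes K. \<forall>P::(int^'n) set. finite P \<longrightarrow> P \<subseteq> alias_class K j
     \<longrightarrow> wt j powr (2 * s) * (\<Sum>k\<in>P. wt k powr (- (2 * s))) \<le> C"
proof -
  have s0: "s > 0" using s by (smt (verit) divide_nonneg_nonneg of_nat_0_le_iff)
  have "2 * s > real CARD('n)" using s by simp
  then obtain S where S: "S > 0" "\<And>F::(int^'n) set. finite F \<Longrightarrow> (\<Sum>j\<in>F. wt j powr (- (2 * s))) \<le> S"
    using lattice_sum_bounded[of "2 * s", where 'n='n] by blast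
  define D where "D = sqrt (real CARD('n)) powr (2 * s)"
  have "wt j powr (2 * s) * (\<Sum>k\<in>P. wt k powr (- (2 * s))) \<le> D * S"
    if K: "K \<ge> 1" and j: "j \<in> modes K" and P: "finite P" "P \<subseteq> alias_class K j" for K j and P :: "(int^'n) set"
  proof -
    define q where "q k = (\<chi> i. (k $ i - j $ i) div (2 * int K))" for k :: "int^'n"
    have q: "k = j + (\<chi> i. 2 * int K * q k $ i)" if "k \<in> P" for k
      using that P(2) by (auto simp: q_def vec_eq_iff alias_class_def)
    have inj: "inj_on q P" by (rule inj_onI) (metis q)
    have pt: "wt j powr (2 * s) * wt k powr (- (2 * s)) \<le> D * wt (q k) powr (- (2 * s))" if "k \<in> P" for k
    proof -
      have "wt j * wt (q k) \<le> sqrt (real CARD('n)) * wt k"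
        using alias_class_shift[OF j K, of "q k"] q[OF that] by simp
      then have "(wt j * wt (q k)) powr (2 * s) \<le> (sqrt (real CARD('n)) * wt k) powr (2 * s)"
        using s0 by (intro powr_mono2) auto
      then show ?thesis by (simp add: powr_mult D_def powr_minus field_simps)
    qed
    have "wt j powr (2 * s) * (\<Sum>k\<in>P. wt k powr (- (2 * s))) \<le> (\<Sum>k\<in>P. D * wt (q k) powr (- (2 * s)))"
      unfolding sum_distrib_left by (intro sum_mono pt)
    also have "\<dots> = D * (\<Sum>m\<in>q ` P. wt m powr (- (2 * s)))"
      by (subst sum.reindex[OF inj]) (simp add: sum_distrib_left)
    also have "\<dots> \<le> D * S" using S(2)[of "q ` P"] P(1) by (intro mult_left_mono) (auto simp: D_def)
    finally show ?thesis .
  qed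
  moreover have "D * S > 0" using S by (simp add: D_def)
  ultimately show ?thesis by blast
qed

lemma alias_class_disjoint:
  assumes "j \<in> modes K" "j' \<in> modes K" "k \<in> alias_class K j" "k \<in> alias_class K j'"
  shows "j = j'"
proof -
  have "j $ i = j' $ i" for i
  proof -
    have "2 * int K dvd (k $ i - j $ i) - (k $ i - j' $ i)"
      using assms unfolding alias_class_def by (intro dvd_diff[of _ "k $ i - j $ i" "k $ i - j' $ i"]) blast+
    then have d: "2 * int K dvd j' $ i - j $ i" by simp
    have "- int K \<le> j $ i" "j $ i \<le> int K - 1" "- int K \<le> j' $ i" "j' $ i \<le> int K - 1"
      using assms by (auto simp: modes_def)
    then have "\<bar>j' $ i - j $ i\<bar> < 2 * int K" by linarith
    with d show ?thesis using dvd_imp_le_int[of "j' $ i - j $ i" "2 * int K"] by fastforce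
  qed
  then show ?thesis by (simp add: vec_eq_iff)
qed

text \<open>
  Aliasing is bounded uniformly in \<open>K\<close>: by the Cauchy-Schwarz inequality on each class and
  \<open>alias_class_weight_sum\<close>, the weighted square at \<open>j\<close> is at most a constant times the weighted square sum
  over the class of \<open>j\<close>, and the classes of different modes are disjoint.
\<close>

lemma hbound_alias:
  fixes s :: real assumes s: "s > real CARD('n::finite) / 2"
  shows "\<exists>C>0. \<forall>K\<ge>1. \<forall>(x::int^'n \<Rightarrow> complex) X. hbound s x X \<longrightarrow> hbound s (trunc K (aliased K x)) (C * X)"
proof -
  obtain C where C: "C > 0" and C2: "\<forall>K\<ge>1. \<forall>j\<in>modes K. \<forall>P::(int^'n) set. finite P \<longrightarrow> P \<subseteq> alias_class K j
     \<longrightarrow> wt j powr (2 * s) * (\<Sum>k\<in>P. wt k powr (- (2 * s))) \<le> C"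
    using alias_class_weight_sum[OF s] by blast
  have "hbound s (trunc K (aliased K x)) (sqrt C * X)" if K: "K \<ge> 1" and x: "hbound s x X"
    for K and x :: "int^'n \<Rightarrow> complex" and X
    unfolding hbound_sq
  proof (intro conjI allI impI)
    have X: "X \<ge> 0" using x hbound_nonneg by auto
    then show "0 \<le> sqrt C * X" using C by simp
    fix F :: "(int^'n) set" assume F: "finite F"
    let ?F = "F \<inter> modes K" and ?X = "\<lambda>k. wt k powr s * cmod (x k)"
    have L: "(\<Sum>j\<in>F. wt j powr (2 * s) * (cmod (trunc K (aliased K x) j))\<^sup>2)
      = (\<Sum>j\<in>?F. wt j powr (2 * s) * (cmod (aliased K x j))\<^sup>2)"
      by (intro sum.mono_neutral_cong_right) (auto simp: trunc_def F)
    have fin: "(\<Sum>j\<in>?F. wt j powr (2 * s) * (cmod (\<Sum>k\<in>alias_class K j \<inter> G. x k))\<^sup>2) \<le> C * X\<^sup>2"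
      if G: "finite G" for G
    proof -
      have pt: "wt j powr (2 * s) * (cmod (\<Sum>k\<in>alias_class K j \<inter> G. x k))\<^sup>2
          \<le> C * (\<Sum>k\<in>alias_class K j \<inter> G. (?X k)\<^sup>2)" if j: "j \<in> modes K" for j
      proof -
        let ?P = "alias_class K j \<inter> G"
        have "cmod (\<Sum>k\<in>?P. x k) \<le> (\<Sum>k\<in>?P. wt k powr (-s) * ?X k)"
          by (rule sum_norm_le) (simp add: powr_minus field_simps)
        then have "(cmod (\<Sum>k\<in>?P. x k))\<^sup>2 \<le> (\<Sum>k\<in>?P. wt k powr (-s) * ?X k)\<^sup>2"
          by (intro power_mono) auto
        also have "\<dots> \<le> (\<Sum>k\<in>?P. (wt k powr (-s))\<^sup>2) * (\<Sum>k\<in>?P. (?X k)\<^sup>2)"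
          by (rule Cauchy_Schwarz_ineq_sum)
        also have "(\<Sum>k\<in>?P. (wt k powr (-s))\<^sup>2) = (\<Sum>k\<in>?P. wt k powr (- (2 * s)))"
          by (simp add: power2_eq_square powr_add[symmetric])
        finally have "wt j powr (2 * s) * (cmod (\<Sum>k\<in>?P. x k))\<^sup>2
           \<le> (wt j powr (2 * s) * (\<Sum>k\<in>?P. wt k powr (- (2 * s)))) * (\<Sum>k\<in>?P. (?X k)\<^sup>2)"
          by (simp add: mult.assoc mult_left_mono)
        also have "\<dots> \<le> C * (\<Sum>k\<in>?P. (?X k)\<^sup>2)"
          using C2[rule_format, OF K j, of ?P] G by (intro mult_right_mono) (auto intro: sum_nonneg)
        finally show ?thesis .
      qed
      have "(\<Sum>j\<in>?F. wt j powr (2 * s) * (cmod (\<Sum>k\<in>alias_class K j \<inter> G. x k))\<^sup>2)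
        \<le> C * (\<Sum>j\<in>?F. \<Sum>k\<in>alias_class K j \<inter> G. (?X k)\<^sup>2)"
      proof (subst sum_distrib_left, rule sum_mono)
        fix j assume "j \<in> ?F"
        then show "wt j powr (2 * s) * (cmod (\<Sum>k\<in>alias_class K j \<inter> G. x k))\<^sup>2
           \<le> C * (\<Sum>k\<in>alias_class K j \<inter> G. (?X k)\<^sup>2)" by (intro pt) simp
      qed
      also have "(\<Sum>j\<in>?F. \<Sum>k\<in>alias_class K j \<inter> G. (?X k)\<^sup>2) = (\<Sum>k\<in>(\<Union>j\<in>?F. alias_class K j \<inter> G). (?X k)\<^sup>2)"
      proof (rule sum.UNION_disjoint[symmetric])
        show "\<forall>j\<in>?F. \<forall>j'\<in>?F. j \<noteq> j' \<longrightarrow> alias_class K j \<inter> G \<inter> (alias_class K j' \<inter> G) = {}"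
          using alias_class_disjoint by blast
      qed (use F G in simp_all)
      also have "\<dots> \<le> (\<Sum>k\<in>G. (?X k)\<^sup>2)" by (rule sum_mono2) (use G in auto)
      also have "\<dots> \<le> X\<^sup>2" using x G unfolding hbound_sq wt_term_sq by blast
      finally show ?thesis using C by (simp add: mult_left_mono)
    qed
    have xs: "x summable_on alias_class K j" for j
      by (rule l1_summable[OF hbound_l1[OF s x]])
    have "((\<lambda>G. \<Sum>k\<in>alias_class K j \<inter> G. x k) \<longlongrightarrow> aliased K x j) (finite_subsets_at_top UNIV)" for j
    proof -
      have "((\<lambda>k. if k \<in> alias_class K j then x k else 0) has_sum aliased K x j) UNIV"
        using has_sum_infsum[OF xs[of j]] unfolding aliased_def
        by (subst has_sum_cong_neutral[where S=UNIV and T="alias_class K j" and g=x]) auto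
      then have "((\<lambda>G. \<Sum>k\<in>G. if k \<in> alias_class K j then x k else 0) \<longlongrightarrow> aliased K x j) (finite_subsets_at_top UNIV)"
        by (simp add: has_sum_def)
      then show ?thesis
        by (rule Lim_transform_eventually)
           (intro eventually_finite_subsets_at_top_weakI, subst Int_commute, rule sum.inter_restrict[symmetric])
    qed
    then have "((\<lambda>G. \<Sum>j\<in>?F. wt j powr (2 * s) * (cmod (\<Sum>k\<in>alias_class K j \<inter> G. x k))\<^sup>2)
       \<longlongrightarrow> (\<Sum>j\<in>?F. wt j powr (2 * s) * (cmod (aliased K x j))\<^sup>2)) (finite_subsets_at_top UNIV)"
      by (intro tendsto_intros)
    then have "(\<Sum>j\<in>?F. wt j powr (2 * s) * (cmod (aliased K x j))\<^sup>2) \<le> C * X\<^sup>2"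
      by (rule tendsto_upperbound) (simp_all add: eventually_finite_subsets_at_top_weakI fin)
    then show "(\<Sum>j\<in>F. wt j powr (2 * s) * (cmod (trunc K (aliased K x) j))\<^sup>2) \<le> (sqrt C * X)\<^sup>2"
      using C unfolding L by (simp add: power_mult_distrib)
  qed
  then show ?thesis using C by (intro exI[of _ "sqrt C"]) auto
qed

lemma hbound_trunc: "hbound s x X \<Longrightarrow> hbound s (trunc K x) X"
  by (rule hbound_cmod_le) (auto simp: trunc_def)

lemma hbound_tail:
  assumes "hbound (s + \<sigma>) x X" "\<sigma> \<ge> 0" "K \<ge> 1"
  shows "hbound s (\<lambda>j. x j - trunc K x j) (real K powr (- \<sigma>) * X)"
proof (rule hbound_compare[OF assms(1)])
  fix j
  show "wt j powr s * cmod (x j - trunc K x j) \<le> real K powr (- \<sigma>) * (wt j powr (s + \<sigma>) * cmod (x j))"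
  proof (cases "j \<in> modes K")
    case False
    have "real K powr \<sigma> \<le> wt j powr \<sigma>"
      using wt_ge_off_modes[OF False] assms by (intro powr_mono2) auto
    then have "1 \<le> real K powr (- \<sigma>) * wt j powr \<sigma>"
      using assms(3) by (simp add: powr_minus field_simps)
    then have "wt j powr s * cmod (x j) * 1 \<le> wt j powr s * cmod (x j) * (real K powr (- \<sigma>) * wt j powr \<sigma>)"
      by (intro mult_left_mono) auto
    then show ?thesis using False by (simp add: trunc_def powr_add mult_ac)
  qed (simp add: trunc_def)
qed simp

lemma alias_trunc:
  assumes "j \<in> modes K" shows "aliased K (trunc K x) j = x j"
proof -
  have "aliased K (trunc K x) j = (\<Sum>\<^sub>\<infinity>k\<in>{j}. x k)" unfolding aliased_def
  proof (rule infsum_cong_neutral)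
    fix k assume "k \<in> alias_class K j - {j}"
    then have "k \<notin> modes K" using alias_class_disjoint[OF assms, of k k] by (auto simp: alias_class_def)
    then show "trunc K x k = 0" by (simp add: trunc_def)
  qed (use assms in \<open>auto simp: trunc_def alias_class_def\<close>)
  then show ?thesis by simp
qed

text \<open>
  Interpolation reproduces the retained modes (\<open>alias_trunc\<close>), so the interpolation error in these modes
  is the aliased tail, and the tail already has the factor \<open>K powr - \<sigma>\<close>.
\<close>

lemma hbound_alias_error:
  fixes s :: real assumes s: "s > real CARD('n::finite) / 2" and \<sigma>: "\<sigma> \<ge> 0"
  shows "\<exists>C>0. \<forall>K\<ge>1. \<forall>(x::int^'n \<Rightarrow> complex) X. hbound (s + \<sigma>) x X
    \<longrightarrow> hbound s (trunc K (\<lambda>j. x j - aliased K x j)) (C * (real K powr (- \<sigma>) * X))"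
proof -
  obtain C where C: "C > 0" "\<And>K (x::int^'n \<Rightarrow> complex) X. K \<ge> 1 \<Longrightarrow> hbound s x X \<Longrightarrow> hbound s (trunc K (aliased K x)) (C * X)"
    using hbound_alias[OF s] by blast
  have "hbound s (trunc K (\<lambda>j. x j - aliased K x j)) (C * (real K powr (- \<sigma>) * X))"
    if K: "K \<ge> 1" and x: "hbound (s + \<sigma>) x X" for K and x :: "int^'n \<Rightarrow> complex" and X
  proof -
    have xs: "hbound s x X" using x \<sigma> by (rule_tac hbound_weaken) auto
    have l: "l1 x" "l1 (trunc K x)" using hbound_l1[OF s] xs hbound_trunc by blast+
    have "hbound s (trunc K (aliased K (\<lambda>j. x j - trunc K x j))) (C * (real K powr (- \<sigma>) * X))"
      by (intro C K hbound_tail x \<sigma>)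
    moreover have "trunc K (aliased K (\<lambda>j. x j - trunc K x j)) = (\<lambda>j. - trunc K (\<lambda>j. x j - aliased K x j) j)"
    proof
      fix j
      show "trunc K (aliased K (\<lambda>j. x j - trunc K x j)) j = - trunc K (\<lambda>j. x j - aliased K x j) j"
        using alias_diff[OF l, of K j] alias_trunc[of j K x] by (simp add: trunc_def[of K "aliased K _"] trunc_def[of K "\<lambda>j. x j - aliased K x j"])
    qed
    ultimately show ?thesis by (simp add: hbound_uminus)
  qed
  then show ?thesis using C(1) by blast
qed

text \<open>
  With \<open>I\<close> for interpolation, \<open>x y - I (p q) = (x y - I (x y)) + I ((x - p) y + p (y - q))\<close>. The first
  difference is an interpolation error of the product, which is as smooth as its factors; the second is
  controlled by the stability of aliasing. The approximations \<open>p\<close> and \<open>q\<close> are arbitrary sequences because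
  the conjugate of a trigonometric polynomial has its frequencies in the reflection of \<open>modes K\<close>, which
  contains \<open>K\<close> in place of \<open>- K\<close>.
\<close>

lemma bilinear_error:
  fixes s :: real assumes s: "s > real CARD('n::finite) / 2" and \<sigma>: "\<sigma> \<ge> 0"
  shows "\<exists>C>0. \<forall>K\<ge>1. \<forall>(x::int^'n \<Rightarrow> complex) y p q X Y P Dx Dy.
     hbound (s + \<sigma>) x X \<longrightarrow> hbound (s + \<sigma>) y Y \<longrightarrow> hbound s p P \<longrightarrow>
     hbound s (\<lambda>j. x j - p j) Dx \<longrightarrow> hbound s (\<lambda>j. y j - q j) Dy \<longrightarrow>
     hbound s (trunc K (\<lambda>j. conv x y j - aliased K (conv p q) j)) (C * (real K powr (- \<sigma>) * X * Y + Dx * Y + P * Dy))"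
proof -
  have s\<sigma>: "s + \<sigma> > real CARD('n) / 2" using s \<sigma> by simp
  obtain A where A: "A > 0" "\<And>K (x::int^'n \<Rightarrow> complex) X. K \<ge> 1 \<Longrightarrow> hbound s x X \<Longrightarrow> hbound s (trunc K (aliased K x)) (A * X)"
    using hbound_alias[OF s] by blast
  obtain E where E: "E > 0" "\<And>K (x::int^'n \<Rightarrow> complex) X. K \<ge> 1 \<Longrightarrow> hbound (s + \<sigma>) x X
    \<Longrightarrow> hbound s (trunc K (\<lambda>j. x j - aliased K x j)) (E * (real K powr (- \<sigma>) * X))"
    using hbound_alias_error[OF s \<sigma>] by blast
  obtain C1 where C1: "C1 > 0" "\<And>(x::int^'n \<Rightarrow> complex) y X Y. hbound s x X \<Longrightarrow> hbound s y Y \<Longrightarrow> hbound s (conv x y) (C1 * X * Y)"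
    using hbound_conv[OF s] by blast
  obtain C2 where C2: "C2 > 0" "\<And>(x::int^'n \<Rightarrow> complex) y X Y. hbound (s+\<sigma>) x X \<Longrightarrow> hbound (s+\<sigma>) y Y \<Longrightarrow> hbound (s+\<sigma>) (conv x y) (C2 * X * Y)"
    using hbound_conv[OF s\<sigma>] by blast
  define C where "C = E * C2 + A * C1"
  have C: "E * C2 \<le> C" "A * C1 \<le> C" "C > 0" using A(1) E(1) C1(1) C2(1) by (auto simp: C_def intro!: add_pos_pos)
  have "hbound s (trunc K (\<lambda>j. conv x y j - aliased K (conv p q) j)) (C * (real K powr (- \<sigma>) * X * Y + Dx * Y + P * Dy))"
    if K: "K \<ge> 1" and x: "hbound (s + \<sigma>) x X" and y: "hbound (s + \<sigma>) y Y" and p: "hbound s p P"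
      and dx: "hbound s (\<lambda>j. x j - p j) Dx" and dy: "hbound s (\<lambda>j. y j - q j) Dy"
    for K and x y p q :: "int^'n \<Rightarrow> complex" and X Y P Dx Dy
  proof -
    have xs: "hbound s x X" and ys: "hbound s y Y" using x y \<sigma> by (auto intro: hbound_weaken)
    have "hbound s (\<lambda>j. y j - (y j - q j)) (Y + Dy)" by (rule hbound_diff[OF ys dy])
    then have q: "hbound s q (Y + Dy)" by simp
    note lx = hbound_l1[OF s xs] and ly = hbound_l1[OF s ys] and lp = hbound_l1[OF s p] and lq = hbound_l1[OF s q]
    note ldx = hbound_l1[OF s dx] and ldy = hbound_l1[OF s dy]
    have xy: "hbound (s+\<sigma>) (conv x y) (C2 * X * Y)" by (rule C2(2)[OF x y])
    have xys: "hbound s (conv x y) (C1 * X * Y)" by (rule C1(2)[OF xs ys])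
    have pq: "hbound s (conv p q) (C1 * P * (Y + Dy))" by (rule C1(2)[OF p q])
    have d: "conv x y j - conv p q j = conv (\<lambda>j. x j - p j) y j + conv p (\<lambda>j. y j - q j) j" for j
      by (simp add: conv_diff_left conv_diff_right lx ly lp lq)
    have "hbound s (\<lambda>j. conv (\<lambda>j. x j - p j) y j + conv p (\<lambda>j. y j - q j) j) (C1 * Dx * Y + C1 * P * Dy)"
      by (intro hbound_add C1 dx ys p dy)
    then have "hbound s (\<lambda>j. conv x y j - conv p q j) (C1 * Dx * Y + C1 * P * Dy)" by (simp add: d)
    then have 1: "hbound s (trunc K (aliased K (\<lambda>j. conv x y j - conv p q j))) (A * (C1 * Dx * Y + C1 * P * Dy))"
      by (rule A(2)[OF K])
    have 2: "hbound s (trunc K (\<lambda>j. conv x y j - aliased K (conv x y) j)) (E * (real K powr (- \<sigma>) * (C2 * X * Y)))"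
      by (rule E(2)[OF K xy])
    have eq: "trunc K (\<lambda>j. conv x y j - aliased K (conv p q) j) =
       (\<lambda>j. trunc K (\<lambda>j. conv x y j - aliased K (conv x y) j) j + trunc K (aliased K (\<lambda>j. conv x y j - conv p q j)) j)"
      by (auto simp: trunc_def alias_diff[OF hbound_l1[OF s xys] hbound_l1[OF s pq]])
    have "hbound s (trunc K (\<lambda>j. conv x y j - aliased K (conv p q) j))
       (E * (real K powr (- \<sigma>) * (C2 * X * Y)) + A * (C1 * Dx * Y + C1 * P * Dy))"
      unfolding eq by (rule hbound_add[OF 2 1])
    moreover have "E * (real K powr (- \<sigma>) * (C2 * X * Y)) + A * (C1 * Dx * Y + C1 * P * Dy)
      \<le> C * (real K powr (- \<sigma>) * X * Y + Dx * Y + P * Dy)"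
    proof -
      have nn: "X \<ge> 0" "Y \<ge> 0" "P \<ge> 0" "Dx \<ge> 0" "Dy \<ge> 0"
        using x y p dx dy hbound_nonneg by blast+
      have "(E * C2) * (real K powr (- \<sigma>) * X * Y) + (A * C1) * (Dx * Y + P * Dy)
         \<le> C * (real K powr (- \<sigma>) * X * Y) + C * (Dx * Y + P * Dy)"
        using nn C by (intro add_mono mult_right_mono) auto
      then show ?thesis by (simp add: algebra_simps)
    qed
    ultimately show ?thesis by (rule hbound_mono)
  qed
  then show ?thesis using C(3) by blast
qed

section \<open>Absolutely convergent Fourier series\<close>

lemma fourier_exp_add: "fourier_exp (j + k) x = fourier_exp j x * fourier_exp k x"
  by (simp add: fourier_exp_def freq_add inner_add_left distrib_left exp_add)

lemma fourier_exp_zero [simp]: "fourier_exp 0 x = 1"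
  by (simp add: fourier_exp_def)

lemma fourier_exp_minus: "fourier_exp (- j) x = cnj (fourier_exp j x)"
  by (simp add: fourier_exp_def freq_minus exp_cnj)

lemma norm_fourier_exp [simp]: "cmod (fourier_exp j x) = 1"
  by (simp add: fourier_exp_def)

lemma continuous_fourier_exp [continuous_intros]: "continuous_on S (fourier_exp j)"
  unfolding fourier_exp_def by (intro continuous_intros)

lemma freq_inner_int: "freq j \<bullet> freq k = real_of_int (\<Sum>i\<in>UNIV. j $ i * k $ i)"
  by (simp add: inner_vec_def freq_def)

lemma exp_2pi_int: "exp (\<i> * complex_of_real (2 * pi * real_of_int n)) = 1"
  by (subst exp_eq_1) (auto intro: exI[of _ n])

lemma periodic_fourier_exp: "periodic (fourier_exp j)"
proof -
  have "fourier_exp j (x + (2 * pi) *\<^sub>R freq k) = fourier_exp j x" for x k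
  proof -
    have "fourier_exp j (x + (2 * pi) *\<^sub>R freq k)
       = exp (\<i> * complex_of_real (freq j \<bullet> x) + \<i> * complex_of_real (2 * pi * (freq j \<bullet> freq k)))"
      by (simp add: fourier_exp_def inner_add_right algebra_simps)
    also have "\<dots> = fourier_exp j x"
      unfolding freq_inner_int exp_add exp_2pi_int by (simp add: fourier_exp_def)
    finally show ?thesis .
  qed
  then show ?thesis by (simp add: periodic_def)
qed

lemma fourier_exp_shift [simp]: "fourier_exp j (x + (2 * pi) *\<^sub>R freq k) = fourier_exp j x"
  using periodic_fourier_exp[of j] by (simp add: periodic_def)

lemma mem_torus_cell: "x \<in> torus_cell \<longleftrightarrow> (\<forall>i. - pi \<le> x $ i \<and> x $ i \<le> pi)"
  by (simp add: torus_cell_def mem_box_cart)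

lemma exists_torus_representative: "\<exists>k. x + (2 * pi) *\<^sub>R freq k \<in> torus_cell"
proof -
  define n where "n i = \<lfloor>(x $ i + pi) / (2 * pi)\<rfloor>" for i
  have "x + (2 * pi) *\<^sub>R freq (\<chi> i. - n i) \<in> torus_cell"
    unfolding mem_torus_cell
  proof
    fix i
    have "real_of_int (n i) \<le> (x $ i + pi) / (2 * pi)" "(x $ i + pi) / (2 * pi) < real_of_int (n i) + 1"
      unfolding n_def by linarith+
    then have "2 * pi * real_of_int (n i) \<le> x $ i + pi" "x $ i + pi < 2 * pi * (real_of_int (n i) + 1)"
      by (simp_all add: field_simps)
    then show "- pi \<le> (x + (2 * pi) *\<^sub>R freq (\<chi> i. - n i)) $ i \<and> (x + (2 * pi) *\<^sub>R freq (\<chi> i. - n i)) $ i \<le> pi"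
      by (simp add: freq_def algebra_simps)
  qed
  then show ?thesis by blast
qed

lemma integrable_on_cell: "continuous_on UNIV f \<Longrightarrow> (f :: real^'n \<Rightarrow> complex) integrable_on torus_cell"
  unfolding torus_cell_def by (rule integrable_continuous) (rule continuous_on_subset, auto)

lemma set_integrable_cell:
  fixes f :: "real^'n \<Rightarrow> 'a::{banach, second_countable_topology}"
  shows "continuous_on UNIV f \<Longrightarrow> set_integrable lborel torus_cell f"
  unfolding torus_cell_def set_integrable_def
  by (rule borel_integrable_compact) (auto intro: continuous_on_subset)

lemma cell_integral:
  fixes f :: "real^'n \<Rightarrow> complex"
  shows "continuous_on UNIV f \<Longrightarrow> (LINT x:torus_cell|lborel. f x) = integral torus_cell f"
  by (rule set_borel_integral_eq_integral(2)[OF set_integrable_cell])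

lemma fourier_coeff_integral:
  fixes v :: "real^'n \<Rightarrow> complex"
  assumes "continuous_on UNIV v"
  shows "fourier_coeff v j = integral torus_cell (\<lambda>x. v x * fourier_exp (- j) x) / (2 * complex_of_real pi) ^ CARD('n)"
  unfolding fourier_coeff_def
  by (subst cell_integral) (auto intro!: continuous_intros assms)

lemma integral_exp_int_frequency:
  "(\<integral>t. indicator {- pi..pi} t *\<^sub>R exp (\<i> * complex_of_real (real_of_int m * t)) \<partial>lborel) = (if m = 0 then 2 * complex_of_real pi else 0)"
proof (cases "m = 0")
  case True
  have "(\<integral>t. indicator {- pi..pi} t *\<^sub>R (1::complex) \<partial>lborel) = complex_of_real pi - complex_of_real (- pi)"
    by (rule integral_FTC_Icc) (auto intro!: derivative_eq_intros has_vector_derivative_of_real)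
  then show ?thesis using True by simp
next
  case False
  define F where "F t = exp (\<i> * complex_of_real (real_of_int m * t)) / (\<i> * of_int m)" for t
  have "(\<integral>t. indicator {- pi..pi} t *\<^sub>R exp (\<i> * complex_of_real (real_of_int m * t)) \<partial>lborel) = F pi - F (- pi)"
  proof (rule integral_FTC_Icc)
    show "(F has_vector_derivative exp (\<i> * complex_of_real (real_of_int m * x))) (at x within {- pi..pi})" for x
    proof -
      have "((\<lambda>z. exp (\<i> * (of_int m * z)) / (\<i> * of_int m)) has_field_derivative exp (\<i> * (of_int m * complex_of_real x))) (at (complex_of_real x))"
        by (auto intro!: derivative_eq_intros simp: False field_simps)
      from has_vector_derivative_real_field[OF this] show ?thesis unfolding F_def by simp
    qed
  qed (auto intro!: continuous_intros)
  also have "F pi = F (- pi)"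
  proof -
    have "exp (\<i> * complex_of_real (real_of_int m * pi)) = exp (\<i> * complex_of_real (real_of_int m * (- pi)) + \<i> * complex_of_real (2 * pi * real_of_int m))"
      by (simp add: algebra_simps)
    then show ?thesis unfolding F_def exp_add exp_2pi_int by simp
  qed
  finally show ?thesis using False by simp
qed

text \<open>
  On the cell the exponential is a product of functions of the single coordinates, so its integral is the
  product of one-dimensional ones.
\<close>

lemma integral_fourier_exp:
  "(LINT x:torus_cell|lborel. fourier_exp j x) = (if j = 0 then (2 * complex_of_real pi) ^ CARD('n) else 0)"
  for j :: "int^'n"
proof -
  define g :: "real^'n \<Rightarrow> real \<Rightarrow> complex"
    where "g b t = indicator {- pi..pi} t *\<^sub>R exp (\<i> * complex_of_real ((freq j \<bullet> b) * t))" for b t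
  interpret product_sigma_finite "\<lambda>_::real^'n. lborel :: real measure" by standard
  have gm: "integrable lborel (g b)" for b
    unfolding g_def by (rule borel_integrable_compact) (auto intro!: continuous_intros)
  have [measurable]: "g b \<in> borel_measurable borel" for b
    using borel_measurable_integrable[OF gm[of b]] by simp
  have bval: "integral\<^sup>L lborel (g (axis i 1)) = (if j $ i = 0 then 2 * complex_of_real pi else 0)" for i
    unfolding g_def using integral_exp_int_frequency[of "j $ i"] by (simp add: freq_def inner_axis)
  have pt: "indicator torus_cell x *\<^sub>R fourier_exp j x = (\<Prod>b\<in>Basis. g b (x \<bullet> b))" for x :: "real^'n"
  proof -
    have "(\<Prod>b\<in>Basis. g b (x \<bullet> b)) = (\<Prod>b\<in>Basis. indicator {- pi..pi} (x \<bullet> b) :: complex) * (\<Prod>b\<in>Basis. exp (\<i> * complex_of_real ((freq j \<bullet> b) * (x \<bullet> b))))"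
      by (simp add: g_def prod.distrib scaleR_conv_of_real of_real_indicator)
    also have "(\<Prod>b\<in>Basis. exp (\<i> * complex_of_real ((freq j \<bullet> b) * (x \<bullet> b)))) = fourier_exp j x"
      by (simp add: exp_sum[symmetric] sum_distrib_left[symmetric] fourier_exp_def euclidean_inner[of "freq j" x])
    also have "(\<Prod>b\<in>Basis. indicator {- pi..pi} (x \<bullet> b) :: complex) = indicator torus_cell x"
      by (auto simp: indicator_def mem_torus_cell Basis_vec_def inner_axis prod_eq_1_iff intro!: prod.neutral)
    finally show ?thesis by (simp add: scaleR_conv_of_real of_real_indicator)
  qed
  have "(LINT x:torus_cell|lborel. fourier_exp j x) = (\<integral>x. (\<Prod>b\<in>Basis. g b (x \<bullet> b)) \<partial>(lborel :: (real^'n) measure))"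
    unfolding set_lebesgue_integral_def pt ..
  also have "\<dots> = (\<integral>f. (\<Prod>b\<in>Basis. g b ((\<Sum>b'\<in>Basis. f b' *\<^sub>R b') \<bullet> b)) \<partial>(\<Pi>\<^sub>M b\<in>(Basis :: (real^'n) set). lborel))"
    by (subst lborel_eq, subst integral_distr) auto
  also have "\<dots> = (\<integral>f. (\<Prod>b\<in>Basis. g b (f b)) \<partial>(\<Pi>\<^sub>M b\<in>(Basis :: (real^'n) set). lborel))"
    by (intro Bochner_Integration.integral_cong refl prod.cong) (simp add: inner_sum_left inner_Basis if_distrib cong: if_cong)
  also have "\<dots> = (\<Prod>b\<in>(Basis :: (real^'n) set). integral\<^sup>L lborel (g b))"
    by (rule product_integral_prod) (auto simp: gm)
  also have "\<dots> = (\<Prod>i\<in>(UNIV::'n set). integral\<^sup>L lborel (g (axis i 1)))"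
  proof -
    have B: "(Basis :: (real^'n) set) = range (\<lambda>i. axis i 1)" by (auto simp: Basis_vec_def)
    have I: "inj (\<lambda>i::'n. axis i (1::real))" by (auto simp: inj_on_def axis_eq_axis)
    show ?thesis unfolding B by (subst prod.reindex[OF I]) simp
  qed
  also have "\<dots> = (if j = 0 then (2 * complex_of_real pi) ^ CARD('n) else 0)"
    unfolding bval by (auto simp: vec_eq_iff)
  finally show ?thesis .
qed

lemma fourier_coeff_exp: "fourier_coeff (fourier_exp k) j = (if j = k then 1 else 0)"
proof -
  have "(LINT x:torus_cell|lborel. fourier_exp k x * fourier_exp (- j) x) = (LINT x:torus_cell|lborel. fourier_exp (k - j) x)"
    by (simp add: fourier_exp_add[symmetric])
  then show ?thesis unfolding fourier_coeff_def integral_fourier_exp by auto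
qed

lemma fourier_coeff_add:
  assumes "continuous_on UNIV v" "continuous_on UNIV w"
  shows "fourier_coeff (\<lambda>x. v x + w x) j = fourier_coeff v j + fourier_coeff w j"
  unfolding fourier_coeff_integral[OF assms(1)] fourier_coeff_integral[OF assms(2)] fourier_coeff_integral[OF continuous_on_add[OF assms]]
  by (simp add: distrib_right integral_add integrable_on_cell continuous_intros assms add_divide_distrib)

lemma fourier_coeff_cmult:
  assumes "continuous_on UNIV v"
  shows "fourier_coeff (\<lambda>x. c * v x) j = c * fourier_coeff v j"
  unfolding fourier_coeff_integral[OF assms] fourier_coeff_integral[OF continuous_on_mult_left[OF assms]]
  by (simp add: mult.assoc)

lemma fourier_coeff_diff:
  assumes "continuous_on UNIV v" "continuous_on UNIV w"
  shows "fourier_coeff (\<lambda>x. v x - w x) j = fourier_coeff v j - fourier_coeff w j"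
  using fourier_coeff_add[of v "\<lambda>x. (-1) * w x" j] fourier_coeff_cmult[of w "-1" j] assms
  by (simp add: continuous_on_minus)

lemma fourier_coeff_sum:
  assumes "finite G" "\<And>i. i \<in> G \<Longrightarrow> continuous_on UNIV (v i)"
  shows "fourier_coeff (\<lambda>x. \<Sum>i\<in>G. v i x) j = (\<Sum>i\<in>G. fourier_coeff (v i) j)"
  using assms
proof (induction G)
  case empty
  then show ?case by (simp add: fourier_coeff_def set_lebesgue_integral_def)
next
  case (insert i G)
  then show ?case by (simp add: fourier_coeff_add continuous_on_sum)
qed

lemma fourier_coeff_mult_exp: "fourier_coeff (\<lambda>x. v x * fourier_exp l x) j = fourier_coeff v (j - l)"
proof -
  have "(\<lambda>x. v x * fourier_exp l x * fourier_exp (- j) x) = (\<lambda>x. v x * fourier_exp (- (j - l)) x)"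
    by (simp add: mult.assoc fourier_exp_add[symmetric])
  then show ?thesis unfolding fourier_coeff_def by (simp only:)
qed

lemma fourier_coeff_cnj:
  assumes "continuous_on UNIV v"
  shows "fourier_coeff (\<lambda>x. cnj (v x)) j = cnj (fourier_coeff v (- j))"
proof -
  have c: "continuous_on UNIV (\<lambda>x. v x * fourier_exp j x)" by (intro continuous_intros assms)
  have "(\<lambda>x. cnj (v x) * fourier_exp (- j) x) = cnj \<circ> (\<lambda>x. v x * fourier_exp j x)"
    by (auto simp: fourier_exp_minus)
  then have "integral torus_cell (\<lambda>x. cnj (v x) * fourier_exp (- j) x) = cnj (integral torus_cell (\<lambda>x. v x * fourier_exp j x))"
    using integral_cnj[of torus_cell "\<lambda>x. v x * fourier_exp j x"] by (simp add: o_def)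
  then show ?thesis using assms
    by (simp add: fourier_coeff_integral continuous_on_cnj)
qed

lemma fourier_coeff_norm_le:
  fixes v :: "real^'n \<Rightarrow> complex"
  shows "\<exists>C\<ge>0. \<forall>(v::real^'n \<Rightarrow> complex) B j. continuous_on UNIV v \<longrightarrow> (\<forall>x. cmod (v x) \<le> B) \<longrightarrow> cmod (fourier_coeff v j) \<le> C * B"
proof -
  let ?c = "measure lborel (torus_cell :: (real^'n) set) / (2 * pi) ^ CARD('n)"
  have "cmod (fourier_coeff v j) \<le> ?c * B"
    if v: "continuous_on UNIV v" and B: "\<And>x. cmod (v x) \<le> B" for v :: "real^'n \<Rightarrow> complex" and B j
  proof -
    have "B \<ge> 0" using B[of 0] norm_ge_zero[of "v 0"] by linarith
    moreover have "continuous_on UNIV (\<lambda>x. v x * fourier_exp (- j) x)" by (intro continuous_intros v)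
    ultimately have "cmod (integral torus_cell (\<lambda>x. v x * fourier_exp (- j) x)) \<le> B * measure lborel (torus_cell :: (real^'n) set)"
      unfolding torus_cell_def
      by (intro integrable_bound) (auto simp: norm_mult B torus_cell_def[symmetric] intro: integrable_on_cell)
    then show ?thesis unfolding fourier_coeff_integral[OF v]
      by (simp add: norm_divide norm_power norm_mult divide_right_mono mult.commute)
  qed
  then show ?thesis by (intro exI[of _ ?c]) auto
qed

lemma fourier_coeff_uniform_limit:
  fixes g :: "real^'n \<Rightarrow> complex"
  assumes "uniform_limit UNIV f g Fl" "\<And>n. continuous_on UNIV (f n)" "continuous_on UNIV g"
  shows "((\<lambda>n. fourier_coeff (f n) j) \<longlongrightarrow> fourier_coeff g j) Fl"
proof (rule tendstoI)
  fix e :: real assume e: "e > 0"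
  obtain C where C: "C \<ge> 0" "\<And>(v::real^'n \<Rightarrow> complex) B. continuous_on UNIV v \<Longrightarrow> (\<forall>x. cmod (v x) \<le> B) \<Longrightarrow> cmod (fourier_coeff v j) \<le> C * B"
    using fourier_coeff_norm_le by blast
  have "e / (C + 1) > 0" using e C(1) by simp
  then have "\<forall>\<^sub>F n in Fl. \<forall>x\<in>UNIV. dist (f n x) (g x) < e / (C + 1)"
    using assms(1) unfolding uniform_limit_iff by blast
  then show "\<forall>\<^sub>F n in Fl. dist (fourier_coeff (f n) j) (fourier_coeff g j) < e"
  proof eventually_elim
    case (elim n)
    have "cmod (fourier_coeff (\<lambda>x. f n x - g x) j) \<le> C * (e / (C + 1))"
      using elim by (intro C(2) continuous_intros assms) (auto simp: dist_norm less_imp_le)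
    also have "\<dots> < e" using e C(1) by (simp add: field_simps)
    finally show ?case by (simp add: dist_norm fourier_coeff_diff assms)
  qed
qed

text \<open>
  Absolute convergence of the Fourier series, together with its sum. All functions that occur in the
  convergence proof are of this kind, and for them multiplication and conjugation can be read off from
  the coefficients.
\<close>

definition expands :: "(real^'n \<Rightarrow> complex) \<Rightarrow> (int^'n \<Rightarrow> complex) \<Rightarrow> bool" where
  "expands v z \<longleftrightarrow> l1 z \<and> (\<forall>x. v x = (\<Sum>\<^sub>\<infinity>j\<in>UNIV. z j * fourier_exp j x))"

lemma expands_uniform_limit:
  assumes "expands v z"
  shows "uniform_limit UNIV (\<lambda>G x. \<Sum>j\<in>G. z j * fourier_exp j x) v (finite_subsets_at_top UNIV)"
proof -
  have "uniform_limit UNIV (\<lambda>G x. \<Sum>j\<in>G. z j * fourier_exp j x) (\<lambda>x. \<Sum>\<^sub>\<infinity>j\<in>UNIV. z j * fourier_exp j x) (finite_subsets_at_top UNIV)"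
    by (rule Weierstrass_m_test_general[where M="\<lambda>j. cmod (z j)"])
       (use assms in \<open>auto simp: expands_def norm_mult\<close>)
  moreover have "v = (\<lambda>x. \<Sum>\<^sub>\<infinity>j\<in>UNIV. z j * fourier_exp j x)" using assms by (auto simp: expands_def)
  ultimately show ?thesis by simp
qed

lemma expands_tendsto:
  assumes "expands v z"
  shows "((\<lambda>G. \<Sum>j\<in>G. z j * fourier_exp j x) \<longlongrightarrow> v x) (finite_subsets_at_top UNIV)"
  by (rule tendsto_uniform_limitI[OF expands_uniform_limit[OF assms]]) simp

lemma expands_torus_continuous:
  assumes "expands v z" shows "torus_continuous v"
proof -
  have "continuous_on UNIV v"
    by (rule uniform_limit_theorem[OF _ expands_uniform_limit[OF assms]])
       (auto intro!: always_eventually continuous_intros)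
  moreover have "periodic v"
    using assms unfolding expands_def periodic_def by simp
  ultimately show ?thesis by (simp add: torus_continuous_def)
qed

text \<open>
  The series converges uniformly, and Fourier coefficients are continuous under uniform convergence.
\<close>

lemma expands_fourier_coeff:
  assumes "expands v z" shows "fourier_coeff v k = z k"
proof -
  have fc: "fourier_coeff (\<lambda>x. \<Sum>j\<in>G. z j * fourier_exp j x) k = (if k \<in> G then z k else 0)" if "finite G" for G
  proof -
    have "fourier_coeff (\<lambda>x. \<Sum>j\<in>G. z j * fourier_exp j x) k = (\<Sum>j\<in>G. z j * fourier_coeff (fourier_exp j) k)"
      using that by (subst fourier_coeff_sum) (auto intro!: continuous_intros sum.cong fourier_coeff_cmult)
    also have "\<dots> = (\<Sum>j\<in>G. if k = j then z j else 0)"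
      by (intro sum.cong) (auto simp: fourier_coeff_exp)
    also have "\<dots> = (if k \<in> G then z k else 0)" using that by simp
    finally show ?thesis .
  qed
  have "((\<lambda>G. fourier_coeff (\<lambda>x. \<Sum>j\<in>G. z j * fourier_exp j x) k) \<longlongrightarrow> fourier_coeff v k) (finite_subsets_at_top UNIV)"
    using expands_torus_continuous[OF assms]
    by (intro fourier_coeff_uniform_limit expands_uniform_limit assms continuous_intros) (simp add: torus_continuous_def)
  moreover have "((\<lambda>G. fourier_coeff (\<lambda>x. \<Sum>j\<in>G. z j * fourier_exp j x) k) \<longlongrightarrow> z k) (finite_subsets_at_top UNIV)"
  proof (rule tendsto_eventually)
    show "\<forall>\<^sub>F G in finite_subsets_at_top UNIV. fourier_coeff (\<lambda>x. \<Sum>j\<in>G. z j * fourier_exp j x) k = z k"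
      unfolding eventually_finite_subsets_at_top using fc by (intro exI[of _ "{k}"]) auto
  qed
  ultimately show ?thesis using tendsto_unique[OF finite_subsets_at_top_neq_bot] by blast
qed

text \<open>
  The trigonometric polynomials of arbitrary degree, as the span of the exponentials. They form an algebra,
  and are used to show that a continuous function is determined by its Fourier coefficients.
\<close>

inductive trig :: "(real^'n \<Rightarrow> complex) \<Rightarrow> bool" where
  exp: "trig (fourier_exp j)"
| scale: "trig f \<Longrightarrow> trig (\<lambda>x. c * f x)"
| add: "trig f \<Longrightarrow> trig g \<Longrightarrow> trig (\<lambda>x. f x + g x)"

lemma trig_const: "trig (\<lambda>x. c)"
  using trig.scale[OF trig.exp[of 0], of c] by simp

lemma trig_sum: "finite I \<Longrightarrow> (\<And>i. i \<in> I \<Longrightarrow> trig (f i)) \<Longrightarrow> trig (\<lambda>x. \<Sum>i\<in>I. f i x)"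
  by (induction I rule: finite_induct) (auto intro: trig.add trig_const)

lemma trig_exp_mult: "trig g \<Longrightarrow> trig (\<lambda>x. fourier_exp j x * g x)"
proof (induction rule: trig.induct)
  case (exp k)
  then show ?case using trig.exp[of "j + k"] by (simp add: fourier_exp_add[abs_def])
next
  case (scale f c)
  then show ?case using trig.scale[of "\<lambda>x. fourier_exp j x * f x" c] by (simp add: mult_ac)
next
  case (add f g)
  then show ?case using trig.add[OF add.IH] by (simp add: distrib_left)
qed

lemma trig_mult: "trig f \<Longrightarrow> trig g \<Longrightarrow> trig (\<lambda>x. f x * g x)"
proof (induction rule: trig.induct)
  case (exp k)
  then show ?case by (rule trig_exp_mult)
next
  case (scale f c)
  then show ?case using trig.scale[of "\<lambda>x. f x * g x" c] by (simp add: mult_ac)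
next
  case (add f h)
  then show ?case using trig.add[of "\<lambda>x. f x * g x" "\<lambda>x. h x * g x"] by (simp add: distrib_right)
qed

lemma trig_orthogonal:
  assumes v: "continuous_on UNIV v" and z: "\<And>j. fourier_coeff v j = 0" and "trig f"
  shows "continuous_on UNIV f \<and> integral torus_cell (\<lambda>x. v x * f x) = 0"
  using assms(3)
proof (induction rule: trig.induct)
  case (exp j)
  show ?case using z[of "- j"] unfolding fourier_coeff_integral[OF v] by (simp add: continuous_fourier_exp)
next
  case (scale f c)
  then show ?case by (auto intro!: continuous_intros simp: mult.left_commute[of _ c])
next
  case (add f g)
  then have "integral torus_cell (\<lambda>x. v x * f x + v x * g x) = integral torus_cell (\<lambda>x. v x * f x) + integral torus_cell (\<lambda>x. v x * g x)"
    by (intro integral_add integrable_on_cell continuous_intros v) auto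
  with add show ?case by (auto intro!: continuous_intros simp: distrib_left)
qed

text \<open>
  The torus as a compact subset of a Euclidean space, one circle for each coordinate.
\<close>

definition circles :: "real^'n \<Rightarrow> (real^'n) \<times> (real^'n)" where
  "circles x = ((\<chi> i. cos (x $ i)), (\<chi> i. sin (x $ i)))"

lemma axis_inner_freq: "freq (axis i 1) \<bullet> x = x $ i"
proof -
  have "freq (axis i 1) = axis i 1" by (auto simp: freq_def vec_eq_iff axis_def)
  then show ?thesis by (simp add: inner_axis')
qed

lemma trig_cos: "trig (\<lambda>x::real^'n. complex_of_real (cos (x $ i)))"
  and trig_sin: "trig (\<lambda>x::real^'n. complex_of_real (sin (x $ i)))"
proof -
  let ?a = "axis i 1 :: int^'n"
  have e: "fourier_exp ?a x = cis (x $ i)" "fourier_exp (- ?a) x = cis (- (x $ i))" for x :: "real^'n"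
    by (simp_all add: fourier_exp_def axis_inner_freq freq_minus cis_conv_exp)
  have "trig (\<lambda>x. (1/2) * fourier_exp ?a x + (1/2) * fourier_exp (- ?a) x)"
    by (intro trig.intros)
  moreover have "(1/2) * fourier_exp ?a x + (1/2) * fourier_exp (- ?a) x = complex_of_real (cos (x $ i))" for x :: "real^'n"
    unfolding e by (simp add: complex_eq_iff)
  ultimately show "trig (\<lambda>x. complex_of_real (cos (x $ i)))" by simp
  have "trig (\<lambda>x. (- \<i>/2) * fourier_exp ?a x + (\<i>/2) * fourier_exp (- ?a) x)"
    by (intro trig.intros)
  moreover have "(- \<i>/2) * fourier_exp ?a x + (\<i>/2) * fourier_exp (- ?a) x = complex_of_real (sin (x $ i))" for x :: "real^'n"
    unfolding e by (simp add: complex_eq_iff)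
  ultimately show "trig (\<lambda>x. complex_of_real (sin (x $ i)))" by simp
qed

text \<open>
  A polynomial on the ambient space is a polynomial in the functions \<open>cos x\<^sub>i\<close> and \<open>sin x\<^sub>i\<close>.
\<close>

lemma trig_polynomial: "real_polynomial_function g \<Longrightarrow> trig (\<lambda>x. complex_of_real (g (circles x)))"
proof (induction rule: real_polynomial_function.induct)
  case (linear h)
  then interpret bounded_linear h .
  have "h (circles x) = (\<Sum>i\<in>UNIV. cos (x $ i) * h (axis i 1, 0)) + (\<Sum>i\<in>UNIV. sin (x $ i) * h (0, axis i 1))" for x
  proof -
    have "circles x = (\<Sum>i\<in>UNIV. cos (x $ i) *\<^sub>R (axis i 1, 0)) + (\<Sum>i\<in>UNIV. sin (x $ i) *\<^sub>R (0, axis i 1))"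
      by (auto simp: circles_def prod_eq_iff vec_eq_iff fst_sum snd_sum axis_def if_distrib cong: if_cong)
    then show ?thesis by (simp only: add sum scaleR real_scaleR_def)
  qed
  then have "(\<lambda>x. complex_of_real (h (circles x))) = (\<lambda>x. (\<Sum>i\<in>UNIV. complex_of_real (h (axis i 1, 0)) * complex_of_real (cos (x $ i)))
     + (\<Sum>i\<in>UNIV. complex_of_real (h (0, axis i 1)) * complex_of_real (sin (x $ i))))"
    by (simp add: mult.commute)
  then show ?case by (simp only:) (intro trig.add trig_sum trig.scale trig_cos trig_sin, auto)
qed (auto intro: trig_const trig.add trig_mult)

lemma circles_eq_imp:
  assumes "periodic f" "circles x = circles y" shows "f x = f y"
proof -
  have "\<exists>n::int. x $ i = y $ i + 2 * pi * real_of_int n" for i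
  proof -
    have "cos (x $ i) = cos (y $ i)" "sin (x $ i) = sin (y $ i)"
      using assms(2) by (auto simp: circles_def vec_eq_iff)
    then show ?thesis using sin_cos_eq_iff[of "x $ i" "y $ i"] by auto
  qed
  then obtain n where n: "\<And>i. x $ i = y $ i + 2 * pi * real_of_int (n i)" by metis
  then have "x = y + (2 * pi) *\<^sub>R freq (\<chi> i. n i)" by (simp add: vec_eq_iff freq_def)
  then show ?thesis using assms(1) by (simp add: periodic_def)
qed

text \<open>
  A periodic function factors through \<open>circles\<close>. The factor is continuous, since preimages of closed sets
  are images of compact sets, and the Stone-Weierstrass theorem for polynomials applies to it.
\<close>

lemma real_trig_approximation:
  fixes f :: "real^'n \<Rightarrow> real"
  assumes f: "torus_continuous f" and e: "e > 0"
  shows "\<exists>p. trig (\<lambda>x. complex_of_real (p x)) \<and> (\<forall>x\<in>torus_cell. \<bar>f x - p x\<bar> < e)"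
proof -
  let ?S = "circles ` (torus_cell :: (real^'n) set)"
  have cc: "continuous_on A circles" for A :: "(real^'n) set"
    unfolding circles_def by (intro continuous_intros)
  have cell: "compact (torus_cell :: (real^'n) set)" by (simp add: torus_cell_def)
  have S: "compact ?S" by (rule compact_continuous_image[OF cc cell])
  \<comment> \<open>The choice of the preimage does not matter, because \<open>f\<close> is periodic.\<close>
  define g where "g y = f (SOME x. x \<in> torus_cell \<and> circles x = y)" for y
  have g: "g (circles x) = f x" if "x \<in> torus_cell" for x
  proof -
    have "(SOME x'. x' \<in> torus_cell \<and> circles x' = circles x) \<in> torus_cell \<and> circles (SOME x'. x' \<in> torus_cell \<and> circles x' = circles x) = circles x"
      by (rule someI[of _ x]) (simp add: that)
    then have "circles (SOME x'. x' \<in> torus_cell \<and> circles x' = circles x) = circles x" by (rule conjunct2)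
    then show ?thesis unfolding g_def
      by (rule circles_eq_imp[rotated]) (use f in \<open>simp add: torus_continuous_def\<close>)
  qed
  have "continuous_on ?S g"
    unfolding continuous_on_closed_vimage[OF compact_imp_closed[OF S]]
  proof (intro allI impI)
    fix B :: "real set" assume B: "closed B"
    have "g -` B \<inter> ?S = circles ` (torus_cell \<inter> f -` B)" using g by (auto simp: image_iff) 
    moreover have "closed (f -` B)"
      using f B by (intro closed_vimage) (auto simp: torus_continuous_def continuous_on_eq_continuous_within)
    ultimately show "closed (g -` B \<inter> ?S)"
      using cell by (simp add: compact_imp_closed compact_continuous_image[OF cc] compact_Int_closed)
  qed
  then obtain h where h: "real_polynomial_function h" "\<And>y. y \<in> ?S \<Longrightarrow> \<bar>g y - h y\<bar> < e"
    using Stone_Weierstrass_real_polynomial_function[OF S _ e] by blast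
  show ?thesis
  proof (intro exI[of _ "\<lambda>x. h (circles x)"] conjI ballI)
    show "trig (\<lambda>x. complex_of_real (h (circles x)))" by (rule trig_polynomial[OF h(1)])
    fix x :: "real^'n" assume x: "x \<in> torus_cell"
    show "\<bar>f x - h (circles x)\<bar> < e" using h(2)[of "circles x"] g[OF x] x by simp
  qed
qed

text \<open>
  All trigonometric polynomials are orthogonal to \<open>v\<close>. Since the conjugate of \<open>v\<close> is a uniform limit of
  such polynomials, the integral of \<open>|v|\<^sup>2\<close> vanishes, and \<open>v\<close> is continuous.
\<close>

lemma fourier_coeff_eq_0_imp:
  fixes v :: "real^'n \<Rightarrow> complex"
  assumes v: "torus_continuous v" and z: "\<And>j. fourier_coeff v j = 0"
  shows "v x = 0"
proof -
  have c: "continuous_on UNIV v" and p: "periodic v" using v by (auto simp: torus_continuous_def)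
  let ?m = "measure lborel (torus_cell :: (real^'n) set)"
  have "bounded (v ` torus_cell)"
    by (intro compact_imp_bounded compact_continuous_image continuous_on_subset[OF c]) (auto simp: torus_cell_def)
  then obtain B where B: "B > 0" "\<And>x. x \<in> torus_cell \<Longrightarrow> cmod (v x) \<le> B"
    by (auto simp: bounded_pos)
  have small: "cmod (integral torus_cell (\<lambda>x. v x * cnj (v x))) \<le> 2 * e * (B * ?m)" if e: "e > 0" for e
  proof -
    have "torus_continuous (\<lambda>x. Re (v x))" "torus_continuous (\<lambda>x. - Im (v x))"
      using v by (auto simp: torus_continuous_def periodic_def intro!: continuous_intros)
    \<comment> \<open>The real and the imaginary part of the conjugate of \<open>v\<close>.\<close>
    note this[THEN real_trig_approximation, OF e]
    then obtain p q where p: "trig (\<lambda>x. complex_of_real (p x))" "\<And>x. x \<in> torus_cell \<Longrightarrow> \<bar>Re (v x) - p x\<bar> < e"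
      and q: "trig (\<lambda>x. complex_of_real (q x))" "\<And>x. x \<in> torus_cell \<Longrightarrow> \<bar>- Im (v x) - q x\<bar> < e"
      by blast
    let ?T = "\<lambda>x. complex_of_real (p x) + \<i> * complex_of_real (q x)"
    have "trig ?T" by (intro trig.intros p q)
    then have T: "continuous_on UNIV ?T" "integral torus_cell (\<lambda>x. v x * ?T x) = 0"
      using trig_orthogonal[OF c z] by blast+
    have cv: "continuous_on UNIV (\<lambda>x. v x * cnj (v x))" by (intro continuous_intros c)
    have cT: "continuous_on UNIV (\<lambda>x. v x * ?T x)" by (intro continuous_intros c T(1))
    have "integral torus_cell (\<lambda>x. v x * cnj (v x)) = integral torus_cell (\<lambda>x. v x * cnj (v x) - v x * ?T x)"
      using T(2) by (simp add: integral_diff integrable_on_cell cv cT)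
    also have "cmod \<dots> \<le> B * (2 * e) * ?m"
      unfolding torus_cell_def
    proof (rule integrable_bound)
      show "0 \<le> B * (2 * e)" using B e by simp
      show "(\<lambda>x. v x * cnj (v x) - v x * ?T x) integrable_on cbox (\<chi> i. - pi) (\<chi> i. pi)"
        unfolding torus_cell_def[symmetric] by (intro integrable_on_cell continuous_on_diff cv cT)
      fix x :: "real^'n" assume "x \<in> cbox (\<chi> i. - pi) (\<chi> i. pi)"
      then have x: "x \<in> torus_cell" by (simp add: torus_cell_def)
      have "cmod (cnj (v x) - ?T x) \<le> \<bar>Re (cnj (v x) - ?T x)\<bar> + \<bar>Im (cnj (v x) - ?T x)\<bar>"
        by (rule cmod_le)
      also have "\<dots> \<le> 2 * e" using p(2)[OF x] q(2)[OF x] by simp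
      finally have "cmod (v x) * cmod (cnj (v x) - ?T x) \<le> B * (2 * e)"
        using B x by (intro mult_mono) auto
      then show "cmod (v x * cnj (v x) - v x * ?T x) \<le> B * (2 * e)"
        by (simp add: norm_mult[symmetric] right_diff_distrib del: norm_mult)
    qed
    finally show ?thesis by (simp add: mult_ac)
  qed
  have "cmod (integral torus_cell (\<lambda>x. v x * cnj (v x))) \<le> 0 + d" if "d > 0" for d
  proof -
    have "B * ?m + 1 > 0" using B by (simp add: add_nonneg_pos)
    then have "2 * (d / (2 * (B * ?m + 1))) * (B * ?m) \<le> d" "d / (2 * (B * ?m + 1)) > 0"
      using that by (auto simp: field_simps)
    then show ?thesis using small[of "d / (2 * (B * ?m + 1))"] by linarith
  qed
  then have "integral torus_cell (\<lambda>x. v x * cnj (v x)) = 0"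
    using field_le_epsilon[of "cmod (integral torus_cell (\<lambda>x. v x * cnj (v x)))" 0] by simp
  moreover have cv: "continuous_on UNIV (\<lambda>x. v x * cnj (v x))" by (intro continuous_intros c)
  ultimately have "((\<lambda>x. v x * cnj (v x)) has_integral 0) torus_cell"
    using integrable_on_cell[OF cv] by (metis has_integral_integral)
  from has_integral_linear[OF this bounded_linear_Re]
  have hi: "((\<lambda>x. (cmod (v x))\<^sup>2) has_integral 0) (cbox (\<chi> i. - pi) (\<chi> i. pi))"
    by (simp add: complex_norm_square[symmetric] o_def torus_cell_def)
  have zero: "v y = 0" if "y \<in> torus_cell" for y
  proof -
    have "(cmod (v y))\<^sup>2 = 0"
    proof (rule has_integral_0_cbox_imp_0[OF _ _ hi])
      show "continuous_on (cbox (\<chi> i. - pi) (\<chi> i. pi)) (\<lambda>x. (cmod (v x))\<^sup>2)"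
        by (intro continuous_intros continuous_on_subset[OF c]) auto
      show "box (\<chi> i. - pi) (\<chi> i. pi) \<noteq> ({} :: (real^'n) set)" by (simp add: interval_ne_empty_cart)
    qed (use that in \<open>auto simp: torus_cell_def\<close>)
    then show ?thesis by simp
  qed
  obtain k where "x + (2 * pi) *\<^sub>R freq k \<in> torus_cell" using exists_torus_representative by blast
  from zero[OF this] show "v x = 0" using p by (simp add: periodic_def)
qed

lemma expands_self:
  assumes z: "l1 z" shows "expands (\<lambda>x. \<Sum>\<^sub>\<infinity>j\<in>UNIV. z j * fourier_exp j x) z"
  using z by (simp add: expands_def)

text \<open>
  The sum of the series is a continuous function with the same coefficients as \<open>v\<close>.
\<close>

lemma expands_fourier_series:
  assumes v: "torus_continuous v" and l: "l1 (fourier_coeff v)"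
  shows "expands v (fourier_coeff v)"
proof -
  define w where "w = (\<lambda>x. \<Sum>\<^sub>\<infinity>j\<in>UNIV. fourier_coeff v j * fourier_exp j x)"
  have w: "expands w (fourier_coeff v)" unfolding w_def by (rule expands_self[OF l])
  note wc = expands_torus_continuous[OF w]
  have "v x - w x = 0" for x
  proof (rule fourier_coeff_eq_0_imp[where v="\<lambda>x. v x - w x"])
    show "torus_continuous (\<lambda>x. v x - w x)"
      using v wc by (auto simp: torus_continuous_def periodic_def intro!: continuous_intros)
    show "fourier_coeff (\<lambda>x. v x - w x) j = 0" for j
      using v wc expands_fourier_coeff[OF w] by (simp add: fourier_coeff_diff torus_continuous_def)
  qed
  then have "v = w" by auto
  then show ?thesis using w by simp
qed

text \<open>
  The inequality of Young for absolutely summable sequences.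
\<close>

lemma l1_conv:
  assumes "l1 x" "l1 y" shows "l1 (conv x y)"
proof -
  let ?X = "\<Sum>\<^sub>\<infinity>j\<in>UNIV. cmod (x j)" and ?Y = "\<Sum>\<^sub>\<infinity>j\<in>UNIV. cmod (y j)"
  have X0: "?X \<ge> 0" by (rule infsum_nonneg) simp
  have "(\<Sum>j\<in>F. cmod (conv x y j)) \<le> ?X * ?Y" if F: "finite F" for F
  proof (rule tendsto_upperbound[where F="finite_subsets_at_top UNIV"])
    show "((\<lambda>G. \<Sum>j\<in>F. cmod (\<Sum>l\<in>G. x (j - l) * y l)) \<longlongrightarrow> (\<Sum>j\<in>F. cmod (conv x y j))) (finite_subsets_at_top UNIV)"
      by (intro tendsto_intros conv_tendsto assms)
    have "(\<Sum>j\<in>F. cmod (\<Sum>l\<in>G. x (j - l) * y l)) \<le> ?X * ?Y" if G: "finite G" for G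
    proof -
      have "(\<Sum>j\<in>F. cmod (\<Sum>l\<in>G. x (j - l) * y l)) \<le> (\<Sum>j\<in>F. \<Sum>l\<in>G. cmod (x (j - l)) * cmod (y l))"
        by (intro sum_mono sum_norm_le) (simp add: norm_mult)
      also have "\<dots> = (\<Sum>l\<in>G. (\<Sum>j\<in>F. cmod (x (j - l))) * cmod (y l))"
        unfolding sum_distrib_right by (rule sum.swap)
      also have "\<dots> \<le> (\<Sum>l\<in>G. ?X * cmod (y l))"
      proof (intro sum_mono mult_right_mono)
        fix l
        have "(\<Sum>j\<in>F. cmod (x (j - l))) = (\<Sum>j\<in>(\<lambda>j. j - l) ` F. cmod (x j))"
          by (subst sum.reindex) (auto simp: inj_on_def)
        also have "\<dots> \<le> ?X" by (rule finite_sum_le_infsum) (auto simp: F assms)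
        finally show "(\<Sum>j\<in>F. cmod (x (j - l))) \<le> ?X" .
      qed auto
      also have "\<dots> = ?X * (\<Sum>l\<in>G. cmod (y l))" by (rule sum_distrib_left[symmetric])
      also have "\<dots> \<le> ?X * ?Y" by (intro mult_left_mono finite_sum_le_infsum) (auto simp: G assms X0)
      finally show ?thesis .
    qed
    then show "\<forall>\<^sub>F G in finite_subsets_at_top UNIV. (\<Sum>j\<in>F. cmod (\<Sum>l\<in>G. x (j - l) * y l)) \<le> ?X * ?Y"
      by (intro eventually_finite_subsets_at_top_weakI)
  qed simp
  then have "bdd_above (sum (\<lambda>j. cmod (conv x y j)) ` {F. F \<subseteq> UNIV \<and> finite F})"
    by (intro bdd_aboveI2[where M="?X * ?Y"]) simp
  then show ?thesis
    by (rule nonneg_bdd_above_summable_on[rotated]) simp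
qed

text \<open>
  Multiplying \<open>v\<close> by the partial sums of the series of \<open>w\<close> gives coefficients that are partial sums of the
  convolution. The partial sums converge uniformly and \<open>v\<close> is bounded.
\<close>

lemma expands_mult:
  assumes v: "expands v x" and w: "expands w y"
  shows "expands (\<lambda>t. v t * w t) (conv x y)"
proof -
  have lx: "l1 x" and ly: "l1 y" using assms by (auto simp: expands_def)
  note vc = expands_torus_continuous[OF v] and wc = expands_torus_continuous[OF w]
  have vw: "torus_continuous (\<lambda>t. v t * w t)"
    using vc wc by (auto simp: torus_continuous_def periodic_def intro!: continuous_intros)
  have cv: "continuous_on UNIV v" using vc by (simp add: torus_continuous_def)
  obtain B where B: "B > 0" "\<And>t. cmod (v t) \<le> B"
  proof -
    have "cmod (v t) \<le> (\<Sum>\<^sub>\<infinity>j\<in>UNIV. cmod (x j))" for t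
    proof -
      have s: "(\<lambda>j. cmod (x j * fourier_exp j t)) summable_on UNIV" using lx by (simp add: norm_mult)
      have "cmod (v t) = cmod (\<Sum>\<^sub>\<infinity>j\<in>UNIV. x j * fourier_exp j t)" using v by (simp add: expands_def)
      also have "\<dots> \<le> (\<Sum>\<^sub>\<infinity>j\<in>UNIV. cmod (x j * fourier_exp j t))" by (rule norm_infsum_bound[OF s])
      finally show ?thesis by (simp add: norm_mult)
    qed
    then show ?thesis using that[of "max 1 (\<Sum>\<^sub>\<infinity>j\<in>UNIV. cmod (x j))"] by (auto simp: le_max_iff_disj)
  qed
  have fc: "fourier_coeff (\<lambda>t. v t * w t) j = conv x y j" for j
  proof -
    have ul: "uniform_limit UNIV (\<lambda>G t. v t * (\<Sum>l\<in>G. y l * fourier_exp l t)) (\<lambda>t. v t * w t) (finite_subsets_at_top UNIV)"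
      unfolding uniform_limit_iff
    proof (intro allI impI)
      fix e :: real assume "e > 0"
      then have "e / B > 0" using B by simp
      then have "\<forall>\<^sub>F G in finite_subsets_at_top UNIV. \<forall>t\<in>UNIV. dist (\<Sum>l\<in>G. y l * fourier_exp l t) (w t) < e / B"
        using expands_uniform_limit[OF w] unfolding uniform_limit_iff by blast
      then show "\<forall>\<^sub>F G in finite_subsets_at_top UNIV. \<forall>t\<in>UNIV. dist (v t * (\<Sum>l\<in>G. y l * fourier_exp l t)) (v t * w t) < e"
      proof eventually_elim
        case (elim G)
        show ?case
        proof
          fix t
          have "dist (v t * (\<Sum>l\<in>G. y l * fourier_exp l t)) (v t * w t) = cmod (v t) * dist (\<Sum>l\<in>G. y l * fourier_exp l t) (w t)"
            by (simp add: dist_norm norm_mult[symmetric] right_diff_distrib)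
          also have "\<dots> \<le> B * dist (\<Sum>l\<in>G. y l * fourier_exp l t) (w t)" by (intro mult_right_mono B) simp
          also have "\<dots> < e" using elim B by (auto simp: field_simps)
          finally show "dist (v t * (\<Sum>l\<in>G. y l * fourier_exp l t)) (v t * w t) < e" .
        qed
      qed
    qed
    have "((\<lambda>G. fourier_coeff (\<lambda>t. v t * (\<Sum>l\<in>G. y l * fourier_exp l t)) j) \<longlongrightarrow> fourier_coeff (\<lambda>t. v t * w t) j) (finite_subsets_at_top UNIV)"
      using vw wc by (intro fourier_coeff_uniform_limit ul continuous_intros cv) (auto simp: torus_continuous_def)
    moreover have "fourier_coeff (\<lambda>t. v t * (\<Sum>l\<in>G. y l * fourier_exp l t)) j = (\<Sum>l\<in>G. x (j - l) * y l)" if "finite G" for G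
    proof -
      have "fourier_coeff (\<lambda>t. v t * (\<Sum>l\<in>G. y l * fourier_exp l t)) j = fourier_coeff (\<lambda>t. \<Sum>l\<in>G. y l * (v t * fourier_exp l t)) j"
        by (simp add: sum_distrib_left mult_ac)
      also have "\<dots> = (\<Sum>l\<in>G. y l * fourier_coeff (\<lambda>t. v t * fourier_exp l t) j)"
        using that cv by (subst fourier_coeff_sum) (auto intro!: continuous_intros sum.cong fourier_coeff_cmult)
      also have "\<dots> = (\<Sum>l\<in>G. x (j - l) * y l)"
        by (simp add: fourier_coeff_mult_exp expands_fourier_coeff[OF v] mult.commute)
      finally show ?thesis .
    qed
    then have "\<forall>\<^sub>F G in finite_subsets_at_top UNIV. fourier_coeff (\<lambda>t. v t * (\<Sum>l\<in>G. y l * fourier_exp l t)) j = (\<Sum>l\<in>G. x (j - l) * y l)"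
      by (intro eventually_finite_subsets_at_top_weakI)
    ultimately have "((\<lambda>G. \<Sum>l\<in>G. x (j - l) * y l) \<longlongrightarrow> fourier_coeff (\<lambda>t. v t * w t) j) (finite_subsets_at_top UNIV)"
      by (rule Lim_transform_eventually)
    then show ?thesis
      using conv_tendsto[OF lx ly] tendsto_unique[OF finite_subsets_at_top_neq_bot] by blast
  qed
  have "fourier_coeff (\<lambda>t. v t * w t) = conv x y" using fc by auto
  with expands_fourier_series[OF vw] l1_conv[OF lx ly] show ?thesis by simp
qed

lemma expands_cnj:
  assumes "expands v z" shows "expands (\<lambda>x. cnj (v x)) (\<lambda>j. cnj (z (- j)))"
proof -
  have l: "l1 z" using assms by (simp add: expands_def)
  have "bij (uminus :: int^'n \<Rightarrow> int^'n)" by (rule bij_betw_byWitness[where f'=uminus]) auto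
  then have l': "l1 (\<lambda>j. cnj (z (- j)))" using l1_reindex[OF l] by simp
  note vc = expands_torus_continuous[OF assms]
  have "torus_continuous (\<lambda>x. cnj (v x))"
    using vc by (auto simp: torus_continuous_def periodic_def intro!: continuous_intros)
  moreover have "fourier_coeff (\<lambda>x. cnj (v x)) = (\<lambda>j. cnj (z (- j)))"
    using vc by (auto simp: fourier_coeff_cnj expands_fourier_coeff[OF assms] torus_continuous_def)
  ultimately show ?thesis using expands_fourier_series[of "\<lambda>x. cnj (v x)"] l' by simp
qed

section \<open>Trigonometric interpolation\<close>

definition unit_root :: "nat \<Rightarrow> int \<Rightarrow> complex" where
  "unit_root K m = exp (\<i> * complex_of_real (pi * real_of_int m / real K))"

lemma unit_root_add: "unit_root K (m + n) = unit_root K m * unit_root K n"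
  by (simp add: unit_root_def exp_add[symmetric] algebra_simps add_divide_distrib)

lemma unit_root_eq_1: 
  assumes "K \<ge> 1" shows "unit_root K m = 1 \<longleftrightarrow> 2 * int K dvd m"
proof -
  have "unit_root K m = 1 \<longleftrightarrow> (\<exists>n::int. pi * real_of_int m / real K = real_of_int (2 * n) * pi)"
    unfolding unit_root_def by (subst exp_eq_1) simp
  also have "\<dots> \<longleftrightarrow> (\<exists>n::int. real_of_int m = real_of_int (2 * int K * n))"
    using assms by (intro ex_cong1) (auto simp: field_simps)
  also have "\<dots> \<longleftrightarrow> 2 * int K dvd m" unfolding of_int_eq_iff dvd_def ..
  finally show ?thesis .
qed

text \<open>
  Multiplying the sum by \<open>unit_root K m\<close> shifts the summation index by one, which leaves the sum over a full
  period unchanged.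
\<close>

lemma sum_unit_root:
  assumes K: "K \<ge> 1"
  shows "(\<Sum>k\<in>{- int K..int K - 1}. unit_root K (m * k)) = (if 2 * int K dvd m then 2 * of_nat K else 0)"
proof (cases "2 * int K dvd m")
  case True
  then have "unit_root K (m * k) = 1" for k by (simp add: unit_root_eq_1[OF K])
  then show ?thesis using True by simp
next
  case False
  let ?S = "\<Sum>k\<in>{- int K..int K - 1}. unit_root K (m * k)"
  have "unit_root K m * ?S = (\<Sum>k\<in>{- int K..int K - 1}. unit_root K (m * (k + 1)))"
    by (simp add: sum_distrib_left unit_root_add distrib_left mult.commute)
  also have "\<dots> = (\<Sum>k\<in>{- int K + 1..int K}. unit_root K (m * k))"
    by (rule sum.reindex_bij_witness[where i="\<lambda>k. k - 1" and j="\<lambda>k. k + 1"]) auto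
  also have "\<dots> = (\<Sum>k\<in>{- int K + 1..int K - 1}. unit_root K (m * k)) + unit_root K (m * int K)"
  proof -
    have "{- int K + 1..int K} = insert (int K) {- int K + 1..int K - 1}" using K by auto
    then show ?thesis by simp
  qed
  \<comment> \<open>The summand has period \<open>2 K\<close> in the index, so the new end point replaces the lost one.\<close>
  also have "unit_root K (m * int K) = unit_root K (m * (- int K))"
  proof -
    have "unit_root K (2 * int K * m) = 1" using unit_root_eq_1[OF K] by simp
    then have "unit_root K (m * (- int K)) * unit_root K (2 * int K * m) = unit_root K (m * (- int K))" by simp
    then show ?thesis unfolding unit_root_add[symmetric] by (simp add: algebra_simps)
  qed
  also have "(\<Sum>k\<in>{- int K + 1..int K - 1}. unit_root K (m * k)) + unit_root K (m * (- int K)) = ?S"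
  proof -
    have "{- int K..int K - 1} = insert (- int K) {- int K + 1..int K - 1}" using K by auto
    then show ?thesis by simp
  qed
  finally have "(unit_root K m - 1) * ?S = 0" by (simp add: algebra_simps)
  moreover have "unit_root K m \<noteq> 1" using False unit_root_eq_1[OF K] by simp
  ultimately show ?thesis using False by simp
qed

lemma fourier_exp_grid:
  "fourier_exp j (grid_point K k) = (\<Prod>i\<in>UNIV. unit_root K (j $ i * k $ i))"
proof -
  have "freq j \<bullet> grid_point K k = (\<Sum>i\<in>UNIV. pi * real_of_int (j $ i * k $ i) / real K)"
    unfolding grid_point_def inner_scaleR_right freq_inner_int
    by (simp add: sum_distrib_left sum_divide_distrib)
  then have "\<i> * complex_of_real (freq j \<bullet> grid_point K k) = (\<Sum>i\<in>UNIV. \<i> * complex_of_real (pi * real_of_int (j $ i * k $ i) / real K))"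
    by (simp add: sum_distrib_left)
  then show ?thesis
    unfolding fourier_exp_def unit_root_def by (simp add: exp_sum del: of_real_mult)
qed

text \<open>
  Frequencies and grid points are both indexed by integer vectors. This symmetry turns orthogonality of
  the exponentials on the grid into completeness (\<open>interp_coeff_grid\<close>).
\<close>

lemma fourier_exp_grid_sym: "fourier_exp j (grid_point K k) = fourier_exp k (grid_point K j)"
  by (simp add: fourier_exp_grid mult.commute)

lemma discrete_orthogonality:
  fixes j :: "int^'n" assumes K: "K \<ge> 1"
  shows "(\<Sum>k\<in>modes K. fourier_exp j (grid_point K k)) = (if \<forall>i. 2 * int K dvd j $ i then (2 * of_nat K) ^ CARD('n) else 0)"
  unfolding fourier_exp_grid sum_prod_modes[where g="\<lambda>i k. unit_root K (j $ i * k)"] sum_unit_root[OF K]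
  by auto

text \<open>
  The discrete Fourier transform of the grid values.
\<close>

definition interp_coeff :: "nat \<Rightarrow> (real^'n \<Rightarrow> complex) \<Rightarrow> int^'n \<Rightarrow> complex" where
  "interp_coeff K v l = (\<Sum>k\<in>modes K. v (grid_point K k) * fourier_exp (- l) (grid_point K k)) / (2 * of_nat K) ^ CARD('n)"

lemma interp_coeff_exp:
  fixes j :: "int^'n" assumes K: "K \<ge> 1"
  shows "interp_coeff K (fourier_exp j) l = (if j \<in> alias_class K l then 1 else 0)"
proof -
  have "(\<Sum>k\<in>modes K. fourier_exp j (grid_point K k) * fourier_exp (- l) (grid_point K k))
     = (\<Sum>k\<in>modes K. fourier_exp (j - l) (grid_point K k))"
    by (simp add: fourier_exp_add[symmetric])
  moreover have "(2 * of_nat K :: complex) ^ CARD('n) \<noteq> 0" using K by simp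
  ultimately show ?thesis
    unfolding interp_coeff_def discrete_orthogonality[OF K] by (auto simp: alias_class_def)
qed

lemma interp_coeff_sum:
  "finite G \<Longrightarrow> interp_coeff K (\<lambda>x. \<Sum>j\<in>G. c j * v j x) l = (\<Sum>j\<in>G. c j * interp_coeff K (v j) l)"
  unfolding interp_coeff_def sum_distrib_right
  by (subst sum.swap) (simp add: sum_divide_distrib sum_distrib_left mult.assoc)

lemma interp_coeff_trig_poly:
  fixes c :: "int^'n \<Rightarrow> complex"
  assumes K: "K \<ge> 1" and l: "l \<in> modes K"
  shows "interp_coeff K (\<lambda>x. \<Sum>j\<in>modes K. c j * fourier_exp j x) l = c l"
proof -
  have "j \<in> alias_class K l \<longleftrightarrow> j = l" if "j \<in> modes K" for j
    using alias_class_disjoint[OF that l, of j] by (auto simp: alias_class_def)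
  then have "(\<Sum>j\<in>modes K. c j * (if j \<in> alias_class K l then 1 else 0)) = (\<Sum>j\<in>modes K. if j = l then c j else 0)"
    by (intro sum.cong) auto
  then show ?thesis
    using l by (simp add: interp_coeff_sum finite_modes interp_coeff_exp[OF K])
qed

lemma interp_coeff_grid:
  fixes v :: "real^'n \<Rightarrow> complex"
  assumes K: "K \<ge> 1" and k: "k \<in> modes K"
  shows "(\<Sum>j\<in>modes K. interp_coeff K v j * fourier_exp j (grid_point K k)) = v (grid_point K k)"
proof -
  let ?N = "(2 * of_nat K :: complex) ^ CARD('n)"
  have N: "?N \<noteq> 0" using K by simp
  have "(\<Sum>j\<in>modes K. interp_coeff K v j * fourier_exp j (grid_point K k))
     = (\<Sum>j\<in>modes K. \<Sum>k'\<in>modes K. v (grid_point K k') / ?N * fourier_exp (k - k') (grid_point K j))"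
  proof (intro sum.cong refl)
    fix j :: "int^'n"
    have "interp_coeff K v j * fourier_exp j (grid_point K k)
      = (\<Sum>k'\<in>modes K. v (grid_point K k') / ?N * (fourier_exp (- j) (grid_point K k') * fourier_exp j (grid_point K k)))"
      by (simp add: interp_coeff_def sum_divide_distrib sum_distrib_right mult.assoc)
    also have "\<dots> = (\<Sum>k'\<in>modes K. v (grid_point K k') / ?N * fourier_exp (k - k') (grid_point K j))"
    proof (intro sum.cong refl)
      fix k' :: "int^'n"
      have "fourier_exp (- j) (grid_point K k') = fourier_exp (- k') (grid_point K j)"
        by (simp add: fourier_exp_minus fourier_exp_grid_sym[of j])
      then have "fourier_exp (- j) (grid_point K k') * fourier_exp j (grid_point K k) = fourier_exp (k - k') (grid_point K j)"
        using fourier_exp_add[of k "- k'" "grid_point K j"] by (simp add: fourier_exp_grid_sym[of j] mult.commute)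
      then show "v (grid_point K k') / ?N * (fourier_exp (- j) (grid_point K k') * fourier_exp j (grid_point K k))
         = v (grid_point K k') / ?N * fourier_exp (k - k') (grid_point K j)" by simp
    qed
    finally show "interp_coeff K v j * fourier_exp j (grid_point K k) = (\<Sum>k'\<in>modes K. v (grid_point K k') / ?N * fourier_exp (k - k') (grid_point K j))" .
  qed
  also have "\<dots> = (\<Sum>k'\<in>modes K. v (grid_point K k') / ?N * (\<Sum>j\<in>modes K. fourier_exp (k - k') (grid_point K j)))"
    by (subst sum.swap) (simp add: sum_distrib_left)
  also have "\<dots> = (\<Sum>k'\<in>modes K. if k' = k then v (grid_point K k') else 0)"
  proof (intro sum.cong refl)
    fix k' :: "int^'n" assume k': "k' \<in> modes K"
    have "(\<forall>i. 2 * int K dvd (k - k') $ i) \<longleftrightarrow> k' = k"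
      using alias_class_disjoint[OF k' k, of k] by (auto simp: alias_class_def)
    then show "v (grid_point K k') / ?N * (\<Sum>j\<in>modes K. fourier_exp (k - k') (grid_point K j)) = (if k' = k then v (grid_point K k') else 0)"
      unfolding discrete_orthogonality[OF K] using N by simp
  qed
  also have "\<dots> = v (grid_point K k)" using k by (simp add: finite_modes)
  finally show ?thesis .
qed

lemma interp_coeff_cong: "(\<And>k. k \<in> modes K \<Longrightarrow> v (grid_point K k) = w (grid_point K k)) \<Longrightarrow> interp_coeff K v l = interp_coeff K w l"
  unfolding interp_coeff_def by (simp cong: sum.cong)

lemma trig_poly_eq:
  assumes "K \<ge> 1" "p \<in> trig_poly K"
  shows "p = (\<lambda>x. \<Sum>j\<in>modes K. interp_coeff K p j * fourier_exp j x)"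
proof -
  obtain c where p: "p = (\<lambda>x. \<Sum>j\<in>modes K. c j * fourier_exp j x)" using assms(2) by (auto simp: trig_poly_def)
  have "interp_coeff K p j = c j" if "j \<in> modes K" for j
    unfolding p by (rule interp_coeff_trig_poly[OF assms(1) that])
  then show ?thesis by (subst p) (auto intro!: sum.cong)
qed

text \<open>
  The trigonometric polynomial with the coefficients \<open>interp_coeff K v\<close> attains the grid values by
  \<open>interp_coeff_grid\<close>. It is the only one, since the coefficients of a trigonometric polynomial are
  recovered from its grid values.
\<close>

lemma interp_eq:
  assumes K: "K \<ge> 1" shows "interp K v = (\<lambda>x. \<Sum>j\<in>modes K. interp_coeff K v j * fourier_exp j x)"
  unfolding interp_def
proof (rule the_equality)
  show "(\<lambda>x. \<Sum>j\<in>modes K. interp_coeff K v j * fourier_exp j x) \<in> trig_poly K \<and>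
    (\<forall>k\<in>modes K. (\<Sum>j\<in>modes K. interp_coeff K v j * fourier_exp j (grid_point K k)) = v (grid_point K k))"
    using interp_coeff_grid[OF K] by (auto simp: trig_poly_def)
  fix p assume p: "p \<in> trig_poly K \<and> (\<forall>k\<in>modes K. p (grid_point K k) = v (grid_point K k))"
  then have "interp_coeff K p = interp_coeff K v" by (intro ext interp_coeff_cong) auto
  then show "p = (\<lambda>x. \<Sum>j\<in>modes K. interp_coeff K v j * fourier_exp j x)"
    using trig_poly_eq[OF K, of p] p by simp
qed

text \<open>
  Each exponential is interpolated by the mode to which it is aliased, and pointwise convergence of the
  series at the finitely many grid points allows summation.
\<close>

lemma expands_interp_coeff:
  fixes z :: "int^'n \<Rightarrow> complex"
  assumes K: "K \<ge> 1" and v: "expands v z"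
  shows "interp_coeff K v l = aliased K z l"
proof -
  have l: "l1 z" using v by (simp add: expands_def)
  have "((\<lambda>G. interp_coeff K (\<lambda>x. \<Sum>j\<in>G. z j * fourier_exp j x) l) \<longlongrightarrow> interp_coeff K v l) (finite_subsets_at_top UNIV)"
    unfolding interp_coeff_def using K by (intro tendsto_intros expands_tendsto[OF v]) auto
  moreover have "interp_coeff K (\<lambda>x. \<Sum>j\<in>G. z j * fourier_exp j x) l = (\<Sum>j\<in>G. if j \<in> alias_class K l then z j else 0)" if "finite G" for G
    unfolding interp_coeff_sum[OF that] interp_coeff_exp[OF K] by (intro sum.cong) auto
  then have "\<forall>\<^sub>F G in finite_subsets_at_top UNIV. interp_coeff K (\<lambda>x. \<Sum>j\<in>G. z j * fourier_exp j x) l = (\<Sum>j\<in>G. if j \<in> alias_class K l then z j else 0)"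
    by (intro eventually_finite_subsets_at_top_weakI)
  ultimately have 1: "((\<lambda>j. if j \<in> alias_class K l then z j else 0) has_sum interp_coeff K v l) UNIV"
    unfolding has_sum_def by (rule Lim_transform_eventually)
  have "(z has_sum aliased K z l) (alias_class K l)"
    unfolding aliased_def by (rule has_sum_infsum[OF l1_summable[OF l]])
  then have "((\<lambda>j. if j \<in> alias_class K l then z j else 0) has_sum aliased K z l) UNIV"
    by (subst has_sum_cong_neutral[where S=UNIV and T="alias_class K l" and g=z]) auto
  with 1 show ?thesis by (rule has_sum_unique)
qed

lemma trunc_l1: "l1 (trunc K c)"
proof -
  have "(\<lambda>j. cmod (trunc K c j)) summable_on modes K" by (rule summable_on_finite[OF finite_modes])
  then show ?thesis
    by (subst summable_on_cong_neutral[where S=UNIV and T="modes K" and g="\<lambda>j. cmod (trunc K c j)"]) (auto simp: trunc_def)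
qed

lemma expands_trig_poly:
  "expands (\<lambda>x. \<Sum>j\<in>modes K. c j * fourier_exp j x) (trunc K c)"
  unfolding expands_def
proof (intro conjI allI trunc_l1)
  fix x
  have "(\<Sum>\<^sub>\<infinity>j\<in>UNIV. trunc K c j * fourier_exp j x) = (\<Sum>\<^sub>\<infinity>j\<in>modes K. c j * fourier_exp j x)"
    by (rule infsum_cong_neutral) (auto simp: trunc_def)
  then show "(\<Sum>j\<in>modes K. c j * fourier_exp j x) = (\<Sum>\<^sub>\<infinity>j\<in>UNIV. trunc K c j * fourier_exp j x)"
    by (simp add: infsum_finite finite_modes)
qed

text \<open>
  The Fourier multiplier of minus the Laplacian.
\<close>

definition lap :: "int^'n \<Rightarrow> complex" where
  "lap j = complex_of_real ((norm (freq j))\<^sup>2)"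

lemma partial_deriv_trig_poly:
  assumes G: "finite G"
  shows "partial_deriv i (\<lambda>x. \<Sum>j\<in>G. c j * fourier_exp j x) = (\<lambda>x. \<Sum>j\<in>G. (\<i> * of_int (j $ i) * c j) * fourier_exp j x)"
proof
  fix x
  have fe: "((\<lambda>h. fourier_exp j (x + h *\<^sub>R axis i 1)) has_vector_derivative \<i> * of_int (j $ i) * fourier_exp j x) (at 0)" for j
  proof -
    have "freq j \<bullet> axis i 1 = real_of_int (j $ i)" by (simp add: inner_axis freq_def)
    then have eq: "fourier_exp j (x + h *\<^sub>R axis i 1) = exp (\<i> * complex_of_real (freq j \<bullet> x) + \<i> * of_int (j $ i) * complex_of_real h)" for h
      by (simp add: fourier_exp_def inner_add_right algebra_simps)
    have "((\<lambda>z. exp (\<i> * complex_of_real (freq j \<bullet> x) + \<i> * of_int (j $ i) * z)) has_field_derivative \<i> * of_int (j $ i) * fourier_exp j x) (at (complex_of_real 0))"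
      by (auto intro!: derivative_eq_intros simp: fourier_exp_def)
    from has_vector_derivative_real_field[OF this] show ?thesis unfolding eq .
  qed
  have "((\<lambda>h. \<Sum>j\<in>G. c j * fourier_exp j (x + h *\<^sub>R axis i 1)) has_vector_derivative (\<Sum>j\<in>G. c j * (\<i> * of_int (j $ i) * fourier_exp j x))) (at 0)"
    by (intro has_vector_derivative_sum has_vector_derivative_mult_right fe)
  then show "partial_deriv i (\<lambda>x. \<Sum>j\<in>G. c j * fourier_exp j x) x = (\<Sum>j\<in>G. (\<i> * of_int (j $ i) * c j) * fourier_exp j x)"
    unfolding partial_deriv_def by (subst vector_derivative_at) (auto simp: mult_ac)
qed

lemma norm_freq_sq: "(norm (freq j))\<^sup>2 = (\<Sum>i\<in>UNIV. (real_of_int (j $ i))\<^sup>2)"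
  by (simp add: norm_vec_def L2_set_def freq_def sum_nonneg)

lemma laplacian_trig_poly:
  assumes G: "finite G"
  shows "laplacian (\<lambda>x. \<Sum>j\<in>G. c j * fourier_exp j x) = (\<lambda>x. \<Sum>j\<in>G. (- lap j * c j) * fourier_exp j x)"
proof
  fix x
  have "laplacian (\<lambda>x. \<Sum>j\<in>G. c j * fourier_exp j x) x
     = (\<Sum>i\<in>UNIV. \<Sum>j\<in>G. (\<i> * of_int (j $ i) * (\<i> * of_int (j $ i) * c j)) * fourier_exp j x)"
    unfolding laplacian_def partial_deriv_trig_poly[OF G] ..
  also have "\<dots> = (\<Sum>j\<in>G. \<Sum>i\<in>UNIV. (\<i> * of_int (j $ i) * (\<i> * of_int (j $ i) * c j)) * fourier_exp j x)"
    by (rule sum.swap)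
  also have "\<dots> = (\<Sum>j\<in>G. (- lap j * c j) * fourier_exp j x)"
  proof (intro sum.cong refl)
    fix j
    have "\<i> * of_int (j $ i) * (\<i> * of_int (j $ i) * c j) * fourier_exp j x = - (of_int (j $ i) ^ 2) * (c j * fourier_exp j x)" for i
    proof -
      have "\<i> * of_int (j $ i) * (\<i> * of_int (j $ i) * c j) * fourier_exp j x = (\<i> * \<i>) * (of_int (j $ i) * of_int (j $ i)) * (c j * fourier_exp j x)"
        by (simp only: mult_ac)
      then show ?thesis by (simp add: power2_eq_square)
    qed
    moreover have "- lap j = (\<Sum>i\<in>UNIV. - (of_int (j $ i) ^ 2))"
      by (simp add: lap_def norm_freq_sq sum_negf)
    ultimately show "(\<Sum>i\<in>UNIV. \<i> * of_int (j $ i) * (\<i> * of_int (j $ i) * c j) * fourier_exp j x) = (- lap j * c j) * fourier_exp j x"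
      by (simp only: sum_distrib_right mult.assoc)
  qed
  finally show "laplacian (\<lambda>x. \<Sum>j\<in>G. c j * fourier_exp j x) x = (\<Sum>j\<in>G. (- lap j * c j) * fourier_exp j x)" .
qed

section \<open>Global solvability of Lipschitz differential equations\<close>

text \<open>
  A solution \<open>X\<close> is sought as \<open>X t = exp (a * (t - t0)) *\<^sub>R Y t\<close>. In terms of the bounded continuous function
  \<open>Y\<close> the integral equation is a fixed point equation whose Lipschitz constant is \<open>L / a\<close>, whatever the
  length of the interval. With \<open>a = 2 * L\<close> it is a contraction.
\<close>

theorem picard_lindeloef_global:
  fixes F :: "'a::banach \<Rightarrow> 'a"
  assumes lip: "\<And>x y. norm (F x - F y) \<le> L * norm (x - y)" and L: "L > 0" and T: "T \<ge> 0"
  shows "\<exists>X. X t0 = x0 \<and> (\<forall>t\<in>{t0..t0 + T}. (X has_vector_derivative F (X t)) (at t within {t0..t0 + T}))"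
proof -
  let ?I = "{t0..t0 + T}"
  \<comment> \<open>Functions on the interval are extended to the line by constants,
    so that they belong to a Banach space.\<close>
  define tau where "tau t = max t0 (min (t0 + T) t)" for t
  have tau_I: "tau t \<in> ?I" for t using T by (auto simp: tau_def)
  have tau_id: "t \<in> ?I \<Longrightarrow> tau t = t" for t by (auto simp: tau_def)
  have tau_cont: "continuous_on UNIV tau" unfolding tau_def by (intro continuous_intros)
  have F_cont: "continuous_on UNIV F"
  proof (rule lipschitz_on_continuous_on)
    show "L-lipschitz_on UNIV F" using lip L by (intro lipschitz_onI) (auto simp: dist_norm)
  qed
  define a where "a = 2 * L"
  have a: "a > 0" using L by (simp add: a_def)
  define f where "f Y r = F (exp (a * (r - t0)) *\<^sub>R apply_bcontfun Y r)" for Y :: "real \<Rightarrow>\<^sub>C 'a" and r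
  have f_cont: "continuous_on S (f Y)" for S Y
    unfolding f_def by (intro continuous_on_compose2[OF F_cont] continuous_intros) auto
  have f_int: "f Y integrable_on {t0..s}" for Y s
    by (rule integrable_continuous_real[OF f_cont])
  define P where "P Y s = exp (- a * (s - t0)) *\<^sub>R (x0 + integral {t0..s} (f Y))" for Y s
  have P_cont: "continuous_on ?I (P Y)" for Y
    unfolding P_def by (intro continuous_intros indefinite_integral_continuous_1 f_int)
  have Pb: "(\<lambda>t. P Y (tau t)) \<in> bcontfun" for Y
  proof -
    have "continuous_on UNIV (\<lambda>t. P Y (tau t))"
      by (rule continuous_on_compose2[OF P_cont tau_cont]) (use tau_I in auto)
    moreover have "bounded (range (\<lambda>t. P Y (tau t)))"
      by (rule bounded_subset[OF compact_imp_bounded[OF compact_continuous_image[OF P_cont]]]) (use tau_I in auto)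
    ultimately show ?thesis by (simp add: bcontfun_def)
  qed
  define Phi where "Phi Y = Bcontfun (\<lambda>t. P Y (tau t))" for Y
  have Phi: "apply_bcontfun (Phi Y) t = P Y (tau t)" for Y t
    unfolding Phi_def using Bcontfun_inverse[OF Pb] by simp
  have contr: "dist (Phi Y) (Phi Z) \<le> 1/2 * dist Y Z" for Y Z
  proof (rule dist_bound)
    fix t
    let ?s = "tau t" and ?D = "dist Y Z"
    have s: "?s \<ge> t0" using tau_I[of t] by simp
    define g where "g r = L * ?D * exp (a * (r - t0))" for r
    have g: "(g has_integral (L * ?D / a * exp (a * (?s - t0)) - L * ?D / a * exp (a * (t0 - t0)))) {t0..?s}"
      by (rule fundamental_theorem_of_calculus[OF s])
         (auto intro!: derivative_eq_intros simp: g_def has_real_derivative_iff_has_vector_derivative[symmetric] a[THEN less_imp_neq, symmetric])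
    have "norm (integral {t0..?s} (\<lambda>r. f Y r - f Z r)) \<le> integral {t0..?s} g"
    proof (rule integral_norm_bound_integral)
      show "(\<lambda>r. f Y r - f Z r) integrable_on {t0..?s}" by (intro integrable_diff f_int)
      show "g integrable_on {t0..?s}" using g by blast
      fix r
      have "norm (f Y r - f Z r) \<le> L * norm (exp (a * (r - t0)) *\<^sub>R (apply_bcontfun Y r - apply_bcontfun Z r))"
        unfolding f_def using lip by (simp add: scaleR_diff_right)
      also have "\<dots> \<le> L * (exp (a * (r - t0)) * ?D)"
        using dist_bounded[of Y r Z] L by (intro mult_left_mono) (auto simp: dist_norm)
      finally show "norm (f Y r - f Z r) \<le> g r" by (simp add: g_def mult_ac)
    qed
    also have "\<dots> \<le> L * ?D / a * exp (a * (?s - t0))"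
      using g L a by (simp add: integral_unique)
    finally have I: "norm (integral {t0..?s} (f Y) - integral {t0..?s} (f Z)) \<le> L * ?D / a * exp (a * (?s - t0))"
      by (simp add: integral_diff f_int)
    have "dist (P Y ?s) (P Z ?s) = exp (- a * (?s - t0)) * norm (integral {t0..?s} (f Y) - integral {t0..?s} (f Z))"
      by (simp add: P_def dist_norm scaleR_diff_right[symmetric])
    also have "\<dots> \<le> exp (- a * (?s - t0)) * (L * ?D / a * exp (a * (?s - t0)))"
      by (intro mult_left_mono I) simp
    also have "\<dots> = (exp (- a * (?s - t0)) * exp (a * (?s - t0))) * (L * ?D / a)" by (simp only: mult_ac)
    also have "\<dots> = 1/2 * ?D"
      using L by (simp add: a_def exp_add[symmetric])
    finally show "dist (apply_bcontfun (Phi Y) t) (apply_bcontfun (Phi Z) t) \<le> 1/2 * ?D" by (simp add: Phi)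
  qed
  obtain Y where Y: "Phi Y = Y"
    using banach_fix_type[of "1/2" Phi] contr by auto
  define X where "X t = x0 + integral {t0..t} (f Y)" for t
  have XY: "X t = exp (a * (t - t0)) *\<^sub>R apply_bcontfun Y t" if "t \<in> ?I" for t
  proof -
    have "apply_bcontfun Y t = P Y t" using Phi[of Y t] Y tau_id[OF that] by simp
    then show ?thesis by (simp add: P_def X_def exp_add[symmetric])
  qed
  have "(X has_vector_derivative F (X t)) (at t within ?I)" if t: "t \<in> ?I" for t
  proof -
    have "(X has_vector_derivative 0 + f Y t) (at t within ?I)"
      unfolding X_def by (intro derivative_intros integral_has_vector_derivative f_cont t)
    then show ?thesis using XY[OF t] by (simp add: f_def)
  qed
  moreover have "X t0 = x0" by (simp add: X_def)
  ultimately show ?thesis by blast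
qed

instance bcontfun :: (metric_space, banach) banach ..

text \<open>
  The unknown is a vector with components in \<open>I\<close>. It is represented as a bounded function on a discrete
  space, which is a Banach space for every index type; the right-hand side is set to zero outside \<open>I\<close>.
\<close>

lemma finite_system_solution:
  fixes G :: "('i \<Rightarrow> complex) \<Rightarrow> 'i \<Rightarrow> complex"
  assumes I: "finite I" and T: "T \<ge> 0"
    and lip: "\<And>i. i \<in> I \<Longrightarrow> \<exists>L. \<forall>x y. cmod (G x i - G y i) \<le> L * (\<Sum>k\<in>I. cmod (x k - y k))"
  shows "\<exists>X. (\<forall>i\<in>I. X t0 i = x0 i) \<and>
     (\<forall>t\<in>{t0..t0 + T}. \<forall>i\<in>I. ((\<lambda>s. X s i) has_vector_derivative G (X t) i) (at t within {t0..t0 + T}))"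
proof -
  obtain l where l: "\<And>i x y. i \<in> I \<Longrightarrow> cmod (G x i - G y i) \<le> l i * (\<Sum>k\<in>I. cmod (x k - y k))"
    using lip by metis
  define L where "L = 1 + (\<Sum>i\<in>I. \<bar>l i\<bar>) * real (card I)"
  have L: "L > 0" unfolding L_def by (intro add_pos_nonneg mult_nonneg_nonneg sum_nonneg) auto
  have bc: "(\<lambda>d. if of_discrete d \<in> I then g (of_discrete d) else 0) \<in> bcontfun" for g :: "'i \<Rightarrow> complex"
  proof -
    have "continuous_on UNIV (\<lambda>d. if of_discrete d \<in> I then g (of_discrete d) else 0)"
      unfolding continuous_on_open_vimage[OF open_UNIV] using Discrete_Topology.open_discrete by blast
    moreover have "range (\<lambda>d. if of_discrete d \<in> I then g (of_discrete d) else 0) \<subseteq> insert 0 (g ` I)" by auto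
    then have "bounded (range (\<lambda>d. if of_discrete d \<in> I then g (of_discrete d) else 0))"
      by (rule bounded_subset[rotated]) (simp add: I finite_imp_bounded)
    ultimately show ?thesis by (simp add: bcontfun_def)
  qed
  define emb where "emb g = Bcontfun (\<lambda>d. if of_discrete d \<in> I then g (of_discrete d) else 0)" for g :: "'i \<Rightarrow> complex"
  have emb: "apply_bcontfun (emb g) d = (if of_discrete d \<in> I then g (of_discrete d) else 0)" for g d
    unfolding emb_def using Bcontfun_inverse[OF bc] by simp
  define coord where "coord Y i = apply_bcontfun Y (discrete i)" for Y :: "'i discrete \<Rightarrow>\<^sub>C complex" and i
  define F where "F Y = emb (G (coord Y))" for Y
  have "norm (F Y - F Z) \<le> L * norm (Y - Z)" for Y Z
  proof (rule norm_bound)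
    fix d :: "'i discrete"
    let ?i = "of_discrete d"
    have "cmod (G (coord Y) ?i - G (coord Z) ?i) \<le> L * norm (Y - Z)" if i: "?i \<in> I"
    proof -
      have "cmod (G (coord Y) ?i - G (coord Z) ?i) \<le> l ?i * (\<Sum>k\<in>I. cmod (coord Y k - coord Z k))"
        by (rule l[OF i])
      also have "\<dots> \<le> \<bar>l ?i\<bar> * (\<Sum>k\<in>I. cmod (coord Y k - coord Z k))"
        by (intro mult_right_mono sum_nonneg) auto
      also have "\<dots> \<le> (\<Sum>i\<in>I. \<bar>l i\<bar>) * (\<Sum>k\<in>I. norm (Y - Z))"
      proof (rule mult_mono)
        show "\<bar>l ?i\<bar> \<le> (\<Sum>i\<in>I. \<bar>l i\<bar>)" by (rule member_le_sum) (auto simp: i I)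
        show "(\<Sum>k\<in>I. cmod (coord Y k - coord Z k)) \<le> (\<Sum>k\<in>I. norm (Y - Z))"
          using norm_bounded[of "Y - Z"] by (intro sum_mono) (simp add: coord_def)
      qed (auto intro: sum_nonneg)
      also have "\<dots> = (L - 1) * norm (Y - Z)" by (simp add: L_def)
      also have "\<dots> \<le> L * norm (Y - Z)" by (intro mult_right_mono) auto
      finally show ?thesis .
    qed
    moreover have "0 \<le> L * norm (Y - Z)" using L by simp
    ultimately show "norm (apply_bcontfun (F Y - F Z) d) \<le> L * norm (Y - Z)" by (simp add: F_def emb)
  qed
  from picard_lindeloef_global[where F=F and L=L, OF this L T, of t0 "emb x0"]
  obtain X where X: "X t0 = emb x0" "\<And>t. t \<in> {t0..t0 + T} \<Longrightarrow> (X has_vector_derivative F (X t)) (at t within {t0..t0 + T})"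
    by blast
  have ev: "bounded_linear (\<lambda>Y. coord Y i)" for i
    unfolding coord_def by (rule bounded_linear_intro[where K=1]) (use norm_bounded in auto)
  show ?thesis
  proof (intro exI[of _ "\<lambda>t. coord (X t)"] conjI ballI)
    show "coord (X t0) i = x0 i" if "i \<in> I" for i using that X by (simp add: coord_def emb discrete_inverse)
    fix t i assume t: "t \<in> {t0..t0 + T}" and i: "i \<in> I"
    from bounded_linear.has_vector_derivative[OF ev X(2)[OF t], of i]
    show "((\<lambda>s. coord (X s) i) has_vector_derivative G (coord (X t)) i) (at t within {t0..t0 + T})"
      using i by (simp add: F_def coord_def[of "emb _"] emb discrete_inverse)
  qed
qed

section \<open>The collocation system in Fourier coefficients\<close>

text \<open>
  The coefficients of the complex conjugate.
\<close>

definition conj_coeff :: "(int^'n \<Rightarrow> complex) \<Rightarrow> int^'n \<Rightarrow> complex" where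
  "conj_coeff x j = cnj (x (- j))"

text \<open>
  The time derivative of the first component according to the semi-discrete Schroedinger equation. It is
  named because its error enters the energy as an unknown of its own.
\<close>

definition psi_rate_num :: "nat \<Rightarrow> (int^'n \<Rightarrow> complex) \<Rightarrow> (int^'n \<Rightarrow> complex) \<Rightarrow> int^'n \<Rightarrow> complex" where
  "psi_rate_num K b a = trunc K (\<lambda>j. - \<i> * (lap j * a j + aliased K (conv b a) j))"

text \<open>
  The ordinary differential equations of the collocation method for the coefficients \<open>a\<close>, \<open>b\<close>, \<open>c\<close> of the
  approximations to \<open>\<psi>\<close>, \<open>u\<close> and the time derivative of \<open>u\<close>.
\<close>

definition numeric_system ::
  "nat \<Rightarrow> real set \<Rightarrow> (real \<Rightarrow> int^'n \<Rightarrow> complex) \<Rightarrow> (real \<Rightarrow> int^'n \<Rightarrow> complex) \<Rightarrow> (real \<Rightarrow> int^'n \<Rightarrow> complex) \<Rightarrow> bool" where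
  "numeric_system K I a b c \<longleftrightarrow> (\<forall>t\<in>I. \<forall>j\<in>modes K.
     ((\<lambda>\<tau>. a \<tau> j) has_vector_derivative
        psi_rate_num K (b t) (a t) j) (at t within I) \<and>
     ((\<lambda>\<tau>. b \<tau> j) has_vector_derivative c t j) (at t within I) \<and>
     ((\<lambda>\<tau>. c \<tau> j) has_vector_derivative
        - lap j * (b t j + aliased K (conv (a t) (conj_coeff (a t))) j)) (at t within I))"

text \<open>
  For finitely supported sequences the pseudospectral product is a finite bilinear expression, which
  gives its Lipschitz continuity and its derivative. The support \<open>S\<close> is left open to include the
  frequencies of conjugates.
\<close>

lemma aliased_conv_finite:
  fixes x y :: "int^'n \<Rightarrow> complex"
  assumes S: "finite S" and x: "\<And>j. j \<notin> S \<Longrightarrow> x j = 0" and y: "\<And>j. j \<notin> S \<Longrightarrow> y j = 0"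
  shows "aliased K (conv x y) j = (\<Sum>k\<in>S. \<Sum>l\<in>S. if k + l \<in> alias_class K j then x k * y l else 0)"
proof -
  let ?S2 = "(\<lambda>(k, l). k + l) ` (S \<times> S)"
  have S2: "finite ?S2" using S by simp
  have cv: "conv x y m = (\<Sum>l\<in>S. x (m - l) * y l)" for m
  proof -
    have "conv x y m = (\<Sum>\<^sub>\<infinity>l\<in>S. x (m - l) * y l)"
      unfolding conv_def by (rule infsum_cong_neutral) (auto simp: y)
    then show ?thesis by (simp add: S)
  qed
  have supp: "conv x y m = 0" if "m \<notin> ?S2" for m
    unfolding cv
  proof (rule sum.neutral, rule ballI)
    fix l assume l: "l \<in> S"
    have "m - l \<notin> S"
    proof
      assume "m - l \<in> S"
      then have "m \<in> ?S2" using l by (intro image_eqI[of _ _ "(m - l, l)"]) auto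
      then show False using that by simp
    qed
    then show "x (m - l) * y l = 0" by (simp add: x)
  qed
  have "aliased K (conv x y) j = (\<Sum>\<^sub>\<infinity>m\<in>?S2. if m \<in> alias_class K j then conv x y m else 0)"
    unfolding aliased_def by (rule infsum_cong_neutral) (use supp in auto)
  also have "\<dots> = (\<Sum>m\<in>?S2. if m \<in> alias_class K j then conv x y m else 0)" by (rule infsum_finite[OF S2])
  also have "\<dots> = (\<Sum>m\<in>?S2. \<Sum>l\<in>S. if m \<in> alias_class K j then x (m - l) * y l else 0)"
    unfolding cv by (intro sum.cong) auto
  also have "\<dots> = (\<Sum>l\<in>S. \<Sum>m\<in>?S2. if m \<in> alias_class K j then x (m - l) * y l else 0)" by (rule sum.swap)
  also have "\<dots> = (\<Sum>l\<in>S. \<Sum>k\<in>S. if k + l \<in> alias_class K j then x k * y l else 0)"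
  proof (rule sum.cong[OF refl])
    fix l assume l: "l \<in> S"
    have "(\<Sum>k\<in>S. if k + l \<in> alias_class K j then x k * y l else 0)
       = (\<Sum>m\<in>(\<lambda>k. k + l) ` S. if m \<in> alias_class K j then x (m - l) * y l else 0)"
      by (subst sum.reindex) (auto cong: if_cong)
    also have "\<dots> = (\<Sum>m\<in>?S2. if m \<in> alias_class K j then x (m - l) * y l else 0)"
    proof (rule sum.mono_neutral_left[OF S2])
      show "(\<lambda>k. k + l) ` S \<subseteq> ?S2" using l by auto
      show "\<forall>m\<in>?S2 - (\<lambda>k. k + l) ` S. (if m \<in> alias_class K j then x (m - l) * y l else 0) = 0"
      proof
        fix m assume m: "m \<in> ?S2 - (\<lambda>k. k + l) ` S"
        have "m - l \<notin> S" 
        proof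
          assume "m - l \<in> S" then have "m \<in> (\<lambda>k. k + l) ` S" by (intro image_eqI[of _ _ "m - l"]) auto
          then show False using m by simp
        qed
        then show "(if m \<in> alias_class K j then x (m - l) * y l else 0) = 0" by (simp add: x)
      qed
    qed
    finally show "(\<Sum>m\<in>?S2. if m \<in> alias_class K j then x (m - l) * y l else 0)
        = (\<Sum>k\<in>S. if k + l \<in> alias_class K j then x k * y l else 0)" ..
  qed
  also have "\<dots> = (\<Sum>k\<in>S. \<Sum>l\<in>S. if k + l \<in> alias_class K j then x k * y l else 0)" by (rule sum.swap)
  finally show ?thesis .
qed

definition clip :: "real \<Rightarrow> complex \<Rightarrow> complex" where
  "clip R z = closest_point (cball 0 R) z"

lemma clip_lipschitz: "R \<ge> 0 \<Longrightarrow> cmod (clip R z - clip R w) \<le> cmod (z - w)"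
  using closest_point_lipschitz[of "cball 0 R" z w] by (simp add: clip_def dist_norm)

lemma clip_bound: "R \<ge> 0 \<Longrightarrow> cmod (clip R z) \<le> R"
  using closest_point_in_set[of "cball (0::complex) R" z] by (simp add: clip_def)

lemma clip_id: "cmod z \<le> R \<Longrightarrow> clip R z = z"
  unfolding clip_def by (rule closest_point_self) simp

text \<open>
  Boundedness is included to make the class closed under products.
\<close>

definition bounded_lipschitz :: "'i set \<Rightarrow> (('i \<Rightarrow> complex) \<Rightarrow> complex) \<Rightarrow> bool" where
  "bounded_lipschitz I f \<longleftrightarrow> (\<exists>L\<ge>0. \<exists>B\<ge>0. \<forall>x y. cmod (f x) \<le> B \<and> cmod (f x - f y) \<le> L * (\<Sum>k\<in>I. cmod (x k - y k)))"

lemma bounded_lipschitzI: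
  assumes "0 \<le> L" "0 \<le> B" "\<And>x. cmod (f x) \<le> B" "\<And>x y. cmod (f x - f y) \<le> L * (\<Sum>k\<in>I. cmod (x k - y k))"
  shows "bounded_lipschitz I f"
  unfolding bounded_lipschitz_def using assms by blast

lemma bounded_lipschitz_const: "bounded_lipschitz I (\<lambda>x. c)"
  by (rule bounded_lipschitzI[of 0 "cmod c"]) auto

lemma bounded_lipschitz_coordinate:
  assumes "finite I" "i \<in> I" "R \<ge> 0" shows "bounded_lipschitz I (\<lambda>x. clip R (x i))"
proof (rule bounded_lipschitzI[of 1 R])
  fix x y :: "_ \<Rightarrow> complex"
  have "cmod (clip R (x i) - clip R (y i)) \<le> cmod (x i - y i)" by (rule clip_lipschitz[OF assms(3)])
  also have "\<dots> \<le> (\<Sum>k\<in>I. cmod (x k - y k))" by (rule member_le_sum) (use assms in auto)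
  finally show "cmod (clip R (x i) - clip R (y i)) \<le> 1 * (\<Sum>k\<in>I. cmod (x k - y k))" by simp
qed (use assms clip_bound in auto)

lemma bounded_lipschitz_add:
  assumes "bounded_lipschitz I f" "bounded_lipschitz I g"
  shows "bounded_lipschitz I (\<lambda>x. f x + g x)"
proof -
  obtain L B L' B' where f: "L \<ge> 0" "B \<ge> 0" "\<And>x. cmod (f x) \<le> B" "\<And>x y. cmod (f x - f y) \<le> L * (\<Sum>k\<in>I. cmod (x k - y k))"
    and g: "L' \<ge> 0" "B' \<ge> 0" "\<And>x. cmod (g x) \<le> B'" "\<And>x y. cmod (g x - g y) \<le> L' * (\<Sum>k\<in>I. cmod (x k - y k))"
    using assms unfolding bounded_lipschitz_def by blast
  show ?thesis
  proof (rule bounded_lipschitzI[of "L + L'" "B + B'"])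
    fix x y :: "'a \<Rightarrow> complex"
    show "cmod (f x + g x) \<le> B + B'" using f(3) g(3) by (intro norm_triangle_mono)
    have "cmod ((f x - f y) + (g x - g y)) \<le> L * (\<Sum>k\<in>I. cmod (x k - y k)) + L' * (\<Sum>k\<in>I. cmod (x k - y k))"
      by (intro norm_triangle_mono f g)
    then show "cmod (f x + g x - (f y + g y)) \<le> (L + L') * (\<Sum>k\<in>I. cmod (x k - y k))" by (simp add: algebra_simps)
  qed (use f g in auto)
qed

lemma bounded_lipschitz_mult:
  assumes "bounded_lipschitz I f" "bounded_lipschitz I g"
  shows "bounded_lipschitz I (\<lambda>x. f x * g x)"
proof -
  obtain L B L' B' where f: "L \<ge> 0" "B \<ge> 0" "\<And>x. cmod (f x) \<le> B" "\<And>x y. cmod (f x - f y) \<le> L * (\<Sum>k\<in>I. cmod (x k - y k))"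
    and g: "L' \<ge> 0" "B' \<ge> 0" "\<And>x. cmod (g x) \<le> B'" "\<And>x y. cmod (g x - g y) \<le> L' * (\<Sum>k\<in>I. cmod (x k - y k))"
    using assms unfolding bounded_lipschitz_def by blast
  show ?thesis
  proof (rule bounded_lipschitzI[of "L * B' + B * L'" "B * B'"])
    fix x y :: "'a \<Rightarrow> complex"
    show "cmod (f x * g x) \<le> B * B'" unfolding norm_mult by (intro mult_mono f g) auto
    have "f x * g x - f y * g y = (f x - f y) * g x + f y * (g x - g y)" by (simp add: algebra_simps)
    also have "cmod \<dots> \<le> (L * (\<Sum>k\<in>I. cmod (x k - y k))) * B' + B * (L' * (\<Sum>k\<in>I. cmod (x k - y k)))"
      by (intro norm_triangle_mono order_trans[OF norm_mult_ineq] mult_mono f g mult_nonneg_nonneg sum_nonneg) auto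
    finally show "cmod (f x * g x - f y * g y) \<le> (L * B' + B * L') * (\<Sum>k\<in>I. cmod (x k - y k))" by (simp add: algebra_simps)
  qed (use f g in auto)
qed

lemma bounded_lipschitz_cnj: "bounded_lipschitz I f \<Longrightarrow> bounded_lipschitz I (\<lambda>x. cnj (f x))"
  unfolding bounded_lipschitz_def by (simp add: complex_cnj_diff[symmetric] del: complex_cnj_diff)

lemma bounded_lipschitz_sum:
  "finite S \<Longrightarrow> (\<And>s. s \<in> S \<Longrightarrow> bounded_lipschitz I (f s)) \<Longrightarrow> bounded_lipschitz I (\<lambda>x. \<Sum>s\<in>S. f s x)"
  by (induction S rule: finite_induct) (auto intro: bounded_lipschitz_const bounded_lipschitz_add)

lemma bounded_lipschitz_aliased_conv:
  fixes P Q :: "('i \<Rightarrow> complex) \<Rightarrow> int^'n \<Rightarrow> complex"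
  assumes S: "finite S" and P: "\<And>x j. j \<notin> S \<Longrightarrow> P x j = 0" and Q: "\<And>x j. j \<notin> S \<Longrightarrow> Q x j = 0"
    and "\<And>j. bounded_lipschitz I (\<lambda>x. P x j)" and "\<And>j. bounded_lipschitz I (\<lambda>x. Q x j)"
  shows "bounded_lipschitz I (\<lambda>x. aliased K (conv (P x) (Q x)) j)"
proof -
  have "bounded_lipschitz I (\<lambda>x. if k + l \<in> alias_class K j then P x k * Q x l else 0)" for k l
    by (cases "k + l \<in> alias_class K j") (auto intro: bounded_lipschitz_const bounded_lipschitz_mult assms)
  moreover have eq: "aliased K (conv (P x) (Q x)) j = (\<Sum>k\<in>S. \<Sum>l\<in>S. if k + l \<in> alias_class K j then P x k * Q x l else 0)" for x
    by (rule aliased_conv_finite[OF S P Q])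
  ultimately show ?thesis
    unfolding eq by (intro bounded_lipschitz_sum S)
qed

lemma trunc_cong: "(\<And>j. j \<in> modes K \<Longrightarrow> x j = y j) \<Longrightarrow> trunc K x = trunc K y"
  by (auto simp: trunc_def)

text \<open>
  Replacing each coefficient in the right-hand side of \<open>numeric_system\<close> by its clipped value makes the
  right-hand side a polynomial in bounded Lipschitz functions, hence globally Lipschitz. On an initial
  interval where the coefficients stay in the ball of radius \<open>R\<close>, clipping is the identity there and the
  original system holds.
\<close>

lemma clipped_solution:
  fixes a0 b0 c0 :: "int^'n \<Rightarrow> complex"
  assumes R: "R \<ge> 0" and T: "T \<ge> 0"
  shows "\<exists>a b c. (\<forall>t. \<forall>j. j \<notin> modes K \<longrightarrow> a t j = 0 \<and> b t j = 0 \<and> c t j = 0)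
    \<and> a t0 = trunc K a0 \<and> b t0 = trunc K b0 \<and> c t0 = trunc K c0
    \<and> (\<forall>j\<in>modes K. continuous_on {t0..t0 + T} (\<lambda>t. a t j) \<and> continuous_on {t0..t0 + T} (\<lambda>t. b t j) \<and> continuous_on {t0..t0 + T} (\<lambda>t. c t j))
    \<and> (\<forall>t1\<le>t0 + T. (\<forall>t\<in>{t0..t1}. \<forall>j\<in>modes K. cmod (a t j) \<le> R \<and> cmod (b t j) \<le> R \<and> cmod (c t j) \<le> R)
        \<longrightarrow> numeric_system K {t0..t1} a b c)"
proof -
  let ?I = "{0,1,2::nat} \<times> (modes K :: (int^'n) set)"
  have I: "finite ?I" by (simp add: finite_modes)
  \<comment> \<open>The reflected modes are those of the conjugate.\<close>
  define S where "S = modes K \<union> uminus ` (modes K :: (int^'n) set)"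
  have S: "finite S" by (simp add: S_def finite_modes)
  \<comment> \<open>The three components of the unknown are numbered 0, 1, 2.\<close>
  define part where "part p x j = (if j \<in> modes K then clip R (x (p, j)) else 0)" for p :: nat and x and j :: "int^'n"
  define G where "G x pj = (let p = fst pj; j = snd pj; A = part 0 x; B = part 1 x; C = part 2 x in
     if p = 0 then - \<i> * (lap j * A j + aliased K (conv B A) j)
     else if p = 1 then C j
     else - lap j * (B j + aliased K (conv A (conj_coeff A)) j))" for x and pj :: "nat \<times> (int^'n)"
  have pl: "bounded_lipschitz ?I (\<lambda>x. part p x j)" if "p \<in> {0,1,2}" for p j
    using that unfolding part_def
    by (cases "j \<in> modes K") (auto intro!: bounded_lipschitz_const bounded_lipschitz_coordinate R simp: finite_modes)
  have pl': "bounded_lipschitz ?I (\<lambda>x. conj_coeff (part p x) j)" if "p \<in> {0,1,2}" for p j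
    unfolding conj_coeff_def by (intro bounded_lipschitz_cnj pl that)
  have sp: "part p x j = 0" "conj_coeff (part p x) j = 0" if "j \<notin> S" for p x j
  proof -
    show "part p x j = 0" using that by (auto simp: part_def S_def)
    have "- j \<notin> modes K" using that image_eqI[of j uminus "- j"] by (auto simp: S_def)
    then show "conj_coeff (part p x) j = 0" by (simp add: part_def conj_coeff_def)
  qed
  have Glip: "bounded_lipschitz ?I (\<lambda>x. G x i)" if "i \<in> ?I" for i
  proof -
    obtain p j where pj: "i = (p, j)" by (cases i)
    then have i: "i = (p, j)" "p \<in> {0,1,2}" using that by simp_all
    have f1: "bounded_lipschitz ?I (\<lambda>x. aliased K (conv (part 1 x) (part 0 x)) j)"
      by (rule bounded_lipschitz_aliased_conv[OF S]) (simp_all add: sp pl del: One_nat_def)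
    have f2: "bounded_lipschitz ?I (\<lambda>x. aliased K (conv (part 0 x) (conj_coeff (part 0 x))) j)"
      by (rule bounded_lipschitz_aliased_conv[OF S]) (simp_all add: sp pl pl' del: One_nat_def)
    consider "p = 0" | "p = 1" | "p = 2" using i by auto
    then show ?thesis
    proof cases
      case 1
      then show ?thesis unfolding i G_def Let_def fst_conv snd_conv
        by (simp only: simp_thms if_True) (intro bounded_lipschitz_mult bounded_lipschitz_add bounded_lipschitz_const f1 pl, simp)
    next
      case 2
      then show ?thesis unfolding i G_def Let_def fst_conv snd_conv using pl[of 2 j] by simp
    next
      case 3
      have "bounded_lipschitz ?I (\<lambda>x. - lap j * (part 1 x j + aliased K (conv (part 0 x) (conj_coeff (part 0 x))) j))"
        by (intro bounded_lipschitz_mult bounded_lipschitz_add bounded_lipschitz_const f2 pl) simp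
      then show ?thesis using 3 unfolding i G_def Let_def fst_conv snd_conv by simp
    qed
  qed
  define x0 where "x0 pj = (if fst pj = 0 then a0 (snd pj) else if fst pj = 1 then b0 (snd pj) else c0 (snd pj))" for pj :: "nat \<times> (int^'n)"
  have lip: "\<exists>L. \<forall>x y. cmod (G x i - G y i) \<le> L * (\<Sum>k\<in>?I. cmod (x k - y k))" if "i \<in> ?I" for i
    using Glip[OF that] unfolding bounded_lipschitz_def by blast
  obtain X where XX: "\<forall>i\<in>?I. X t0 i = x0 i"
     "\<forall>t\<in>{t0..t0 + T}. \<forall>i\<in>?I. ((\<lambda>s. X s i) has_vector_derivative G (X t) i) (at t within {t0..t0 + T})"
    using finite_system_solution[where G=G, OF I T lip, of t0 x0] by blast
  have X0: "\<And>i. i \<in> ?I \<Longrightarrow> X t0 i = x0 i"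
    and X: "\<And>t i. t \<in> {t0..t0 + T} \<Longrightarrow> i \<in> ?I \<Longrightarrow> ((\<lambda>s. X s i) has_vector_derivative G (X t) i) (at t within {t0..t0 + T})"
    using XX by blast+
  define pr where "pr p t j = (if j \<in> modes K then X t (p, j) else 0)" for p :: nat and t and j
  have prX: "((\<lambda>s. pr p s j) has_vector_derivative G (X t) (p, j)) (at t within {t0..t0 + T})"
    if "t \<in> {t0..t0 + T}" "p \<in> {0,1,2}" "j \<in> modes K" for p t j
    using X[OF that(1), of "(p, j)"] that by (auto simp: pr_def)
  show ?thesis
  proof (rule exI[of _ "pr 0"], rule exI[of _ "pr 1"], rule exI[of _ "pr 2"], intro conjI allI impI ballI)
    show "pr 0 t0 = trunc K a0" "pr 1 t0 = trunc K b0" "pr 2 t0 = trunc K c0"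
      using X0 by (auto simp: pr_def trunc_def x0_def)
    fix j :: "int^'n" assume j: "j \<in> modes K"
    have "continuous_on {t0..t0 + T} (\<lambda>t. pr p t j)" if "p \<in> {0,1,2}" for p
      by (rule continuous_on_vector_derivative) (rule prX[OF _ that j])
    then show "continuous_on {t0..t0 + T} (\<lambda>t. pr 0 t j)" "continuous_on {t0..t0 + T} (\<lambda>t. pr 1 t j)" "continuous_on {t0..t0 + T} (\<lambda>t. pr 2 t j)"
      by auto
  next
    fix t1 assume t1: "t1 \<le> t0 + T"
      and bd: "\<forall>t\<in>{t0..t1}. \<forall>j\<in>modes K. cmod (pr 0 t j) \<le> R \<and> cmod (pr 1 t j) \<le> R \<and> cmod (pr 2 t j) \<le> R"
    show "numeric_system K {t0..t1} (pr 0) (pr 1) (pr 2)"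
      unfolding numeric_system_def
    proof (intro ballI)
      fix t and j :: "int^'n" assume t: "t \<in> {t0..t1}" and j: "j \<in> modes K"
      have p: "part p (X t) = pr p t" if "p \<in> {0,1,2}" for p
        using that bd t by (auto simp: part_def pr_def clip_id)
      have d: "((\<lambda>s. pr p s j) has_vector_derivative G (X t) (p, j)) (at t within {t0..t1})" if "p \<in> {0,1,2}" for p
        by (rule has_vector_derivative_within_subset[OF prX[OF _ that j]]) (use t t1 in auto)
      show "((\<lambda>\<tau>. pr 0 \<tau> j) has_vector_derivative
        psi_rate_num K (pr 1 t) (pr 0 t) j) (at t within {t0..t1}) \<and>
     ((\<lambda>\<tau>. pr 1 \<tau> j) has_vector_derivative pr 2 t j) (at t within {t0..t1}) \<and>
     ((\<lambda>\<tau>. pr 2 \<tau> j) has_vector_derivative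
        - lap j * (pr 1 t j + aliased K (conv (pr 0 t) (conj_coeff (pr 0 t))) j)) (at t within {t0..t1})"
        using d[of 0] d[of 1] d[of 2] unfolding G_def Let_def by (simp add: p psi_rate_num_def trunc_def j)
    qed
  qed (auto simp: pr_def)
qed

section \<open>Consistency of the spatial discretization\<close>

definition psi_rate :: "(int^'n \<Rightarrow> complex) \<Rightarrow> (int^'n \<Rightarrow> complex) \<Rightarrow> int^'n \<Rightarrow> complex" where
  "psi_rate u \<psi> j = - \<i> * (lap j * \<psi> j + conv u \<psi> j)"

definition exact_system ::
  "real set \<Rightarrow> (real \<Rightarrow> int^'n \<Rightarrow> complex) \<Rightarrow> (real \<Rightarrow> int^'n \<Rightarrow> complex) \<Rightarrow> (real \<Rightarrow> int^'n \<Rightarrow> complex) \<Rightarrow> bool" where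
  "exact_system I \<psi> u w \<longleftrightarrow> (\<forall>t\<in>I. \<forall>j.
     ((\<lambda>\<tau>. \<psi> \<tau> j) has_vector_derivative psi_rate (u t) (\<psi> t) j) (at t within I) \<and>
     ((\<lambda>\<tau>. u \<tau> j) has_vector_derivative w t j) (at t within I) \<and>
     ((\<lambda>\<tau>. w \<tau> j) has_vector_derivative
        - lap j * (u t j + conv (\<psi> t) (conj_coeff (\<psi> t)) j)) (at t within I))"

text \<open>
  The Sobolev norm restricted to the retained modes. Being a finite sum, it can be differentiated in time;
  the remaining modes of the exact solution are controlled by \<open>hbound_tail\<close>.
\<close>

definition modes_norm :: "nat \<Rightarrow> real \<Rightarrow> (int^'n \<Rightarrow> complex) \<Rightarrow> real" where
  "modes_norm K s x = L2_set (\<lambda>j. wt j powr s * cmod (x j)) (modes K)"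

lemma modes_norm_nonneg [simp]: "0 \<le> modes_norm K s x"
  by (simp add: modes_norm_def)

lemma modes_norm_sq: "(modes_norm K s x)\<^sup>2 = (\<Sum>j\<in>modes K. wt j powr (2 * s) * (cmod (x j))\<^sup>2)"
  unfolding modes_norm_def L2_set_def wt_term_sq by (simp add: sum_nonneg)

lemma modes_norm_le: "hbound s (trunc K x) B \<Longrightarrow> modes_norm K s x \<le> B"
  using hboundD[of s "trunc K x" B "modes K"] by (simp add: modes_norm_def trunc_def finite_modes cong: L2_set_cong)

lemma hbound_modes_norm: "hbound s (trunc K x) (modes_norm K s x)"
  unfolding hbound_def
proof (intro allI impI)
  fix F :: "(int^'a) set" assume F: "finite F"
  have "(\<Sum>j\<in>F. (wt j powr s * cmod (trunc K x j))\<^sup>2) = (\<Sum>j\<in>F \<inter> modes K. (wt j powr s * cmod (x j))\<^sup>2)"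
    by (rule sum.mono_neutral_cong_right) (use F in \<open>auto simp: trunc_def\<close>)
  also have "\<dots> \<le> (\<Sum>j\<in>modes K. (wt j powr s * cmod (x j))\<^sup>2)"
    by (rule sum_mono2) (auto simp: finite_modes)
  finally show "L2_set (\<lambda>j. wt j powr s * cmod (trunc K x j)) F \<le> modes_norm K s x"
    by (simp add: modes_norm_def L2_set_def)
qed

lemma modes_norm_mono: "s \<le> s' \<Longrightarrow> modes_norm K s x \<le> modes_norm K s' x"
  unfolding modes_norm_def by (intro L2_set_mono mult_right_mono wt_powr_mono) auto

lemma modes_norm_cong: "(\<And>j. j \<in> modes K \<Longrightarrow> x j = y j) \<Longrightarrow> modes_norm K s x = modes_norm K s y"
  unfolding modes_norm_def by (intro L2_set_cong) auto

lemma modes_norm_triangle: "modes_norm K s (\<lambda>j. x j + y j) \<le> modes_norm K s x + modes_norm K s y"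
proof -
  have "modes_norm K s (\<lambda>j. x j + y j) \<le> L2_set (\<lambda>j. wt j powr s * cmod (x j) + wt j powr s * cmod (y j)) (modes K)"
    unfolding modes_norm_def
    by (intro L2_set_mono) (auto simp: distrib_left[symmetric] norm_triangle_ineq intro!: mult_left_mono)
  also have "\<dots> \<le> modes_norm K s x + modes_norm K s y" unfolding modes_norm_def by (rule L2_set_triangle_ineq)
  finally show ?thesis .
qed

text \<open>
  Outside \<open>modes K\<close> the error is the tail of the exact coefficients.
\<close>

lemma hbound_error:
  assumes x: "hbound (s + \<sigma>) x X" and p: "\<And>j. j \<notin> modes K \<Longrightarrow> p j = 0" and "\<sigma> \<ge> 0" "K \<ge> 1"
  shows "hbound s (\<lambda>j. x j - p j) (modes_norm K s (\<lambda>j. x j - p j) + real K powr (- \<sigma>) * X)"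
proof -
  have eq: "(\<lambda>j. x j - p j) = (\<lambda>j. trunc K (\<lambda>j. x j - p j) j + (x j - trunc K x j))"
    using p by (auto simp: trunc_def)
  show ?thesis
    by (subst eq) (intro hbound_add hbound_modes_norm hbound_tail assms)
qed

text \<open>
  The form of \<open>bilinear_error\<close> used below: all factors are bounded by one constant \<open>A\<close> and all errors by
  multiples of one small quantity \<open>z\<close>.
\<close>

lemma bilinear_error_uniform:
  fixes s :: real assumes s: "s > real CARD('n::finite) / 2" and \<sigma>: "\<sigma> \<ge> 0"
  shows "\<exists>C>0. \<forall>K\<ge>1. \<forall>(x::int^'n \<Rightarrow> complex) y p q A z.
     hbound (s + \<sigma>) x A \<longrightarrow> hbound (s + \<sigma>) y A \<longrightarrow> hbound s p A \<longrightarrow> real K powr (- \<sigma>) \<le> z \<longrightarrow>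
     hbound s (\<lambda>j. x j - p j) (A * z) \<longrightarrow> hbound s (\<lambda>j. y j - q j) (A * z) \<longrightarrow>
     modes_norm K s (\<lambda>j. conv x y j - aliased K (conv p q) j) \<le> C * (A\<^sup>2 * z)"
proof -
  obtain C where C: "C > 0" and B: "\<forall>K\<ge>1. \<forall>(x::int^'n \<Rightarrow> complex) y p q X Y P Dx Dy.
     hbound (s + \<sigma>) x X \<longrightarrow> hbound (s + \<sigma>) y Y \<longrightarrow> hbound s p P \<longrightarrow>
     hbound s (\<lambda>j. x j - p j) Dx \<longrightarrow> hbound s (\<lambda>j. y j - q j) Dy \<longrightarrow>
     hbound s (trunc K (\<lambda>j. conv x y j - aliased K (conv p q) j)) (C * (real K powr (- \<sigma>) * X * Y + Dx * Y + P * Dy))"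
    using bilinear_error[OF s \<sigma>] by blast
  have "modes_norm K s (\<lambda>j. conv x y j - aliased K (conv p q) j) \<le> 3 * C * (A\<^sup>2 * z)"
    if K: "K \<ge> 1" and x: "hbound (s + \<sigma>) x A" and y: "hbound (s + \<sigma>) y A" and p: "hbound s p A" and z: "real K powr (- \<sigma>) \<le> z"
      and dx: "hbound s (\<lambda>j. x j - p j) (A * z)" and dy: "hbound s (\<lambda>j. y j - q j) (A * z)"
    for K and x y p q :: "int^'n \<Rightarrow> complex" and A z
  proof -
    have "modes_norm K s (\<lambda>j. conv x y j - aliased K (conv p q) j) \<le> C * (real K powr (- \<sigma>) * A * A + (A * z) * A + A * (A * z))"
      by (rule modes_norm_le) (rule B[rule_format, OF K x y p dx dy])
    also have "\<dots> \<le> C * (z * A * A + (A * z) * A + A * (A * z))"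
      using C hbound_nonneg[OF x] z by (intro mult_left_mono add_mono mult_right_mono) auto
    also have "\<dots> = 3 * C * (A\<^sup>2 * z)" by (simp add: power2_eq_square algebra_simps)
    finally show ?thesis .
  qed
  then show ?thesis using C by (intro exI[of _ "3 * C"]) auto
qed

lemma norm_freq_sq_le: "(norm (freq j))\<^sup>2 \<le> (wt j)\<^sup>2"
  by (intro power_mono) (auto simp: wt_def)

lemma wt_powr_add2: "wt j powr (s + 2) = wt j powr s * (wt j)\<^sup>2"
  by (simp add: powr_add powr_numeral)

lemma hbound_psi_rate:
  fixes s :: real assumes s: "s > real CARD('n::finite) / 2"
  shows "\<exists>C>0. \<forall>(u::int^'n \<Rightarrow> complex) \<psi> M. hbound s u M \<longrightarrow> hbound (s + 2) \<psi> M \<longrightarrow> hbound s (psi_rate u \<psi>) (M + C * M * M)"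
proof -
  obtain C where C: "C > 0" and cv: "\<forall>(x::int^'n \<Rightarrow> complex) y X Y. hbound s x X \<longrightarrow> hbound s y Y \<longrightarrow> hbound s (conv x y) (C * X * Y)"
    using hbound_conv[OF s] by blast
  have "hbound s (psi_rate u \<psi>) (M + C * M * M)" if u: "hbound s u M" and p: "hbound (s + 2) \<psi> M" for u \<psi> :: "int^'n \<Rightarrow> complex" and M
  proof -
    have "hbound s (\<lambda>j. lap j * \<psi> j) (1 * M)"
    proof (rule hbound_compare[OF p])
      fix j :: "int^'n"
      have "wt j powr s * ((norm (freq j))\<^sup>2 * cmod (\<psi> j)) \<le> wt j powr s * ((wt j)\<^sup>2 * cmod (\<psi> j))"
        by (intro mult_left_mono mult_right_mono norm_freq_sq_le) auto
      then show "wt j powr s * cmod (lap j * \<psi> j) \<le> 1 * (wt j powr (s + 2) * cmod (\<psi> j))"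
        by (simp add: lap_def norm_mult norm_power wt_powr_add2 mult.assoc)
    qed simp
    moreover have "hbound s (conv u \<psi>) (C * M * M)"
      by (rule cv[rule_format, OF u hbound_weaken[OF p]]) simp
    ultimately have "hbound s (\<lambda>j. lap j * \<psi> j + conv u \<psi> j) (M + C * M * M)" using hbound_add by fastforce
    then show ?thesis by (rule hbound_cmod_le) (simp add: psi_rate_def norm_mult)
  qed
  then show ?thesis using C by blast
qed

text \<open>
  With \<open>e\<close>, \<open>h\<close>, \<open>q\<close> for the errors of \<open>\<psi>\<close>, of its time derivative and of the product \<open>u \<psi>\<close>, the two
  Schroedinger equations give \<open>|j|\<^sup>2 * e = \<i> * h - q\<close> in each retained mode. Dividing by \<open>|j|\<^sup>2 = (wt j)\<^sup>2\<close>
  gains two orders. The zero frequency is the exception, where \<open>wt j = 1\<close>, and it is covered by the last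
  term.
\<close>

lemma recover_two_derivatives:
  assumes "K \<ge> 1"
  shows "modes_norm K (s + 2) (\<lambda>j. \<psi> j - a j) \<le> modes_norm K s (\<lambda>j. psi_rate u \<psi> j - psi_rate_num K b a j)
     + modes_norm K s (\<lambda>j. conv u \<psi> j - aliased K (conv b a) j) + modes_norm K s (\<lambda>j. \<psi> j - a j)"
proof -
  let ?e = "\<lambda>j. \<psi> j - a j" and ?h = "\<lambda>j. psi_rate u \<psi> j - psi_rate_num K b a j" and ?q = "\<lambda>j. conv u \<psi> j - aliased K (conv b a) j"
  have pt: "wt j powr (s + 2) * cmod (?e j) \<le> wt j powr s * cmod (?h j) + wt j powr s * cmod (?q j) + wt j powr s * cmod (?e j)"
    if j: "j \<in> modes K" for j
  proof -
    have h: "lap j * ?e j = \<i> * ?h j - ?q j"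
      using j by (simp add: psi_rate_def psi_rate_num_def trunc_def algebra_simps)
    have "(wt j)\<^sup>2 * cmod (?e j) \<le> cmod (?h j) + cmod (?q j) + cmod (?e j)"
    proof (cases "norm (freq j) \<ge> 1")
      case True
      then have "(wt j)\<^sup>2 * cmod (?e j) = cmod (lap j * ?e j)" by (simp add: wt_def lap_def norm_mult norm_power)
      also have "\<dots> \<le> cmod (\<i> * ?h j) + cmod (?q j)" unfolding h by (rule norm_triangle_ineq4)
      also have "\<dots> \<le> cmod (?h j) + cmod (?q j) + cmod (?e j)" by (simp add: norm_mult)
      finally show ?thesis .
    next
      case False
      then have "wt j = 1" by (simp add: wt_def)
      then show ?thesis by simp
    qed
    then have "wt j powr s * ((wt j)\<^sup>2 * cmod (?e j)) \<le> wt j powr s * (cmod (?h j) + cmod (?q j) + cmod (?e j))"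
      by (intro mult_left_mono) auto
    then show ?thesis by (simp add: wt_powr_add2 algebra_simps)
  qed
  have "modes_norm K (s + 2) ?e \<le> L2_set (\<lambda>j. (wt j powr s * cmod (?h j) + wt j powr s * cmod (?q j)) + wt j powr s * cmod (?e j)) (modes K)"
    unfolding modes_norm_def by (intro L2_set_mono pt) auto
  also have "\<dots> \<le> L2_set (\<lambda>j. wt j powr s * cmod (?h j) + wt j powr s * cmod (?q j)) (modes K) + modes_norm K s ?e"
    unfolding modes_norm_def by (rule L2_set_triangle_ineq)
  also have "\<dots> \<le> (modes_norm K s ?h + modes_norm K s ?q) + modes_norm K s ?e"
    unfolding modes_norm_def by (intro add_right_mono L2_set_triangle_ineq)
  finally show ?thesis .
qed

text \<open>
  The same identity read in the other direction. It is used at the initial time, where the error of \<open>\<psi>\<close> is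
  known in order \<open>s + 2\<close>.
\<close>

lemma modes_norm_psi_rate_error:
  assumes "K \<ge> 1"
  shows "modes_norm K s (\<lambda>j. psi_rate u \<psi> j - psi_rate_num K b a j) \<le> modes_norm K (s + 2) (\<lambda>j. \<psi> j - a j)
     + modes_norm K s (\<lambda>j. conv u \<psi> j - aliased K (conv b a) j)"
proof -
  let ?e = "\<lambda>j. \<psi> j - a j" and ?h = "\<lambda>j. psi_rate u \<psi> j - psi_rate_num K b a j" and ?q = "\<lambda>j. conv u \<psi> j - aliased K (conv b a) j"
  have pt: "wt j powr s * cmod (?h j) \<le> wt j powr (s + 2) * cmod (?e j) + wt j powr s * cmod (?q j)" if j: "j \<in> modes K" for j
  proof -
    have h: "?h j = - \<i> * (lap j * ?e j + ?q j)"
      using j by (simp add: psi_rate_def psi_rate_num_def trunc_def algebra_simps)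
    have "cmod (?h j) = cmod (lap j * ?e j + ?q j)"
      unfolding h by (simp add: norm_mult)
    also have "\<dots> \<le> cmod (lap j * ?e j) + cmod (?q j)" by (rule norm_triangle_ineq)
    also have "\<dots> \<le> (wt j)\<^sup>2 * cmod (?e j) + cmod (?q j)"
      by (simp add: lap_def norm_mult norm_power mult_right_mono norm_freq_sq_le)
    finally have "wt j powr s * cmod (?h j) \<le> wt j powr s * ((wt j)\<^sup>2 * cmod (?e j) + cmod (?q j))"
      by (intro mult_left_mono) auto
    then show ?thesis by (simp add: wt_powr_add2 algebra_simps)
  qed
  have "modes_norm K s ?h \<le> L2_set (\<lambda>j. wt j powr (s + 2) * cmod (?e j) + wt j powr s * cmod (?q j)) (modes K)"
    unfolding modes_norm_def by (intro L2_set_mono pt) auto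
  also have "\<dots> \<le> modes_norm K (s + 2) ?e + modes_norm K s ?q"
    unfolding modes_norm_def by (rule L2_set_triangle_ineq)
  finally show ?thesis .
qed

definition in_modes :: "nat \<Rightarrow> (int^'n \<Rightarrow> complex) \<Rightarrow> bool" where
  "in_modes K x \<longleftrightarrow> (\<forall>j. j \<notin> modes K \<longrightarrow> x j = 0)"

text \<open>
  As long as the error is at most 1, the approximation is bounded in terms of the exact solution: the
  constant collects \<open>M\<close> for the solution, \<open>1\<close> for the retained modes, and again \<open>M\<close> for the tail.
\<close>

lemma hbound_approximant:
  assumes x: "hbound (s + \<sigma>) x M" and p: "in_modes K p" and \<sigma>: "\<sigma> \<ge> 0" and K: "K \<ge> 1"
    and N: "modes_norm K s (\<lambda>j. x j - p j) \<le> 1"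
  shows "hbound s p (2 * M + 1)"
proof -
  have M: "M \<ge> 0" using x hbound_nonneg by auto
  have k: "real K powr (- \<sigma>) \<le> 1" using K \<sigma> by (simp add: powr_minus ge_one_powr_ge_zero inverse_le_1_iff)
  have xs: "hbound s x M" using x \<sigma> by (rule_tac hbound_weaken) auto
  have "hbound s (\<lambda>j. x j - p j) (modes_norm K s (\<lambda>j. x j - p j) + real K powr (- \<sigma>) * M)"
    by (rule hbound_error[OF x _ \<sigma> K]) (use p in \<open>simp add: in_modes_def\<close>)
  from hbound_diff[OF xs this]
  have "hbound s p (M + (modes_norm K s (\<lambda>j. x j - p j) + real K powr (- \<sigma>) * M))" by simp
  moreover have "real K powr (- \<sigma>) * M \<le> 1 * M" by (intro mult_right_mono k M)
  ultimately show ?thesis using N by (elim hbound_mono) simp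
qed

lemma error_bound_scaled:
  assumes x: "hbound (s + \<sigma>) x M" and p: "in_modes K p" and \<sigma>: "\<sigma> \<ge> 0" and K: "K \<ge> 1"
    and N: "modes_norm K s (\<lambda>j. x j - p j) \<le> B * (real K powr (- \<sigma>) + y)" and y: "y \<ge> 0" and A: "B + M \<le> A"
  shows "hbound s (\<lambda>j. x j - p j) (A * (real K powr (- \<sigma>) + y))"
proof -
  have M: "M \<ge> 0" using x hbound_nonneg by auto
  have "hbound s (\<lambda>j. x j - p j) (modes_norm K s (\<lambda>j. x j - p j) + real K powr (- \<sigma>) * M)"
    by (rule hbound_error[OF x _ \<sigma> K]) (use p in \<open>simp add: in_modes_def\<close>)
  moreover have "modes_norm K s (\<lambda>j. x j - p j) + real K powr (- \<sigma>) * M \<le> A * (real K powr (- \<sigma>) + y)"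
  proof -
    have "real K powr (- \<sigma>) * M \<le> M * (real K powr (- \<sigma>) + y)" using y M by (simp add: distrib_left mult.commute)
    then have "modes_norm K s (\<lambda>j. x j - p j) + real K powr (- \<sigma>) * M \<le> (B + M) * (real K powr (- \<sigma>) + y)"
      using N by (simp add: distrib_right)
    also have "\<dots> \<le> A * (real K powr (- \<sigma>) + y)" using A y by (intro mult_right_mono) auto
    finally show ?thesis .
  qed
  ultimately show ?thesis by (rule hbound_mono)
qed

lemma conj_coeff_diff: "conj_coeff x j - conj_coeff y j = conj_coeff (\<lambda>j. x j - y j) j"
  by (simp add: conj_coeff_def)

lemma hbound_conj_coeff: "hbound s x X \<Longrightarrow> hbound s (conj_coeff x) X"
  using hbound_reflect[of s x X] by (simp add: conj_coeff_def[abs_def])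

definition regular_state :: "real \<Rightarrow> real \<Rightarrow> real \<Rightarrow> (int^'n \<Rightarrow> complex) \<Rightarrow> (int^'n \<Rightarrow> complex) \<Rightarrow> (int^'n \<Rightarrow> complex) \<Rightarrow> bool" where
  "regular_state s \<sigma> M \<psi> u w \<longleftrightarrow> hbound (s + 2 + \<sigma>) \<psi> M \<and> hbound (s + 1 + \<sigma>) u M \<and> hbound (s + \<sigma>) w M"

text \<open>
  The energy of the error of \<open>\<psi>\<close>, its time derivative, the error of \<open>u\<close>, and its time derivative. The error
  of \<open>\<psi>\<close> enters in order \<open>s\<close> only; the two further derivatives are encoded in \<open>h\<close>.
\<close>

definition error_energy ::
  "nat \<Rightarrow> real \<Rightarrow> (int^'n \<Rightarrow> complex) \<Rightarrow> (int^'n \<Rightarrow> complex) \<Rightarrow> (int^'n \<Rightarrow> complex) \<Rightarrow> (int^'n \<Rightarrow> complex) \<Rightarrow> real" where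
  "error_energy K s e h \<eta> \<omega> = (modes_norm K s e)\<^sup>2 + (modes_norm K s h)\<^sup>2 + (modes_norm K (s + 1) \<eta>)\<^sup>2 + (modes_norm K s \<omega>)\<^sup>2"

text \<open>
  The norm in which convergence is claimed, over the retained modes.
\<close>

definition total_error ::
  "nat \<Rightarrow> real \<Rightarrow> (int^'n \<Rightarrow> complex) \<Rightarrow> (int^'n \<Rightarrow> complex) \<Rightarrow> (int^'n \<Rightarrow> complex) \<Rightarrow> real" where
  "total_error K s e \<eta> \<omega> = modes_norm K (s + 2) e + modes_norm K (s + 1) \<eta> + modes_norm K s \<omega>"

lemma total_error_le_imp:
  assumes "total_error K s e \<eta> \<omega> \<le> B"
  shows "modes_norm K (s + 2) e \<le> B" "modes_norm K (s + 1) \<eta> \<le> B" "modes_norm K s \<omega> \<le> B"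
proof -
  have "0 \<le> modes_norm K (s + 2) e" "0 \<le> modes_norm K (s + 1) \<eta>" "0 \<le> modes_norm K s \<omega>" by simp_all
  then show "modes_norm K (s + 2) e \<le> B" "modes_norm K (s + 1) \<eta> \<le> B" "modes_norm K s \<omega> \<le> B"
    using assms unfolding total_error_def by linarith+
qed

definition state_error ::
  "nat \<Rightarrow> real \<Rightarrow> (int^'n \<Rightarrow> complex) \<Rightarrow> (int^'n \<Rightarrow> complex) \<Rightarrow> (int^'n \<Rightarrow> complex)
     \<Rightarrow> (int^'n \<Rightarrow> complex) \<Rightarrow> (int^'n \<Rightarrow> complex) \<Rightarrow> (int^'n \<Rightarrow> complex) \<Rightarrow> real" where
  "state_error K s \<psi> u w a b c = total_error K s (\<lambda>j. \<psi> j - a j) (\<lambda>j. u j - b j) (\<lambda>j. w j - c j)"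

definition state_energy ::
  "nat \<Rightarrow> real \<Rightarrow> (int^'n \<Rightarrow> complex) \<Rightarrow> (int^'n \<Rightarrow> complex) \<Rightarrow> (int^'n \<Rightarrow> complex)
     \<Rightarrow> (int^'n \<Rightarrow> complex) \<Rightarrow> (int^'n \<Rightarrow> complex) \<Rightarrow> (int^'n \<Rightarrow> complex) \<Rightarrow> real" where
  "state_energy K s \<psi> u w a b c = error_energy K s (\<lambda>j. \<psi> j - a j)
     (\<lambda>j. psi_rate u \<psi> j - psi_rate_num K b a j) (\<lambda>j. u j - b j) (\<lambda>j. w j - c j)"

lemma error_energy_le_imp:
  assumes "error_energy K s e h \<eta> \<omega> \<le> y\<^sup>2" "0 \<le> y"
  shows "modes_norm K s e \<le> y" "modes_norm K s h \<le> y" "modes_norm K (s + 1) \<eta> \<le> y" "modes_norm K s \<omega> \<le> y"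
proof -
  have "0 \<le> (modes_norm K s e)\<^sup>2" "0 \<le> (modes_norm K s h)\<^sup>2" "0 \<le> (modes_norm K (s + 1) \<eta>)\<^sup>2" "0 \<le> (modes_norm K s \<omega>)\<^sup>2"
    by simp_all
  then have "(modes_norm K s e)\<^sup>2 \<le> y\<^sup>2" "(modes_norm K s h)\<^sup>2 \<le> y\<^sup>2" "(modes_norm K (s + 1) \<eta>)\<^sup>2 \<le> y\<^sup>2" "(modes_norm K s \<omega>)\<^sup>2 \<le> y\<^sup>2"
    using assms(1) unfolding error_energy_def by linarith+
  then show "modes_norm K s e \<le> y" "modes_norm K s h \<le> y" "modes_norm K (s + 1) \<eta> \<le> y" "modes_norm K s \<omega> \<le> y"
    using assms(2) by (auto intro: power2_le_imp_le)
qed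

text \<open>
  The forcing of the equation for the error of the time derivative of \<open>\<psi>\<close>: the time derivative of the
  product \<open>u \<psi>\<close> minus that of its pseudospectral counterpart.
\<close>

definition rate_defect ::
  "nat \<Rightarrow> (int^'n \<Rightarrow> complex) \<Rightarrow> (int^'n \<Rightarrow> complex) \<Rightarrow> (int^'n \<Rightarrow> complex)
     \<Rightarrow> (int^'n \<Rightarrow> complex) \<Rightarrow> (int^'n \<Rightarrow> complex) \<Rightarrow> (int^'n \<Rightarrow> complex) \<Rightarrow> int^'n \<Rightarrow> complex" where
  "rate_defect K \<psi> u w a b c j = (conv w \<psi> j + conv u (psi_rate u \<psi>) j)
     - (aliased K (conv c a) j + aliased K (conv b (psi_rate_num K b a)) j)"

definition density_defect :: "nat \<Rightarrow> (int^'n \<Rightarrow> complex) \<Rightarrow> (int^'n \<Rightarrow> complex) \<Rightarrow> int^'n \<Rightarrow> complex" where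
  "density_defect K \<psi> a j = conv \<psi> (conj_coeff \<psi>) j - aliased K (conv a (conj_coeff a)) j"

text \<open>
  The energy controls everything that occurs in its own derivative. The errors of the products of \<open>u\<close> or its
  time derivative with \<open>\<psi>\<close> or its time derivative follow in order \<open>s\<close> from \<open>bilinear_error_uniform\<close>, since
  all these factors lie in order \<open>s + \<sigma>\<close>. The error of \<open>u \<psi>\<close> then gives two more derivatives of the error of
  \<open>\<psi>\<close> (\<open>recover_two_derivatives\<close>), and only with these can the density defect be estimated in order \<open>s + 2\<close>.
\<close>

lemma static_estimates:
  fixes s \<sigma> M :: real
  assumes s: "s > real CARD('n::finite) / 2" and \<sigma>: "\<sigma> \<ge> 0"
  shows "\<exists>C>0. \<forall>K\<ge>1. \<forall>(\<psi>::int^'n \<Rightarrow> complex) u w a b c y.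
     regular_state s \<sigma> M \<psi> u w \<longrightarrow> in_modes K a \<longrightarrow> in_modes K b \<longrightarrow> in_modes K c \<longrightarrow>
     state_error K s \<psi> u w a b c \<le> 1 \<longrightarrow> 0 \<le> y \<longrightarrow> state_energy K s \<psi> u w a b c \<le> y\<^sup>2 \<longrightarrow>
     modes_norm K (s + 2) (\<lambda>j. \<psi> j - a j) \<le> C * (real K powr (- \<sigma>) + y) \<and>
     modes_norm K s (rate_defect K \<psi> u w a b c) \<le> C * (real K powr (- \<sigma>) + y) \<and>
     modes_norm K (s + 2) (density_defect K \<psi> a) \<le> C * (real K powr (- \<sigma>) + y)"
proof (cases "M \<ge> 0")
  case False
  have "\<not> hbound r x M" for r and x :: "int^'n \<Rightarrow> complex" using False hbound_nonneg by blast
  then show ?thesis by (intro exI[of _ 1]) (auto simp: regular_state_def)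
next
  case M: True
  have s2: "s + 2 > real CARD('n) / 2" and s\<sigma>: "s + \<sigma> > real CARD('n) / 2" using s \<sigma> by auto
  obtain C1 where C1: "C1 > 0" and B1: "\<forall>K\<ge>1. \<forall>(x::int^'n \<Rightarrow> complex) y p q A z.
     hbound (s + \<sigma>) x A \<longrightarrow> hbound (s + \<sigma>) y A \<longrightarrow> hbound s p A \<longrightarrow> real K powr (- \<sigma>) \<le> z \<longrightarrow>
     hbound s (\<lambda>j. x j - p j) (A * z) \<longrightarrow> hbound s (\<lambda>j. y j - q j) (A * z) \<longrightarrow>
     modes_norm K s (\<lambda>j. conv x y j - aliased K (conv p q) j) \<le> C1 * (A\<^sup>2 * z)"
    using bilinear_error_uniform[OF s \<sigma>] by blast
  obtain C2 where C2: "C2 > 0" and B2: "\<forall>K\<ge>1. \<forall>(x::int^'n \<Rightarrow> complex) y p q A z.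
     hbound (s + 2 + \<sigma>) x A \<longrightarrow> hbound (s + 2 + \<sigma>) y A \<longrightarrow> hbound (s + 2) p A \<longrightarrow> real K powr (- \<sigma>) \<le> z \<longrightarrow>
     hbound (s + 2) (\<lambda>j. x j - p j) (A * z) \<longrightarrow> hbound (s + 2) (\<lambda>j. y j - q j) (A * z) \<longrightarrow>
     modes_norm K (s + 2) (\<lambda>j. conv x y j - aliased K (conv p q) j) \<le> C2 * (A\<^sup>2 * z)"
    using bilinear_error_uniform[OF s2 \<sigma>] by blast
  obtain C3 where C3: "C3 > 0" and B3: "\<forall>(u::int^'n \<Rightarrow> complex) \<psi> M. hbound (s + \<sigma>) u M \<longrightarrow> hbound (s + \<sigma> + 2) \<psi> M
     \<longrightarrow> hbound (s + \<sigma>) (psi_rate u \<psi>) (M + C3 * M * M)"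
    using hbound_psi_rate[OF s\<sigma>] by blast
  define M2 where "M2 = M + C3 * M * M"
  have M2: "M2 \<ge> 0" using M C3 by (simp add: M2_def)
  \<comment> \<open>\<open>A\<close> bounds the exact and the approximate factors in order \<open>s\<close>, and also the errors divided by \<open>?z\<close>.
    \<open>B\<close> is the constant of the recovered \<open>s + 2\<close> norm, and \<open>A'\<close> replaces \<open>A\<close> in that order.\<close>
  define A where "A = 2 * M + 1 + M2"
  define B where "B = 2 + C1 * A\<^sup>2"
  define A' where "A' = A + B"
  have A: "A \<ge> 0" "M \<le> A" "2 * M + 1 \<le> A" "1 + M \<le> A" "1 + M2 \<le> A" "M2 \<le> A" using M M2 by (auto simp: A_def)
  have B: "B \<ge> 0" using C1 by (simp add: B_def)
  define C where "C = B + 2 * (C1 * A\<^sup>2) + C2 * A'\<^sup>2"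
  have C: "B \<le> C" "2 * (C1 * A\<^sup>2) \<le> C" "C2 * A'\<^sup>2 \<le> C" using B C1 C2 by (auto simp: C_def)
  have C0: "C > 0" unfolding C_def B_def using C1 C2 by (intro add_pos_nonneg) auto
  have "modes_norm K (s + 2) (\<lambda>j. \<psi> j - a j) \<le> C * (real K powr (- \<sigma>) + y) \<and>
     modes_norm K s (rate_defect K \<psi> u w a b c) \<le> C * (real K powr (- \<sigma>) + y) \<and>
     modes_norm K (s + 2) (density_defect K \<psi> a) \<le> C * (real K powr (- \<sigma>) + y)"
    if K: "K \<ge> 1" and reg: "regular_state s \<sigma> M \<psi> u w" and a: "in_modes K a" and b: "in_modes K b" and c: "in_modes K c"
     and le1: "state_error K s \<psi> u w a b c \<le> 1" and y: "0 \<le> y" and en: "state_energy K s \<psi> u w a b c \<le> y\<^sup>2"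
    for K and \<psi> u w a b c :: "int^'n \<Rightarrow> complex" and y
  proof -
    have psi: "hbound (s + 2 + \<sigma>) \<psi> M" and u: "hbound (s + 1 + \<sigma>) u M" and w: "hbound (s + \<sigma>) w M"
      using reg by (simp_all add: regular_state_def)
    note a1 = total_error_le_imp(1)[OF le1[unfolded state_error_def]]
      and b1 = total_error_le_imp(2)[OF le1[unfolded state_error_def]]
      and c1 = total_error_le_imp(3)[OF le1[unfolded state_error_def]]
    note ay = error_energy_le_imp(1)[OF en[unfolded state_energy_def] y]
      and hy = error_energy_le_imp(2)[OF en[unfolded state_energy_def] y]
      and b'y = error_energy_le_imp(3)[OF en[unfolded state_energy_def] y]
      and cy = error_energy_le_imp(4)[OF en[unfolded state_energy_def] y]
    let ?k = "real K powr (- \<sigma>)"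
    let ?z = "?k + y"
    have kz: "?k \<le> ?z" using y by simp
    have z0: "0 \<le> ?z" using y by simp
    have yz: "y \<le> 1 * ?z" by simp
    have psi': "hbound (s + \<sigma>) \<psi> M" by (rule hbound_weaken[OF psi]) simp
    have u': "hbound (s + \<sigma>) u M" by (rule hbound_weaken[OF u]) simp
    have a1': "modes_norm K s (\<lambda>j. \<psi> j - a j) \<le> 1" using a1 modes_norm_mono[of s "s + 2" K "\<lambda>j. \<psi> j - a j"] by simp
    have b1': "modes_norm K s (\<lambda>j. u j - b j) \<le> 1" using b1 modes_norm_mono[of s "s + 1" K "\<lambda>j. u j - b j"] by simp
    have b'y': "modes_norm K s (\<lambda>j. u j - b j) \<le> y" using b'y modes_norm_mono[of s "s + 1" K "\<lambda>j. u j - b j"] by simp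
    have rate: "hbound (s + \<sigma>) (psi_rate u \<psi>) M2" unfolding M2_def
      by (rule B3[rule_format, OF u']) (use psi in \<open>simp add: add_ac\<close>)
    have rm: "in_modes K (psi_rate_num K b a)" by (simp add: in_modes_def psi_rate_num_def trunc_def)
    have bA: "hbound s b A" using hbound_approximant[OF u' b \<sigma> K b1'] A(3) by (rule hbound_mono)
    have cA: "hbound s c A" using hbound_approximant[OF w c \<sigma> K c1] A(3) by (rule hbound_mono)
    have aA: "hbound (s + 2) a A" using hbound_approximant[OF psi a \<sigma> K a1] A(3) by (rule hbound_mono)
    have uA: "hbound (s + \<sigma>) u A" and wA: "hbound (s + \<sigma>) w A" and pA: "hbound (s + \<sigma>) \<psi> A" and rA: "hbound (s + \<sigma>) (psi_rate u \<psi>) A"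
      using u' w psi' rate A by (auto intro: hbound_mono)
    have dpsi: "hbound s (\<lambda>j. \<psi> j - a j) (A * ?z)"
      by (rule error_bound_scaled[OF psi' a \<sigma> K order_trans[OF ay yz] y A(4)])
    have du: "hbound s (\<lambda>j. u j - b j) (A * ?z)"
      by (rule error_bound_scaled[OF u' b \<sigma> K order_trans[OF b'y' yz] y A(4)])
    have dw: "hbound s (\<lambda>j. w j - c j) (A * ?z)"
      by (rule error_bound_scaled[OF w c \<sigma> K order_trans[OF cy yz] y A(4)])
    have dr: "hbound s (\<lambda>j. psi_rate u \<psi> j - psi_rate_num K b a j) (A * ?z)"
      by (rule error_bound_scaled[OF rate rm \<sigma> K order_trans[OF hy yz] y A(5)])
    have q0: "modes_norm K s (\<lambda>j. conv u \<psi> j - aliased K (conv b a) j) \<le> C1 * (A\<^sup>2 * ?z)"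
      by (rule B1[rule_format, OF K uA pA bA kz du dpsi])
    have q1: "modes_norm K s (\<lambda>j. conv w \<psi> j - aliased K (conv c a) j) \<le> C1 * (A\<^sup>2 * ?z)"
      by (rule B1[rule_format, OF K wA pA cA kz dw dpsi])
    have q2: "modes_norm K s (\<lambda>j. conv u (psi_rate u \<psi>) j - aliased K (conv b (psi_rate_num K b a)) j) \<le> C1 * (A\<^sup>2 * ?z)"
      by (rule B1[rule_format, OF K uA rA bA kz du dr])
    have "modes_norm K (s + 2) (\<lambda>j. \<psi> j - a j) \<le> y + C1 * (A\<^sup>2 * ?z) + y"
      using recover_two_derivatives[OF K, of s \<psi> a u b] hy q0 ay by linarith
    also have "\<dots> \<le> B * ?z" by (simp add: B_def algebra_simps)
    finally have e2: "modes_norm K (s + 2) (\<lambda>j. \<psi> j - a j) \<le> B * ?z" .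
    have A'1: "B + M \<le> A'" and A'2: "A \<le> A'" "M \<le> A'" using A B by (auto simp: A'_def)
    have dpsi2: "hbound (s + 2) (\<lambda>j. \<psi> j - a j) (A' * ?z)"
      by (rule error_bound_scaled[OF psi a \<sigma> K e2 y A'1])
    have dconj: "hbound (s + 2) (\<lambda>j. conj_coeff \<psi> j - conj_coeff a j) (A' * ?z)"
      unfolding conj_coeff_diff by (rule hbound_conj_coeff[OF dpsi2])
    have q3: "modes_norm K (s + 2) (density_defect K \<psi> a) \<le> C2 * (A'\<^sup>2 * ?z)"
      unfolding density_defect_def[abs_def]
      by (rule B2[rule_format, OF K hbound_mono[OF psi A'2(2)] hbound_conj_coeff[OF hbound_mono[OF psi A'2(2)]] hbound_mono[OF aA A'2(1)] kz dpsi2 dconj])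
    have "modes_norm K s (rate_defect K \<psi> u w a b c)
      = modes_norm K s (\<lambda>j. (conv w \<psi> j - aliased K (conv c a) j) + (conv u (psi_rate u \<psi>) j - aliased K (conv b (psi_rate_num K b a)) j))"
      by (simp add: rate_defect_def[abs_def] algebra_simps)
    also have "\<dots> \<le> C1 * (A\<^sup>2 * ?z) + C1 * (A\<^sup>2 * ?z)"
      by (rule order_trans[OF modes_norm_triangle add_mono[OF q1 q2]])
    finally have q12: "modes_norm K s (rate_defect K \<psi> u w a b c) \<le> 2 * (C1 * A\<^sup>2) * ?z" by (simp add: mult_ac)
    have "B * ?z \<le> C * ?z" "2 * (C1 * A\<^sup>2) * ?z \<le> C * ?z" "C2 * A'\<^sup>2 * ?z \<le> C * ?z"
      by (intro mult_right_mono C z0)+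
    then show ?thesis using e2 q12 q3 by (auto simp: mult.assoc)
  qed
  then show ?thesis using C0 by blast
qed

section \<open>Evolution of the error\<close>

lemma gronwall_linear:
  fixes f :: "real \<Rightarrow> real"
  assumes "t0 \<le> t" and f: "\<And>x. x \<in> {t0..t} \<Longrightarrow> (f has_real_derivative f' x) (at x within {t0..t})"
    and le: "\<And>x. x \<in> {t0..t} \<Longrightarrow> f' x \<le> L * f x"
  shows "f t \<le> f t0 * exp (L * (t - t0))"
proof -
  define g where "g x = f x * exp (- L * (x - t0))" for x
  have g: "(g has_real_derivative (f' x - L * f x) * exp (- L * (x - t0))) (at x within {t0..t})" if "x \<in> {t0..t}" for x
    unfolding g_def by (auto intro!: derivative_eq_intros f[OF that] simp: algebra_simps)
  have "g t \<le> g t0"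
  proof (rule DERIV_nonpos_imp_decreasing_open[OF assms(1)])
    show "continuous_on {t0..t} g" by (rule DERIV_continuous_on[OF g])
    fix x assume "t0 < x" "x < t"
    then have "DERIV g x :> (f' x - L * f x) * exp (- L * (x - t0))" "(f' x - L * f x) * exp (- L * (x - t0)) \<le> 0"
      using g[of x] le[of x] by (auto simp: at_within_Icc_at intro!: mult_nonpos_nonneg)
    then show "\<exists>y. DERIV g x :> y \<and> y \<le> 0" by blast
  qed
  then have "f t * exp (- L * (t - t0)) * exp (L * (t - t0)) \<le> f t0 * exp (L * (t - t0))"
    unfolding g_def by (intro mult_right_mono) auto
  then have le: "f t * (exp (- L * (t - t0)) * exp (L * (t - t0))) \<le> f t0 * exp (L * (t - t0))"
    by (simp only: mult.assoc)
  have "exp (- L * (t - t0)) * exp (L * (t - t0)) = 1" by (simp add: exp_add[symmetric])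
  from le[unfolded this] show ?thesis by simp
qed

lemma conv_trunc: "conv x (trunc N y) j = (\<Sum>l\<in>modes N. x (j - l) * y l)"
proof -
  have "conv x (trunc N y) j = (\<Sum>\<^sub>\<infinity>l\<in>modes N. x (j - l) * y l)"
    unfolding conv_def by (rule infsum_cong_neutral) (auto simp: trunc_def)
  then show ?thesis by (simp add: infsum_finite finite_modes)
qed

text \<open>
  The rate is uniform in the mode and in the sequences, which makes the convergence uniform in time when
  the sequences depend on time.
\<close>

lemma conv_trunc_error:
  fixes s :: real assumes s: "s > real CARD('n::finite) / 2" and \<sigma>: "\<sigma> \<ge> 0"
  shows "\<exists>C>0. \<forall>(x::int^'n \<Rightarrow> complex) y X Y. \<forall>N\<ge>1. \<forall>j. hbound s x X \<longrightarrow> hbound (s + \<sigma>) y Y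
     \<longrightarrow> cmod (conv x y j - conv x (trunc N y) j) \<le> C * X * (real N powr (- \<sigma>) * Y)"
proof -
  obtain C where C: "C > 0" and cv: "\<forall>(x::int^'n \<Rightarrow> complex) y X Y. hbound s x X \<longrightarrow> hbound s y Y \<longrightarrow> hbound s (conv x y) (C * X * Y)"
    using hbound_conv[OF s] by blast
  have s0: "s \<ge> 0" using s by (smt (verit) divide_nonneg_nonneg of_nat_0_le_iff)
  have "cmod (conv x y j - conv x (trunc N y) j) \<le> C * X * (real N powr (- \<sigma>) * Y)"
    if N: "N \<ge> 1" and x: "hbound s x X" and y: "hbound (s + \<sigma>) y Y" for x y :: "int^'n \<Rightarrow> complex" and X Y N j
  proof -
    have ys: "hbound s y Y" by (rule hbound_weaken[OF y]) (use \<sigma> in simp)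
    note lx = hbound_l1[OF s x] and ly = hbound_l1[OF s ys]
    have "hbound s (conv x (\<lambda>j. y j - trunc N y j)) (C * X * (real N powr (- \<sigma>) * Y))"
      by (rule cv[rule_format, OF x hbound_tail[OF y \<sigma> N]])
    from hbound_coeff_le[OF this, of j]
    have "wt j powr s * cmod (conv x y j - conv x (trunc N y) j) \<le> C * X * (real N powr (- \<sigma>) * Y)"
      by (simp add: conv_diff_right[OF lx ly trunc_l1])
    moreover have "1 * cmod (conv x y j - conv x (trunc N y) j) \<le> wt j powr s * cmod (conv x y j - conv x (trunc N y) j)"
      using s0 by (intro mult_right_mono ge_one_powr_ge_zero) auto
    ultimately show ?thesis by simp
  qed
  then show ?thesis using C by blast
qed

text \<open>
  The infinite sum is the limit of the finite sums over \<open>modes N\<close>. By \<open>conv_trunc_error\<close> their derivatives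
  converge uniformly on the time interval with the rate \<open>N powr - \<sigma>\<close>, so the limit may be differentiated
  term by term. This is how the equation for \<open>\<psi>\<close> is differentiated in time although the coefficients of
  \<open>\<psi>\<close> are only known to be differentiable one by one.
\<close>

lemma conv_has_vector_derivative:
  fixes x y :: "real \<Rightarrow> int^'n \<Rightarrow> complex"
  assumes s: "s > real CARD('n::finite) / 2" and \<sigma>: "\<sigma> > 0" and I: "convex I"
    and x: "\<And>t. t \<in> I \<Longrightarrow> hbound s (x t) X" and x': "\<And>t. t \<in> I \<Longrightarrow> hbound s (x' t) X"
    and y: "\<And>t. t \<in> I \<Longrightarrow> hbound (s + \<sigma>) (y t) Y" and y': "\<And>t. t \<in> I \<Longrightarrow> hbound (s + \<sigma>) (y' t) Y"
    and dx: "\<And>t j. t \<in> I \<Longrightarrow> ((\<lambda>\<tau>. x \<tau> j) has_vector_derivative x' t j) (at t within I)"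
    and dy: "\<And>t j. t \<in> I \<Longrightarrow> ((\<lambda>\<tau>. y \<tau> j) has_vector_derivative y' t j) (at t within I)"
    and t: "t \<in> I"
  shows "((\<lambda>\<tau>. conv (x \<tau>) (y \<tau>) j) has_vector_derivative conv (x' t) (y t) j + conv (x t) (y' t) j) (at t within I)"
proof -
  obtain C where C: "C > 0" and ce: "\<forall>(x::int^'n \<Rightarrow> complex) y X Y. \<forall>N\<ge>1. \<forall>j. hbound s x X \<longrightarrow> hbound (s + \<sigma>) y Y
     \<longrightarrow> cmod (conv x y j - conv x (trunc N y) j) \<le> C * X * (real N powr (- \<sigma>) * Y)"
    using conv_trunc_error[OF s less_imp_le[OF \<sigma>]] by blast
  define f where "f N \<tau> = conv (x \<tau>) (trunc N (y \<tau>)) j" for N \<tau>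
  define f' where "f' N \<tau> = conv (x' \<tau>) (trunc N (y \<tau>)) j + conv (x \<tau>) (trunc N (y' \<tau>)) j" for N \<tau>
  define g' where "g' \<tau> = conv (x' \<tau>) (y \<tau>) j + conv (x \<tau>) (y' \<tau>) j" for \<tau>
  have lim0: "((\<lambda>N. 2 * (C * X * (real N powr (- \<sigma>) * Y))) \<longlongrightarrow> 2 * (C * X * (0 * Y))) sequentially"
    by (intro tendsto_intros tendsto_neg_powr filterlim_real_sequentially) (use \<sigma> in simp)
  have df: "(f N has_derivative (\<lambda>h. h *\<^sub>R f' N \<tau>)) (at \<tau> within I)" if "\<tau> \<in> I" for N \<tau>
  proof -
    have "((\<lambda>r. \<Sum>l\<in>modes N. x r (j - l) * y r l) has_vector_derivative
        (\<Sum>l\<in>modes N. x \<tau> (j - l) * y' \<tau> l + x' \<tau> (j - l) * y \<tau> l)) (at \<tau> within I)"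
      by (intro has_vector_derivative_sum has_vector_derivative_mult dx dy that)
    then have "(f N has_vector_derivative f' N \<tau>) (at \<tau> within I)"
      unfolding f_def f'_def conv_trunc by (simp add: sum.distrib add.commute)
    then show ?thesis by (simp add: has_vector_derivative_def)
  qed
  have df_err: "cmod (f' N \<tau> - g' \<tau>) \<le> 2 * (C * X * (real N powr (- \<sigma>) * Y))" if "\<tau> \<in> I" "N \<ge> 1" for N \<tau>
  proof -
    have "f' N \<tau> - g' \<tau> = - ((conv (x' \<tau>) (y \<tau>) j - conv (x' \<tau>) (trunc N (y \<tau>)) j) + (conv (x \<tau>) (y' \<tau>) j - conv (x \<tau>) (trunc N (y' \<tau>)) j))"
      by (simp add: f'_def g'_def)
    also have "cmod \<dots> \<le> C * X * (real N powr (- \<sigma>) * Y) + C * X * (real N powr (- \<sigma>) * Y)"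
      unfolding norm_minus_cancel
      by (intro norm_triangle_mono ce[rule_format, OF that(2) x'[OF that(1)] y[OF that(1)]] ce[rule_format, OF that(2) x[OF that(1)] y'[OF that(1)]])
    also have "\<dots> = 2 * (C * X * (real N powr (- \<sigma>) * Y))" by (rule mult_2[symmetric])
    finally show ?thesis .
  qed
  have fl: "(\<lambda>N. f N \<tau>) \<longlonglongrightarrow> conv (x \<tau>) (y \<tau>) j" if "\<tau> \<in> I" for \<tau>
  proof -
    have "((\<lambda>N. f N \<tau> - conv (x \<tau>) (y \<tau>) j) \<longlongrightarrow> 0) sequentially"
    proof (rule Lim_null_comparison)
      show "\<forall>\<^sub>F N in sequentially. norm (f N \<tau> - conv (x \<tau>) (y \<tau>) j) \<le> 2 * (C * X * (real N powr (- \<sigma>) * Y))"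
        using eventually_ge_at_top[of 1]
      proof eventually_elim
        case (elim N)
        have "0 \<le> cmod (conv (x \<tau>) (y \<tau>) j - conv (x \<tau>) (trunc N (y \<tau>)) j)" by simp
        moreover have "cmod (conv (x \<tau>) (y \<tau>) j - conv (x \<tau>) (trunc N (y \<tau>)) j) \<le> C * X * (real N powr (- \<sigma>) * Y)"
          by (rule ce[rule_format, OF elim x[OF that] y[OF that]])
        ultimately show ?case unfolding f_def norm_minus_commute[of "conv (x \<tau>) (trunc N (y \<tau>)) j"] by linarith
      qed
      show "((\<lambda>N. 2 * (C * X * (real N powr (- \<sigma>) * Y))) \<longlongrightarrow> 0) sequentially" using lim0 by simp
    qed
    then show ?thesis by (rule LIM_zero_cancel)
  qed
  have "\<exists>g. \<forall>\<tau>\<in>I. (\<lambda>N. f N \<tau>) \<longlonglongrightarrow> g \<tau> \<and> (g has_derivative (\<lambda>h. h *\<^sub>R g' \<tau>)) (at \<tau> within I)"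
  proof (rule has_derivative_sequence[OF I df _ t fl[OF t]])
    fix e :: real assume e: "e > 0"
    have "\<forall>\<^sub>F N in sequentially. 2 * (C * X * (real N powr (- \<sigma>) * Y)) < e"
      using order_tendstoD(2)[OF lim0, of e] e by simp
    then show "\<forall>\<^sub>F N in sequentially. \<forall>\<tau>\<in>I. \<forall>h. norm (h *\<^sub>R f' N \<tau> - h *\<^sub>R g' \<tau>) \<le> e * norm h"
      using eventually_ge_at_top[of 1]
    proof eventually_elim
      case (elim N)
      show ?case
      proof (intro ballI allI)
        fix \<tau> and h :: real assume \<tau>: "\<tau> \<in> I"
        have "cmod (f' N \<tau> - g' \<tau>) \<le> e" using df_err[OF \<tau> elim(2)] elim(1) by linarith
        then have "\<bar>h\<bar> * cmod (f' N \<tau> - g' \<tau>) \<le> \<bar>h\<bar> * e" by (intro mult_left_mono) auto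
        then show "norm (h *\<^sub>R f' N \<tau> - h *\<^sub>R g' \<tau>) \<le> e * norm h"
          by (simp add: scaleR_diff_right[symmetric] mult.commute)
      qed
    qed
  qed
  then obtain g where g: "\<And>\<tau>. \<tau> \<in> I \<Longrightarrow> (\<lambda>N. f N \<tau>) \<longlonglongrightarrow> g \<tau>"
    "\<And>\<tau>. \<tau> \<in> I \<Longrightarrow> (g has_derivative (\<lambda>h. h *\<^sub>R g' \<tau>)) (at \<tau> within I)" by blast
  have "conv (x \<tau>) (y \<tau>) j = g \<tau>" if "\<tau> \<in> I" for \<tau>
    using LIMSEQ_unique[OF fl[OF that] g(1)[OF that]] .
  then have "((\<lambda>\<tau>. conv (x \<tau>) (y \<tau>) j) has_derivative (\<lambda>h. h *\<^sub>R g' t)) (at t within I)"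
    by (intro has_derivative_transform[OF t _ g(2)[OF t]])
  then show ?thesis by (simp add: has_vector_derivative_def g'_def)
qed

lemma aliased_conv_has_vector_derivative:
  fixes x y :: "real \<Rightarrow> int^'n \<Rightarrow> complex"
  assumes S: "\<And>t. in_modes K (x t)" "\<And>t. in_modes K (x' t)" "\<And>t. in_modes K (y t)" "\<And>t. in_modes K (y' t)"
    and dx: "\<And>j. j \<in> modes K \<Longrightarrow> ((\<lambda>\<tau>. x \<tau> j) has_vector_derivative x' t j) (at t within I)"
    and dy: "\<And>j. j \<in> modes K \<Longrightarrow> ((\<lambda>\<tau>. y \<tau> j) has_vector_derivative y' t j) (at t within I)"
  shows "((\<lambda>\<tau>. aliased K (conv (x \<tau>) (y \<tau>)) j) has_vector_derivative aliased K (conv (x' t) (y t)) j + aliased K (conv (x t) (y' t)) j) (at t within I)"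
proof -
  have fin: "aliased K (conv p q) j = (\<Sum>k\<in>modes K. \<Sum>l\<in>modes K. if k + l \<in> alias_class K j then p k * q l else 0)"
    if "in_modes K p" "in_modes K q" for p q :: "int^'n \<Rightarrow> complex"
    by (rule aliased_conv_finite[OF finite_modes]) (use that in \<open>auto simp: in_modes_def\<close>)
  have "((\<lambda>\<tau>. if k + l \<in> alias_class K j then x \<tau> k * y \<tau> l else 0) has_vector_derivative
      (if k + l \<in> alias_class K j then x t k * y' t l + x' t k * y t l else 0)) (at t within I)"
    if "k \<in> modes K" "l \<in> modes K" for k l
    using has_vector_derivative_mult[OF dx[OF that(1)] dy[OF that(2)]] by (cases "k + l \<in> alias_class K j") auto
  then have "((\<lambda>\<tau>. \<Sum>k\<in>modes K. \<Sum>l\<in>modes K. if k + l \<in> alias_class K j then x \<tau> k * y \<tau> l else 0) has_vector_derivative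
      (\<Sum>k\<in>modes K. \<Sum>l\<in>modes K. if k + l \<in> alias_class K j then x t k * y' t l + x' t k * y t l else 0)) (at t within I)"
    by (intro has_vector_derivative_sum)
  moreover have "(\<Sum>k\<in>modes K. \<Sum>l\<in>modes K. if k + l \<in> alias_class K j then x t k * y' t l + x' t k * y t l else 0)
    = aliased K (conv (x' t) (y t)) j + aliased K (conv (x t) (y' t)) j"
    unfolding fin[OF S(2,3)] fin[OF S(1,4)] sum.distrib[symmetric] by (intro sum.cong) auto
  ultimately show ?thesis unfolding fin[OF S(1,3)] by simp
qed

lemma cmod_sq_has_real_derivative:
  assumes "(z has_vector_derivative z') (at t within I)"
  shows "((\<lambda>\<tau>. (cmod (z \<tau>))\<^sup>2) has_real_derivative 2 * (z t \<bullet> z')) (at t within I)"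
proof -
  have "((\<lambda>\<tau>. z \<tau> \<bullet> z \<tau>) has_vector_derivative z t \<bullet> z' + z' \<bullet> z t) (at t within I)"
    by (rule bounded_bilinear.has_vector_derivative[OF bounded_bilinear_inner assms assms])
  then show ?thesis
    by (simp add: has_real_derivative_iff_has_vector_derivative power2_norm_eq_inner inner_commute)
qed

text \<open>
  Bookkeeping for a single frequency: \<open>E\<close>, \<open>H\<close>, \<open>V\<close>, \<open>W\<close> are the contributions of \<open>e\<close>, \<open>h\<close>, \<open>\<omega>\<close>, \<open>\<eta>\<close> to the
  energy, \<open>Q\<close> and \<open>P\<close> those of the two forcing terms.
\<close>

lemma combine_energy_terms:
  fixes E H W Q P V :: real
  assumes "a \<le> E + H" "b \<le> H + Q" "c \<le> W + 2 * V + P" "0 \<le> E" "0 \<le> W"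
  shows "a + b + c \<le> 2 * (E + H + W + V) + Q + P"
proof -
  have "a + b + c \<le> (E + H) + (H + Q) + (W + 2 * V + P)" by (intro add_mono assms)
  also have "\<dots> = 2 * (E + H + W + V) + Q + P - E - W" by (simp add: algebra_simps)
  finally show ?thesis using assms(4,5) by (simp add: algebra_simps)
qed

text \<open>
  The Laplacian acts by a real multiple of \<open>\<i>\<close>, which is orthogonal to \<open>h\<close>; only the forcing contributes.
\<close>

lemma schroedinger_term: "2 * (h \<bullet> (- \<i> * (complex_of_real r * h + q))) \<le> (cmod h)\<^sup>2 + (cmod q)\<^sup>2"
proof -
  have "h \<bullet> (- \<i> * (complex_of_real r * h + q)) = h \<bullet> (- \<i> * q)"
    by (simp add: inner_complex_def algebra_simps)
  moreover have "h \<bullet> (- \<i> * q) \<le> cmod h * cmod (- \<i> * q)" by (rule norm_cauchy_schwarz)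
  moreover have "cmod (- \<i> * q) = cmod q" by (simp add: norm_mult)
  ultimately have "2 * (h \<bullet> (- \<i> * (complex_of_real r * h + q))) \<le> 2 * cmod h * cmod q" by simp
  also have "\<dots> \<le> (cmod h)\<^sup>2 + (cmod q)\<^sup>2" by (rule sum_squares_bound)
  finally show ?thesis .
qed

text \<open>
  With \<open>|j|\<^sup>2\<close> in place of \<open>(wt j)\<^sup>2\<close> the products of \<open>e\<close> and \<open>f\<close> would cancel, as in the conservation of
  energy for the wave equation. The two weights differ by at most 1, and only at the zero frequency.
\<close>

lemma wave_term:
  fixes j :: "int^'n" and e f p :: complex
  shows "(wt j)\<^sup>2 * (2 * (e \<bullet> f)) + 2 * (f \<bullet> (- lap j * (e + p))) \<le> (wt j)\<^sup>2 * (cmod e)\<^sup>2 + 2 * (cmod f)\<^sup>2 + (wt j)^4 * (cmod p)\<^sup>2"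
proof -
  let ?r = "(norm (freq j))\<^sup>2"
  have gap: "0 \<le> (wt j)\<^sup>2 - ?r" "(wt j)\<^sup>2 - ?r \<le> 1" "?r \<le> (wt j)\<^sup>2" "0 \<le> ?r"
    using norm_freq_sq_le[of j] by (auto simp: wt_def max_def)
  have eq: "(wt j)\<^sup>2 * (2 * (e \<bullet> f)) + 2 * (f \<bullet> (- lap j * (e + p))) = ((wt j)\<^sup>2 - ?r) * (2 * (e \<bullet> f)) - ?r * (2 * (f \<bullet> p))"
    by (simp add: lap_def inner_complex_def algebra_simps)
  have ef: "2 * (e \<bullet> f) \<le> (cmod e)\<^sup>2 + (cmod f)\<^sup>2"
    using norm_cauchy_schwarz[of e f] sum_squares_bound[of "cmod e" "cmod f"] by linarith
  have "((wt j)\<^sup>2 - ?r) * (2 * (e \<bullet> f)) \<le> ((wt j)\<^sup>2 - ?r) * ((cmod e)\<^sup>2 + (cmod f)\<^sup>2)"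
    by (intro mult_left_mono ef gap)
  also have "\<dots> \<le> 1 * ((cmod e)\<^sup>2 + (cmod f)\<^sup>2)" by (intro mult_right_mono gap) auto
  also have "\<dots> \<le> (wt j)\<^sup>2 * (cmod e)\<^sup>2 + (cmod f)\<^sup>2"
    using mult_right_mono[of 1 "(wt j)\<^sup>2" "(cmod e)\<^sup>2"] by (simp add: one_le_power)
  finally have 1: "((wt j)\<^sup>2 - ?r) * (2 * (e \<bullet> f)) \<le> (wt j)\<^sup>2 * (cmod e)\<^sup>2 + (cmod f)\<^sup>2" .
  have "- (f \<bullet> p) \<le> cmod f * cmod p"
    using norm_cauchy_schwarz[of "- f" p] by simp
  then have "?r * (2 * - (f \<bullet> p)) \<le> ?r * (2 * (cmod f * cmod p))"
    by (intro mult_left_mono gap) auto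
  then have "- (?r * (2 * (f \<bullet> p))) \<le> ?r * (2 * (cmod f * cmod p))" by (simp only: mult_minus_right)
  also have "\<dots> \<le> (wt j)\<^sup>2 * (2 * (cmod f * cmod p))" by (intro mult_right_mono gap) auto
  also have "\<dots> = 2 * cmod f * ((wt j)\<^sup>2 * cmod p)" by (simp only: mult_ac)
  also have "\<dots> \<le> (cmod f)\<^sup>2 + ((wt j)\<^sup>2 * cmod p)\<^sup>2" by (rule sum_squares_bound)
  also have "((wt j)\<^sup>2 * cmod p)\<^sup>2 = (wt j)^4 * (cmod p)\<^sup>2" by (simp add: power_mult_distrib power_mult[symmetric])
  finally show ?thesis using 1 unfolding eq by linarith
qed

text \<open>
  The equations for \<open>e\<close>, \<open>h\<close>, \<open>\<eta>\<close>, \<open>\<omega>\<close> hold mode by mode, and \<open>schroedinger_term\<close> and \<open>wave_term\<close> bound the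
  contribution of each mode. The forcing \<open>p\<close> of the wave equation stands under the Laplacian, hence its norm
  of order \<open>s + 2\<close>.
\<close>

lemma error_energy_derivative:
  fixes e h \<eta> \<omega> :: "real \<Rightarrow> int^'n \<Rightarrow> complex"
  assumes e: "\<And>j. j \<in> modes K \<Longrightarrow> ((\<lambda>\<tau>. e \<tau> j) has_vector_derivative h t j) (at t within I)"
    and h: "\<And>j. j \<in> modes K \<Longrightarrow> ((\<lambda>\<tau>. h \<tau> j) has_vector_derivative - \<i> * (lap j * h t j + q j)) (at t within I)"
    and \<eta>: "\<And>j. j \<in> modes K \<Longrightarrow> ((\<lambda>\<tau>. \<eta> \<tau> j) has_vector_derivative \<omega> t j) (at t within I)"
    and \<omega>: "\<And>j. j \<in> modes K \<Longrightarrow> ((\<lambda>\<tau>. \<omega> \<tau> j) has_vector_derivative - lap j * (\<eta> t j + p j)) (at t within I)"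
  shows "\<exists>D. ((\<lambda>\<tau>. error_energy K s (e \<tau>) (h \<tau>) (\<eta> \<tau>) (\<omega> \<tau>)) has_real_derivative D) (at t within I) \<and>
     D \<le> 2 * error_energy K s (e t) (h t) (\<eta> t) (\<omega> t) + (modes_norm K s q)\<^sup>2 + (modes_norm K (s + 2) p)\<^sup>2"
proof -
  let ?w = "\<lambda>j :: int^'n. wt j powr (2 * s)"
  have w1: "wt j powr (2 * (s + 1)) = ?w j * (wt j)\<^sup>2" for j :: "int^'n"
    by (simp add: distrib_left powr_add powr_numeral)
  have w2: "wt j powr (2 * (s + 2)) = ?w j * (wt j) ^ 4" for j :: "int^'n"
    by (simp add: distrib_left powr_add powr_numeral)
  define D where "D = (\<Sum>j\<in>modes K. ?w j * (2 * (e t j \<bullet> h t j)) + ?w j * (2 * (h t j \<bullet> (- \<i> * (lap j * h t j + q j))))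
     + ?w j * (wt j)\<^sup>2 * (2 * (\<eta> t j \<bullet> \<omega> t j)) + ?w j * (2 * (\<omega> t j \<bullet> (- lap j * (\<eta> t j + p j)))))"
  have en: "error_energy K s e' h' \<eta>' \<omega>' = (\<Sum>j\<in>modes K. ?w j * (cmod (e' j))\<^sup>2 + ?w j * (cmod (h' j))\<^sup>2
     + ?w j * (wt j)\<^sup>2 * (cmod (\<eta>' j))\<^sup>2 + ?w j * (cmod (\<omega>' j))\<^sup>2)" for e' h' \<eta>' \<omega>' :: "int^'n \<Rightarrow> complex"
    unfolding error_energy_def modes_norm_sq w1 by (simp add: sum.distrib)
  have "((\<lambda>\<tau>. error_energy K s (e \<tau>) (h \<tau>) (\<eta> \<tau>) (\<omega> \<tau>)) has_real_derivative D) (at t within I)"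
    unfolding en D_def
    by (intro DERIV_sum DERIV_add DERIV_cmult cmod_sq_has_real_derivative e h \<eta> \<omega>)
  moreover have "D \<le> 2 * error_energy K s (e t) (h t) (\<eta> t) (\<omega> t) + (modes_norm K s q)\<^sup>2 + (modes_norm K (s + 2) p)\<^sup>2"
  proof -
    have "D \<le> (\<Sum>j\<in>modes K. 2 * (?w j * (cmod (e t j))\<^sup>2 + ?w j * (cmod (h t j))\<^sup>2 + ?w j * (wt j)\<^sup>2 * (cmod (\<eta> t j))\<^sup>2 + ?w j * (cmod (\<omega> t j))\<^sup>2)
       + ?w j * (cmod (q j))\<^sup>2 + ?w j * (wt j) ^ 4 * (cmod (p j))\<^sup>2)"
      unfolding D_def
    proof (rule sum_mono)
      fix j :: "int^'n"
      have "2 * (e t j \<bullet> h t j) \<le> (cmod (e t j))\<^sup>2 + (cmod (h t j))\<^sup>2"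
        using norm_cauchy_schwarz[of "e t j" "h t j"] sum_squares_bound[of "cmod (e t j)" "cmod (h t j)"] by linarith
      moreover have "2 * (h t j \<bullet> (- \<i> * (lap j * h t j + q j))) \<le> (cmod (h t j))\<^sup>2 + (cmod (q j))\<^sup>2"
        unfolding lap_def by (rule schroedinger_term)
      ultimately have "2 * (e t j \<bullet> h t j) + 2 * (h t j \<bullet> (- \<i> * (lap j * h t j + q j))) + ((wt j)\<^sup>2 * (2 * (\<eta> t j \<bullet> \<omega> t j)) + 2 * (\<omega> t j \<bullet> (- lap j * (\<eta> t j + p j))))
        \<le> 2 * ((cmod (e t j))\<^sup>2 + (cmod (h t j))\<^sup>2 + (wt j)\<^sup>2 * (cmod (\<eta> t j))\<^sup>2 + (cmod (\<omega> t j))\<^sup>2) + (cmod (q j))\<^sup>2 + (wt j) ^ 4 * (cmod (p j))\<^sup>2"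
        by (rule combine_energy_terms) (rule wave_term, simp_all)
      from mult_left_mono[OF this, of "?w j"]
      show "?w j * (2 * (e t j \<bullet> h t j)) + ?w j * (2 * (h t j \<bullet> (- \<i> * (lap j * h t j + q j))))
         + ?w j * (wt j)\<^sup>2 * (2 * (\<eta> t j \<bullet> \<omega> t j)) + ?w j * (2 * (\<omega> t j \<bullet> (- lap j * (\<eta> t j + p j))))
         \<le> 2 * (?w j * (cmod (e t j))\<^sup>2 + ?w j * (cmod (h t j))\<^sup>2 + ?w j * (wt j)\<^sup>2 * (cmod (\<eta> t j))\<^sup>2 + ?w j * (cmod (\<omega> t j))\<^sup>2)
       + ?w j * (cmod (q j))\<^sup>2 + ?w j * (wt j) ^ 4 * (cmod (p j))\<^sup>2"
        by (simp only: distrib_left mult.assoc mult.left_commute[of "?w j" 2] powr_ge_zero add.assoc)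
    qed
    also have "\<dots> = 2 * error_energy K s (e t) (h t) (\<eta> t) (\<omega> t) + (modes_norm K s q)\<^sup>2 + (modes_norm K (s + 2) p)\<^sup>2"
      unfolding en modes_norm_sq w2 by (simp add: sum.distrib sum_distrib_left[symmetric])
    finally show ?thesis .
  qed
  ultimately show ?thesis by blast
qed

lemma modes_norm_interpolation_error:
  fixes s :: real assumes s: "s > real CARD('n::finite) / 2" and \<sigma>: "\<sigma> \<ge> 0"
  shows "\<exists>C>0. \<forall>K\<ge>1. \<forall>(x::int^'n \<Rightarrow> complex) X. hbound (s + \<sigma>) x X
    \<longrightarrow> modes_norm K s (\<lambda>j. x j - trunc K (aliased K x) j) \<le> C * (real K powr (- \<sigma>) * X)"
proof -
  obtain C where C: "C > 0" and B: "\<forall>K\<ge>1. \<forall>(x::int^'n \<Rightarrow> complex) X. hbound (s + \<sigma>) x X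
    \<longrightarrow> hbound s (trunc K (\<lambda>j. x j - aliased K x j)) (C * (real K powr (- \<sigma>) * X))"
    using hbound_alias_error[OF s \<sigma>] by blast
  have "modes_norm K s (\<lambda>j. x j - trunc K (aliased K x) j) \<le> C * (real K powr (- \<sigma>) * X)"
    if "K \<ge> 1" "hbound (s + \<sigma>) x X" for K and x :: "int^'n \<Rightarrow> complex" and X
  proof -
    have "modes_norm K s (\<lambda>j. x j - trunc K (aliased K x) j) = modes_norm K s (\<lambda>j. x j - aliased K x j)"
      by (rule modes_norm_cong) (simp add: trunc_def)
    also have "\<dots> \<le> C * (real K powr (- \<sigma>) * X)" by (rule modes_norm_le) (rule B[rule_format, OF that])
    finally show ?thesis .
  qed
  then show ?thesis using C by blast
qed

text \<open>
  At the initial time all errors are interpolation errors. The error of the time derivative of \<open>\<psi>\<close> follows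
  from them by \<open>modes_norm_psi_rate_error\<close>; for it the approximation of \<open>u\<close> has to be bounded, which is
  ensured by the assumption that the error is at most 1.
\<close>

lemma initial_error:
  fixes s \<sigma> M :: real
  assumes s: "s > real CARD('n::finite) / 2" and \<sigma>: "\<sigma> \<ge> 0" and M: "M \<ge> 0"
  shows "\<exists>C>0. \<forall>K\<ge>1. \<forall>(\<psi>::int^'n \<Rightarrow> complex) u w a b c.
     regular_state s \<sigma> M \<psi> u w \<longrightarrow>
     a = trunc K (aliased K \<psi>) \<longrightarrow> b = trunc K (aliased K u) \<longrightarrow> c = trunc K (aliased K w) \<longrightarrow>
     state_error K s \<psi> u w a b c \<le> C * real K powr (- \<sigma>) \<and>
     (state_error K s \<psi> u w a b c \<le> 1 \<longrightarrow> state_energy K s \<psi> u w a b c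
       \<le> C * (real K powr (- \<sigma>))\<^sup>2)"
proof -
  have s1: "s + 1 > real CARD('n) / 2" and s2: "s + 2 > real CARD('n) / 2" using s by auto
  obtain C0 where C0: "C0 > 0" and I0: "\<forall>K\<ge>1. \<forall>(x::int^'n \<Rightarrow> complex) X. hbound (s + \<sigma>) x X
    \<longrightarrow> modes_norm K s (\<lambda>j. x j - trunc K (aliased K x) j) \<le> C0 * (real K powr (- \<sigma>) * X)"
    using modes_norm_interpolation_error[OF s \<sigma>] by blast
  obtain C1 where C1: "C1 > 0" and I1: "\<forall>K\<ge>1. \<forall>(x::int^'n \<Rightarrow> complex) X. hbound (s + 1 + \<sigma>) x X
    \<longrightarrow> modes_norm K (s + 1) (\<lambda>j. x j - trunc K (aliased K x) j) \<le> C1 * (real K powr (- \<sigma>) * X)"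
    using modes_norm_interpolation_error[OF s1 \<sigma>] by blast
  obtain C2 where C2: "C2 > 0" and I2: "\<forall>K\<ge>1. \<forall>(x::int^'n \<Rightarrow> complex) X. hbound (s + 2 + \<sigma>) x X
    \<longrightarrow> modes_norm K (s + 2) (\<lambda>j. x j - trunc K (aliased K x) j) \<le> C2 * (real K powr (- \<sigma>) * X)"
    using modes_norm_interpolation_error[OF s2 \<sigma>] by blast
  obtain Q where Q: "Q > 0" and BQ: "\<forall>K\<ge>1. \<forall>(x::int^'n \<Rightarrow> complex) y p q A z.
     hbound (s + \<sigma>) x A \<longrightarrow> hbound (s + \<sigma>) y A \<longrightarrow> hbound s p A \<longrightarrow> real K powr (- \<sigma>) \<le> z \<longrightarrow>
     hbound s (\<lambda>j. x j - p j) (A * z) \<longrightarrow> hbound s (\<lambda>j. y j - q j) (A * z) \<longrightarrow>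
     modes_norm K s (\<lambda>j. conv x y j - aliased K (conv p q) j) \<le> Q * (A\<^sup>2 * z)"
    using bilinear_error_uniform[OF s \<sigma>] by blast
  define B where "B = (C0 + C1 + C2) * M"
  have B: "C0 * M \<le> B" "C1 * M \<le> B" "C2 * M \<le> B" "B \<ge> 0"
    unfolding B_def using C0 C1 C2 M by (auto simp: distrib_right)
  define A where "A = 2 * M + 1 + B + M"
  have A: "2 * M + 1 \<le> A" "B + M \<le> A" "M \<le> A" using B M by (auto simp: A_def)
  define H where "H = B + Q * A\<^sup>2"
  have H: "H \<ge> 0" using B Q by (simp add: H_def)
  define C where "C = 1 + 3 * B + 3 * B\<^sup>2 + H\<^sup>2"
  have C: "3 * B \<le> C" "3 * B\<^sup>2 + H\<^sup>2 \<le> C" "C > 0" using B by (auto simp: C_def add_pos_nonneg)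
  have "state_error K s \<psi> u w a b c \<le> C * real K powr (- \<sigma>) \<and>
     (state_error K s \<psi> u w a b c \<le> 1 \<longrightarrow> state_energy K s \<psi> u w a b c
       \<le> C * (real K powr (- \<sigma>))\<^sup>2)"
    if K: "K \<ge> 1" and reg: "regular_state s \<sigma> M \<psi> u w"
      and a: "a = trunc K (aliased K \<psi>)" and b: "b = trunc K (aliased K u)" and c: "c = trunc K (aliased K w)"
    for K and \<psi> u w a b c :: "int^'n \<Rightarrow> complex"
  proof -
    have psi: "hbound (s + 2 + \<sigma>) \<psi> M" and u: "hbound (s + 1 + \<sigma>) u M" and w: "hbound (s + \<sigma>) w M"
      using reg by (simp_all add: regular_state_def)
    let ?k = "real K powr (- \<sigma>)"
    have k0: "?k \<ge> 0" by simp
    have e: "modes_norm K (s + 2) (\<lambda>j. \<psi> j - a j) \<le> B * ?k"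
    proof -
      have "modes_norm K (s + 2) (\<lambda>j. \<psi> j - a j) \<le> C2 * (?k * M)" unfolding a by (rule I2[rule_format, OF K psi])
      also have "\<dots> = (C2 * M) * ?k" by simp
      also have "\<dots> \<le> B * ?k" by (intro mult_right_mono B k0)
      finally show ?thesis .
    qed
    have eta: "modes_norm K (s + 1) (\<lambda>j. u j - b j) \<le> B * ?k"
    proof -
      have "modes_norm K (s + 1) (\<lambda>j. u j - b j) \<le> C1 * (?k * M)" unfolding b by (rule I1[rule_format, OF K u])
      also have "\<dots> = (C1 * M) * ?k" by simp
      also have "\<dots> \<le> B * ?k" by (intro mult_right_mono B k0)
      finally show ?thesis .
    qed
    have om: "modes_norm K s (\<lambda>j. w j - c j) \<le> B * ?k"
    proof -
      have "modes_norm K s (\<lambda>j. w j - c j) \<le> C0 * (?k * M)" unfolding c by (rule I0[rule_format, OF K w])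
      also have "\<dots> = (C0 * M) * ?k" by simp
      also have "\<dots> \<le> B * ?k" by (intro mult_right_mono B k0)
      finally show ?thesis .
    qed
    have es: "modes_norm K s (\<lambda>j. \<psi> j - a j) \<le> B * ?k"
      using e modes_norm_mono[of s "s + 2" K "\<lambda>j. \<psi> j - a j"] by simp
    have etas: "modes_norm K s (\<lambda>j. u j - b j) \<le> B * ?k"
      using eta modes_norm_mono[of s "s + 1" K "\<lambda>j. u j - b j"] by simp
    have 2: "state_energy K s \<psi> u w a b c
       \<le> C * ?k\<^sup>2" if le1: "state_error K s \<psi> u w a b c \<le> 1"
    proof -
      note b1 = total_error_le_imp(2)[OF le1[unfolded state_error_def]]
      have b1s: "modes_norm K s (\<lambda>j. u j - b j) \<le> 1"
        using b1 modes_norm_mono[of s "s + 1" K "\<lambda>j. u j - b j"] by simp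
      have ia: "in_modes K a" and ib: "in_modes K b" by (simp_all add: a b in_modes_def trunc_def)
      have psi': "hbound (s + \<sigma>) \<psi> M" by (rule hbound_weaken[OF psi]) simp
      have u': "hbound (s + \<sigma>) u M" by (rule hbound_weaken[OF u]) simp
      have du: "hbound s (\<lambda>j. u j - b j) (A * (?k + 0))"
        by (rule error_bound_scaled[OF u' ib \<sigma> K _ _ A(2)]) (use etas in auto)
      have dpsi: "hbound s (\<lambda>j. \<psi> j - a j) (A * (?k + 0))"
        by (rule error_bound_scaled[OF psi' ia \<sigma> K _ _ A(2)]) (use es in auto)
      have "modes_norm K s (\<lambda>j. conv u \<psi> j - aliased K (conv b a) j) \<le> Q * (A\<^sup>2 * (?k + 0))"
        by (rule BQ[rule_format, OF K hbound_mono[OF u' A(3)] hbound_mono[OF psi' A(3)] hbound_mono[OF hbound_approximant[OF u' ib \<sigma> K b1s] A(1)] _ du dpsi]) simp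
      then have h: "modes_norm K s (\<lambda>j. psi_rate u \<psi> j - psi_rate_num K b a j) \<le> H * ?k"
        using modes_norm_psi_rate_error[OF K, of s u \<psi> b a] e by (simp add: H_def distrib_right mult.assoc)
      have "state_energy K s \<psi> u w a b c
         \<le> (B * ?k)\<^sup>2 + (H * ?k)\<^sup>2 + (B * ?k)\<^sup>2 + (B * ?k)\<^sup>2"
        unfolding state_energy_def error_energy_def by (intro add_mono power_mono es h eta om) auto
      also have "\<dots> = (3 * B\<^sup>2 + H\<^sup>2) * ?k\<^sup>2" by (simp add: power_mult_distrib algebra_simps)
      also have "\<dots> \<le> C * ?k\<^sup>2" by (intro mult_right_mono C) auto
      finally show ?thesis .
    qed
    have "state_error K s \<psi> u w a b c \<le> (3 * B) * ?k"
      unfolding state_error_def total_error_def using e eta om by simp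
    also have "\<dots> \<le> C * ?k" by (intro mult_right_mono C k0)
    finally have 1: "state_error K s \<psi> u w a b c \<le> C * ?k" .
    then show ?thesis using 2 by blast
  qed
  then show ?thesis using C(3) by blast
qed

lemma psi_rate_has_vector_derivative:
  fixes \<psi> u w :: "real \<Rightarrow> int^'n \<Rightarrow> complex"
  assumes s: "s > real CARD('n::finite) / 2" and \<sigma>: "\<sigma> > 0" and I: "convex I" and sys: "exact_system I \<psi> u w"
    and reg: "\<And>t. t \<in> I \<Longrightarrow> regular_state s \<sigma> M (\<psi> t) (u t) (w t)"
    and t: "t \<in> I"
  shows "((\<lambda>\<tau>. psi_rate (u \<tau>) (\<psi> \<tau>) j) has_vector_derivative
     - \<i> * (lap j * psi_rate (u t) (\<psi> t) j + (conv (w t) (\<psi> t) j + conv (u t) (psi_rate (u t) (\<psi> t)) j))) (at t within I)"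
proof -
  note bd = reg[unfolded regular_state_def]
  have s\<sigma>: "s + \<sigma> > real CARD('n) / 2" using s \<sigma> by simp
  obtain C where C: "C > 0" and B: "\<forall>(u::int^'n \<Rightarrow> complex) \<psi> M. hbound (s + \<sigma>) u M \<longrightarrow> hbound (s + \<sigma> + 2) \<psi> M
     \<longrightarrow> hbound (s + \<sigma>) (psi_rate u \<psi>) (M + C * M * M)"
    using hbound_psi_rate[OF s\<sigma>] by blast
  have M: "M \<ge> 0" using bd[OF t] hbound_nonneg by blast
  have CM: "M \<le> M + C * M * M" using C M by simp
  have "((\<lambda>\<tau>. conv (u \<tau>) (\<psi> \<tau>) j) has_vector_derivative
     conv (w t) (\<psi> t) j + conv (u t) (psi_rate (u t) (\<psi> t)) j) (at t within I)"
  proof (rule conv_has_vector_derivative[OF s \<sigma> I _ _ _ _ _ _ t, where X=M and Y="M + C * M * M"])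
    fix r assume r: "r \<in> I"
    show "hbound s (u r) M" by (rule hbound_weaken[of "s + 1 + \<sigma>"]) (use bd[OF r] \<sigma> in auto)
    show "hbound s (w r) M" by (rule hbound_weaken[of "s + \<sigma>"]) (use bd[OF r] \<sigma> in auto)
    show "hbound (s + \<sigma>) (\<psi> r) (M + C * M * M)"
      by (rule hbound_mono[OF hbound_weaken[of "s + 2 + \<sigma>"] CM]) (use bd[OF r] in auto)
    show "hbound (s + \<sigma>) (psi_rate (u r) (\<psi> r)) (M + C * M * M)"
    proof (rule B[rule_format])
      show "hbound (s + \<sigma>) (u r) M" by (rule hbound_weaken[of "s + 1 + \<sigma>"]) (use bd[OF r] in auto)
      show "hbound (s + \<sigma> + 2) (\<psi> r) M" using bd[OF r] by (simp add: add_ac)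
    qed
  qed (use sys in \<open>auto simp: exact_system_def\<close>)
  moreover have "((\<lambda>\<tau>. \<psi> \<tau> j) has_vector_derivative psi_rate (u t) (\<psi> t) j) (at t within I)"
    using sys t by (simp add: exact_system_def)
  ultimately show ?thesis
    unfolding psi_rate_def[of "u _" "\<psi> _" j, abs_def]
    by (intro has_vector_derivative_mult_right has_vector_derivative_add)
qed

lemma psi_rate_num_has_vector_derivative:
  fixes a b c :: "real \<Rightarrow> int^'n \<Rightarrow> complex"
  assumes sys: "numeric_system K I a b c" and im: "\<And>t. in_modes K (a t)" "\<And>t. in_modes K (b t)" "\<And>t. in_modes K (c t)"
    and t: "t \<in> I" and j: "j \<in> modes K"
  shows "((\<lambda>\<tau>. psi_rate_num K (b \<tau>) (a \<tau>) j) has_vector_derivative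
     - \<i> * (lap j * psi_rate_num K (b t) (a t) j + (aliased K (conv (c t) (a t)) j + aliased K (conv (b t) (psi_rate_num K (b t) (a t))) j))) (at t within I)"
proof -
  have rm: "in_modes K (psi_rate_num K p q)" for p q :: "int^'n \<Rightarrow> complex"
    by (simp add: in_modes_def psi_rate_num_def trunc_def)
  have da: "((\<lambda>\<tau>. a \<tau> k) has_vector_derivative psi_rate_num K (b t) (a t) k) (at t within I)" if "k \<in> modes K" for k
    using sys t that by (simp add: numeric_system_def)
  have db: "((\<lambda>\<tau>. b \<tau> k) has_vector_derivative c t k) (at t within I)" if "k \<in> modes K" for k
    using sys t that by (simp add: numeric_system_def)
  have eq: "psi_rate_num K (b \<tau>) (a \<tau>) j = - \<i> * (lap j * a \<tau> j + aliased K (conv (b \<tau>) (a \<tau>)) j)" for \<tau>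
    using j by (simp add: psi_rate_num_def trunc_def)
  have "((\<lambda>\<tau>. aliased K (conv (b \<tau>) (a \<tau>)) j) has_vector_derivative
      aliased K (conv (c t) (a t)) j + aliased K (conv (b t) (psi_rate_num K (b t) (a t))) j) (at t within I)"
    by (rule aliased_conv_has_vector_derivative[where x'="\<lambda>t. c t" and y'="\<lambda>t. psi_rate_num K (b t) (a t)"]) (use im rm da db in auto)
  then have "((\<lambda>\<tau>. - \<i> * (lap j * a \<tau> j + aliased K (conv (b \<tau>) (a \<tau>)) j)) has_vector_derivative
     - \<i> * (lap j * psi_rate_num K (b t) (a t) j + (aliased K (conv (c t) (a t)) j + aliased K (conv (b t) (psi_rate_num K (b t) (a t))) j))) (at t within I)"
    by (intro has_vector_derivative_mult_right has_vector_derivative_add da j)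
  then show ?thesis by (simp only: eq)
qed

definition exact_regular ::
  "real \<Rightarrow> real \<Rightarrow> real \<Rightarrow> real set \<Rightarrow> (real \<Rightarrow> int^'n \<Rightarrow> complex) \<Rightarrow> (real \<Rightarrow> int^'n \<Rightarrow> complex) \<Rightarrow> (real \<Rightarrow> int^'n \<Rightarrow> complex) \<Rightarrow> bool" where
  "exact_regular s \<sigma> M I \<psi> u w \<longleftrightarrow> exact_system I \<psi> u w \<and>
     (\<forall>t\<in>I. regular_state s \<sigma> M (\<psi> t) (u t) (w t))"

text \<open>
  The initial values of the collocation method: \<open>aliased\<close> gives the coefficients of the interpolants.
\<close>

definition interpolated_start ::
  "nat \<Rightarrow> real \<Rightarrow> (real \<Rightarrow> int^'n \<Rightarrow> complex) \<Rightarrow> (real \<Rightarrow> int^'n \<Rightarrow> complex) \<Rightarrow> (real \<Rightarrow> int^'n \<Rightarrow> complex)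
     \<Rightarrow> (real \<Rightarrow> int^'n \<Rightarrow> complex) \<Rightarrow> (real \<Rightarrow> int^'n \<Rightarrow> complex) \<Rightarrow> (real \<Rightarrow> int^'n \<Rightarrow> complex) \<Rightarrow> bool" where
  "interpolated_start K t0 \<psi> u w a b c \<longleftrightarrow> (\<forall>t. in_modes K (a t) \<and> in_modes K (b t) \<and> in_modes K (c t)) \<and>
     a t0 = trunc K (aliased K (\<psi> t0)) \<and> b t0 = trunc K (aliased K (u t0)) \<and> c t0 = trunc K (aliased K (w t0))"

text \<open>
  The linear Gronwall inequality for \<open>E + K powr (- 2 * \<sigma>)\<close>. The hypothesis that the error is at most 1 serves to
  bound the numerical solution, on which the constants of the consistency estimates depend.
\<close>

theorem conditional_error_bound:
  fixes s \<sigma> M T :: real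
  assumes s: "s > real CARD('n::finite) / 2" and \<sigma>: "\<sigma> > 0" and M: "M \<ge> 0" and T: "T \<ge> 0"
  shows "\<exists>C>0. \<forall>K\<ge>1. \<forall>t0 t1 (\<psi>::real \<Rightarrow> int^'n \<Rightarrow> complex) u w a b c.
     t1 \<le> t0 + T \<longrightarrow> exact_regular s \<sigma> M {t0..t1} \<psi> u w \<longrightarrow> numeric_system K {t0..t1} a b c \<longrightarrow>
     interpolated_start K t0 \<psi> u w a b c \<longrightarrow>
     (\<forall>t\<in>{t0..t1}. state_error K s (\<psi> t) (u t) (w t) (a t) (b t) (c t) \<le> 1) \<longrightarrow>
     (\<forall>t\<in>{t0..t1}. state_error K s (\<psi> t) (u t) (w t) (a t) (b t) (c t) \<le> C * real K powr (- \<sigma>))"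
proof -
  have \<sigma>0: "\<sigma> \<ge> 0" using \<sigma> by simp
  obtain C where C: "C > 0" and SE: "\<forall>K\<ge>1. \<forall>(\<psi>::int^'n \<Rightarrow> complex) u w a b c y.
     regular_state s \<sigma> M \<psi> u w \<longrightarrow> in_modes K a \<longrightarrow> in_modes K b \<longrightarrow> in_modes K c \<longrightarrow>
     state_error K s \<psi> u w a b c \<le> 1 \<longrightarrow> 0 \<le> y \<longrightarrow> state_energy K s \<psi> u w a b c \<le> y\<^sup>2 \<longrightarrow>
     modes_norm K (s + 2) (\<lambda>j. \<psi> j - a j) \<le> C * (real K powr (- \<sigma>) + y) \<and>
     modes_norm K s (rate_defect K \<psi> u w a b c) \<le> C * (real K powr (- \<sigma>) + y) \<and>
     modes_norm K (s + 2) (density_defect K \<psi> a) \<le> C * (real K powr (- \<sigma>) + y)"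
    using static_estimates[OF s \<sigma>0, of M] by (elim exE conjE) blast
  obtain G where G: "G > 0" and IE: "\<forall>K\<ge>1. \<forall>(\<psi>::int^'n \<Rightarrow> complex) u w a b c. regular_state s \<sigma> M \<psi> u w \<longrightarrow>
     a = trunc K (aliased K \<psi>) \<longrightarrow> b = trunc K (aliased K u) \<longrightarrow> c = trunc K (aliased K w) \<longrightarrow>
     state_error K s \<psi> u w a b c \<le> G * real K powr (- \<sigma>) \<and>
     (state_error K s \<psi> u w a b c \<le> 1 \<longrightarrow> state_energy K s \<psi> u w a b c \<le> G * (real K powr (- \<sigma>))\<^sup>2)"
    using initial_error[OF s \<sigma>0 M] by (elim exE conjE) blast
  \<comment> \<open>The energy itself enters with the factor 2, and each of the two defects with at most
    \<open>2 * C\<^sup>2\<close> by the estimate \<open>sq\<close>. In units of \<open>K powr - \<sigma>\<close>, \<open>H\<close> bounds the square root of the energy and \<open>R\<close> the error.\<close>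
  define L where "L = 2 + 4 * C\<^sup>2"
  have L: "L \<ge> 0" by (simp add: L_def)
  define H where "H = sqrt ((G + 1) * exp (L * T))"
  have H: "H \<ge> 0" using G by (simp add: H_def)
  define R where "R = C * (1 + H) + 2 * H"
  have R: "R > 0" using C H by (simp add: R_def add_pos_nonneg)
  have "state_error K s (\<psi> t) (u t) (w t) (a t) (b t) (c t) \<le> R * real K powr (- \<sigma>)"
    if K: "K \<ge> 1" and t1: "t1 \<le> t0 + T" and er: "exact_regular s \<sigma> M {t0..t1} \<psi> u w"
      and num: "numeric_system K {t0..t1} a b c" and st: "interpolated_start K t0 \<psi> u w a b c"
      and small: "\<forall>t\<in>{t0..t1}. state_error K s (\<psi> t) (u t) (w t) (a t) (b t) (c t) \<le> 1"
      and t: "t \<in> {t0..t1}"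
    for K t0 t1 and \<psi> u w a b c :: "real \<Rightarrow> int^'n \<Rightarrow> complex" and t
  proof -
    have ex: "exact_system {t0..t1} \<psi> u w"
      and reg: "\<And>t. t \<in> {t0..t1} \<Longrightarrow> regular_state s \<sigma> M (\<psi> t) (u t) (w t)"
      using er unfolding exact_regular_def by blast+
    have im: "\<forall>t. in_modes K (a t) \<and> in_modes K (b t) \<and> in_modes K (c t)"
      and ia: "a t0 = trunc K (aliased K (\<psi> t0))" and ib: "b t0 = trunc K (aliased K (u t0))" and ic: "c t0 = trunc K (aliased K (w t0))"
      using st unfolding interpolated_start_def by blast+
    let ?I = "{t0..t1}"
    let ?k = "real K powr (- \<sigma>)"
    define e where "e \<tau> j = \<psi> \<tau> j - a \<tau> j" for \<tau> j
    define h where "h \<tau> j = psi_rate (u \<tau>) (\<psi> \<tau>) j - psi_rate_num K (b \<tau>) (a \<tau>) j" for \<tau> j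
    define \<eta> where "\<eta> \<tau> j = u \<tau> j - b \<tau> j" for \<tau> j
    define \<omega> where "\<omega> \<tau> j = w \<tau> j - c \<tau> j" for \<tau> j
    define q where "q \<tau> = rate_defect K (\<psi> \<tau>) (u \<tau>) (w \<tau>) (a \<tau>) (b \<tau>) (c \<tau>)" for \<tau>
    define p where "p \<tau> = density_defect K (\<psi> \<tau>) (a \<tau>)" for \<tau>
    define E where "E \<tau> = state_energy K s (\<psi> \<tau>) (u \<tau>) (w \<tau>) (a \<tau>) (b \<tau>) (c \<tau>)" for \<tau>
    have E_eq: "E \<tau> = error_energy K s (e \<tau>) (h \<tau>) (\<eta> \<tau>) (\<omega> \<tau>)" for \<tau>
      by (simp add: E_def state_energy_def e_def[abs_def] h_def[abs_def] \<eta>_def[abs_def] \<omega>_def[abs_def])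
    have E0: "E \<tau> \<ge> 0" for \<tau> by (simp add: E_eq error_energy_def)
    have sqE: "modes_norm K s (e \<tau>) \<le> sqrt (E \<tau>)" "modes_norm K s (h \<tau>) \<le> sqrt (E \<tau>)"
       "modes_norm K (s + 1) (\<eta> \<tau>) \<le> sqrt (E \<tau>)" "modes_norm K s (\<omega> \<tau>) \<le> sqrt (E \<tau>)" for \<tau>
      by (rule error_energy_le_imp[of K s "e \<tau>" "h \<tau>" "\<eta> \<tau>" "\<omega> \<tau>"]; use E0[of \<tau>] in \<open>simp add: E_eq[symmetric]\<close>)+
    have stat: "modes_norm K (s + 2) (e \<tau>) \<le> C * (?k + sqrt (E \<tau>)) \<and> modes_norm K s (q \<tau>) \<le> C * (?k + sqrt (E \<tau>))
        \<and> modes_norm K (s + 2) (p \<tau>) \<le> C * (?k + sqrt (E \<tau>))" if \<tau>: "\<tau> \<in> ?I" for \<tau>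
      unfolding e_def[abs_def] q_def p_def
    proof (rule SE[rule_format, OF K reg[OF \<tau>]])
      show "in_modes K (a \<tau>)" "in_modes K (b \<tau>)" "in_modes K (c \<tau>)" using im by auto
      show "state_error K s (\<psi> \<tau>) (u \<tau>) (w \<tau>) (a \<tau>) (b \<tau>) (c \<tau>) \<le> 1" using small \<tau> by blast
      show "0 \<le> sqrt (E \<tau>)" "state_energy K s (\<psi> \<tau>) (u \<tau>) (w \<tau>) (a \<tau>) (b \<tau>) (c \<tau>) \<le> (sqrt (E \<tau>))\<^sup>2"
        using E0[of \<tau>] by (simp_all add: E_def)
    qed
    have der: "\<exists>D. (E has_real_derivative D) (at \<tau> within ?I) \<and> D \<le> L * (E \<tau> + ?k\<^sup>2)" if \<tau>: "\<tau> \<in> ?I" for \<tau>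
    proof -
      have "\<exists>D. ((\<lambda>\<tau>. error_energy K s (e \<tau>) (h \<tau>) (\<eta> \<tau>) (\<omega> \<tau>)) has_real_derivative D) (at \<tau> within ?I) \<and>
         D \<le> 2 * error_energy K s (e \<tau>) (h \<tau>) (\<eta> \<tau>) (\<omega> \<tau>) + (modes_norm K s (q \<tau>))\<^sup>2 + (modes_norm K (s + 2) (p \<tau>))\<^sup>2"
      proof (rule error_energy_derivative)
        fix j :: "int^'n" assume j: "j \<in> modes K"
        have "((\<lambda>\<tau>. \<psi> \<tau> j) has_vector_derivative psi_rate (u \<tau>) (\<psi> \<tau>) j) (at \<tau> within ?I)"
          using ex \<tau> by (simp add: exact_system_def)
        moreover have "((\<lambda>\<tau>. a \<tau> j) has_vector_derivative psi_rate_num K (b \<tau>) (a \<tau>) j) (at \<tau> within ?I)"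
          using num \<tau> j by (simp add: numeric_system_def)
        ultimately show "((\<lambda>\<tau>. e \<tau> j) has_vector_derivative h \<tau> j) (at \<tau> within ?I)"
          unfolding e_def h_def by (rule has_vector_derivative_diff)
        have "((\<lambda>\<tau>. u \<tau> j) has_vector_derivative w \<tau> j) (at \<tau> within ?I)"
          using ex \<tau> by (simp add: exact_system_def)
        moreover have "((\<lambda>\<tau>. b \<tau> j) has_vector_derivative c \<tau> j) (at \<tau> within ?I)"
          using num \<tau> j by (simp add: numeric_system_def)
        ultimately show "((\<lambda>\<tau>. \<eta> \<tau> j) has_vector_derivative \<omega> \<tau> j) (at \<tau> within ?I)"
          unfolding \<eta>_def \<omega>_def by (rule has_vector_derivative_diff)
        have "((\<lambda>\<tau>. w \<tau> j) has_vector_derivative - lap j * (u \<tau> j + conv (\<psi> \<tau>) (conj_coeff (\<psi> \<tau>)) j)) (at \<tau> within ?I)"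
          using ex \<tau> by (simp add: exact_system_def)
        moreover have "((\<lambda>\<tau>. c \<tau> j) has_vector_derivative - lap j * (b \<tau> j + aliased K (conv (a \<tau>) (conj_coeff (a \<tau>))) j)) (at \<tau> within ?I)"
          using num \<tau> j by (simp add: numeric_system_def)
        ultimately have "((\<lambda>\<tau>. \<omega> \<tau> j) has_vector_derivative - lap j * (u \<tau> j + conv (\<psi> \<tau>) (conj_coeff (\<psi> \<tau>)) j)
            - (- lap j * (b \<tau> j + aliased K (conv (a \<tau>) (conj_coeff (a \<tau>))) j))) (at \<tau> within ?I)"
          unfolding \<omega>_def by (rule has_vector_derivative_diff)
        then show "((\<lambda>\<tau>. \<omega> \<tau> j) has_vector_derivative - lap j * (\<eta> \<tau> j + p \<tau> j)) (at \<tau> within ?I)"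
          by (rule has_vector_derivative_eq_rhs) (simp add: \<eta>_def p_def density_defect_def algebra_simps)
        have "((\<lambda>\<tau>. h \<tau> j) has_vector_derivative
           - \<i> * (lap j * psi_rate (u \<tau>) (\<psi> \<tau>) j + (conv (w \<tau>) (\<psi> \<tau>) j + conv (u \<tau>) (psi_rate (u \<tau>) (\<psi> \<tau>)) j))
           - (- \<i> * (lap j * psi_rate_num K (b \<tau>) (a \<tau>) j + (aliased K (conv (c \<tau>) (a \<tau>)) j + aliased K (conv (b \<tau>) (psi_rate_num K (b \<tau>) (a \<tau>))) j)))) (at \<tau> within ?I)"
          unfolding h_def
        proof (rule has_vector_derivative_diff)
          show "((\<lambda>\<tau>. psi_rate (u \<tau>) (\<psi> \<tau>) j) has_vector_derivative
             - \<i> * (lap j * psi_rate (u \<tau>) (\<psi> \<tau>) j + (conv (w \<tau>) (\<psi> \<tau>) j + conv (u \<tau>) (psi_rate (u \<tau>) (\<psi> \<tau>)) j))) (at \<tau> within ?I)"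
            by (rule psi_rate_has_vector_derivative[OF s \<sigma> _ ex reg \<tau>]) auto
          show "((\<lambda>\<tau>. psi_rate_num K (b \<tau>) (a \<tau>) j) has_vector_derivative
             - \<i> * (lap j * psi_rate_num K (b \<tau>) (a \<tau>) j + (aliased K (conv (c \<tau>) (a \<tau>)) j + aliased K (conv (b \<tau>) (psi_rate_num K (b \<tau>) (a \<tau>))) j))) (at \<tau> within ?I)"
            by (rule psi_rate_num_has_vector_derivative[OF num _ _ _ \<tau> j]) (use im in auto)
        qed
        then show "((\<lambda>\<tau>. h \<tau> j) has_vector_derivative - \<i> * (lap j * h \<tau> j + q \<tau> j)) (at \<tau> within ?I)"
          by (rule has_vector_derivative_eq_rhs) (simp add: h_def q_def rate_defect_def algebra_simps)
      qed
      then obtain D where D: "(E has_real_derivative D) (at \<tau> within ?I)"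
        "D \<le> 2 * E \<tau> + (modes_norm K s (q \<tau>))\<^sup>2 + (modes_norm K (s + 2) (p \<tau>))\<^sup>2"
        unfolding E_eq[abs_def] by blast
      have sq: "(C * (?k + sqrt (E \<tau>)))\<^sup>2 \<le> 2 * C\<^sup>2 * (E \<tau> + ?k\<^sup>2)"
      proof -
        have "(?k + sqrt (E \<tau>))\<^sup>2 \<le> 2 * (E \<tau> + ?k\<^sup>2)"
          using sum_squares_bound[of ?k "sqrt (E \<tau>)"] E0[of \<tau>] by (simp add: power2_sum)
        then have "C\<^sup>2 * (?k + sqrt (E \<tau>))\<^sup>2 \<le> C\<^sup>2 * (2 * (E \<tau> + ?k\<^sup>2))" by (intro mult_left_mono) auto
        then show ?thesis unfolding power_mult_distrib by (simp only: mult_ac)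
      qed
      have "(modes_norm K s (q \<tau>))\<^sup>2 \<le> (C * (?k + sqrt (E \<tau>)))\<^sup>2" "(modes_norm K (s + 2) (p \<tau>))\<^sup>2 \<le> (C * (?k + sqrt (E \<tau>)))\<^sup>2"
        using stat[OF \<tau>] by (auto intro!: power_mono)
      then have "D \<le> 2 * E \<tau> + 2 * (2 * C\<^sup>2 * (E \<tau> + ?k\<^sup>2))" using D(2) sq by linarith
      also have "\<dots> \<le> L * (E \<tau> + ?k\<^sup>2)" by (simp add: L_def algebra_simps)
      finally show ?thesis using D(1) by blast
    qed
    obtain D where D: "\<And>\<tau>. \<tau> \<in> ?I \<Longrightarrow> (E has_real_derivative D \<tau>) (at \<tau> within ?I)" "\<And>\<tau>. \<tau> \<in> ?I \<Longrightarrow> D \<tau> \<le> L * (E \<tau> + ?k\<^sup>2)"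
      using der by metis
    have t0I: "t0 \<in> ?I" using t by simp
    have "E t + ?k\<^sup>2 \<le> (E t0 + ?k\<^sup>2) * exp (L * (t - t0))"
    proof (rule gronwall_linear[where f="\<lambda>\<tau>. E \<tau> + ?k\<^sup>2" and f'=D])
      show "t0 \<le> t" using t by simp
      fix x assume x: "x \<in> {t0..t}"
      then have xI: "x \<in> ?I" using t by auto
      have "(E has_real_derivative D x) (at x within {t0..t})"
        by (rule DERIV_subset[OF D(1)[OF xI]]) (use t in auto)
      then show "((\<lambda>\<tau>. E \<tau> + ?k\<^sup>2) has_real_derivative D x) (at x within {t0..t})"
        by (auto intro!: derivative_eq_intros)
      show "D x \<le> L * (E x + ?k\<^sup>2)" by (rule D(2)[OF xI])
    qed
    also have "\<dots> \<le> ((G + 1) * ?k\<^sup>2) * exp (L * T)"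
    proof (rule mult_mono)
      have "E t0 \<le> G * ?k\<^sup>2"
        using IE[rule_format, OF K reg[OF t0I] ia ib ic] small t0I unfolding E_def by blast
      then show "E t0 + ?k\<^sup>2 \<le> (G + 1) * ?k\<^sup>2" by (simp add: distrib_right)
      show "exp (L * (t - t0)) \<le> exp (L * T)" using t t1 L by (simp add: mult_left_mono)
    qed (use G in auto)
    also have "\<dots> = (H * ?k)\<^sup>2" using G by (simp add: H_def power_mult_distrib)
    finally have "E t + ?k\<^sup>2 \<le> (H * ?k)\<^sup>2" .
    then have "E t \<le> (H * ?k)\<^sup>2" by (rule order_trans[rotated]) simp
    then have y: "sqrt (E t) \<le> H * ?k" using H by (intro real_le_lsqrt) (auto simp: E0)
    have "total_error K s (e t) (\<eta> t) (\<omega> t) \<le> C * (?k + sqrt (E t)) + sqrt (E t) + sqrt (E t)"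
      unfolding total_error_def using stat[OF t] sqE[of t] by (intro add_mono) auto
    also have "\<dots> \<le> C * (?k + H * ?k) + H * ?k + H * ?k"
      using y C by (intro add_mono mult_left_mono) auto
    also have "\<dots> = R * ?k" by (simp add: R_def algebra_simps)
    finally show ?thesis by (simp add: state_error_def e_def[abs_def] \<eta>_def[abs_def] \<omega>_def[abs_def])
  qed
  then show ?thesis using R by blast
qed

section \<open>Continuation in time\<close>

text \<open>
  If \<open>f\<close> exceeded 1 somewhere, there would be a first time with \<open>f = 1\<close> by the intermediate value theorem.
  Up to that time \<open>f \<le> 1\<close>, so that \<open>step\<close> gives \<open>f \<le> 1/2\<close> there.
\<close>

lemma bootstrap:
  fixes f :: "real \<Rightarrow> real"
  assumes f: "continuous_on {t0..t1} f" and f0: "f t0 \<le> 1/2"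
    and step: "\<And>r. r \<in> {t0..t1} \<Longrightarrow> (\<forall>t\<in>{t0..r}. f t \<le> 1) \<Longrightarrow> f r \<le> 1/2"
    and t: "t \<in> {t0..t1}"
  shows "f t \<le> 1/2"
proof -
  have less1: "f r \<le> 1" if r: "r \<in> {t0..t1}" for r
  proof (rule ccontr)
    assume "\<not> f r \<le> 1"
    then have r1: "f r > 1" by simp
    let ?S = "{t0..t1} \<inter> f -` {1}"
    have ivt: "\<exists>x. t0 \<le> x \<and> x \<le> y \<and> f x = 1" if "y \<in> {t0..t1}" "f y > 1" for y
    proof (rule IVT')
      show "continuous_on {t0..y} f" by (rule continuous_on_subset[OF f]) (use that in auto)
    qed (use f0 that in auto)
    obtain x where "t0 \<le> x" "x \<le> r" "f x = 1" using ivt[OF r r1] by blast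
    then have "x \<in> ?S" using r by simp
    then have ne: "?S \<noteq> {}" by blast
    have "closed ?S" by (rule continuous_closed_preimage[OF f]) auto
    then have "compact ({t0..t1} \<inter> ?S)" by (rule compact_Int_closed[OF compact_Icc])
    moreover have "{t0..t1} \<inter> ?S = ?S" by blast
    ultimately have "compact ?S" by simp
    then obtain m where m: "m \<in> ?S" and least: "\<And>x. x \<in> ?S \<Longrightarrow> m \<le> x"
      using compact_attains_inf[OF _ ne] by blast
    have "f x \<le> 1" if x: "x \<in> {t0..m}" for x
    proof (rule ccontr)
      assume "\<not> f x \<le> 1"
      then have fx: "f x > 1" by simp
      have xI: "x \<in> {t0..t1}" using x m by simp
      obtain y where y: "t0 \<le> y" "y \<le> x" "f y = 1" using ivt[OF xI fx] by blast
      have "m \<le> y" by (rule least) (use y xI in simp)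
      then have "x = y" using x y by simp
      then have "f x = 1" using y by simp
      then show False using fx by simp
    qed
    then have "f m \<le> 1/2" using m by (intro step) simp_all
    then show False using m by simp
  qed
  show ?thesis by (rule step[OF t]) (use less1 t in auto)
qed

lemma exact_system_subset: "exact_system I \<psi> u w \<Longrightarrow> J \<subseteq> I \<Longrightarrow> exact_system J \<psi> u w"
  unfolding exact_system_def by (meson has_vector_derivative_within_subset subsetD)

lemma continuous_modes_norm:
  assumes "\<And>j. j \<in> modes K \<Longrightarrow> continuous_on S (\<lambda>t. x t j)"
  shows "continuous_on S (\<lambda>t. modes_norm K s (x t))"
  unfolding modes_norm_def L2_set_def by (intro continuous_intros assms)

text \<open>
  The continuation argument, formulated for functions \<open>a\<close>, \<open>b\<close>, \<open>c\<close> that are known to solve the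
  collocation system only on initial intervals where the error is at most 1. It thus covers both a given
  collocation solution and the solution of the clipped system, and for the latter it yields existence.
\<close>

theorem coefficient_error_bound:
  fixes s \<sigma> M T :: real
  assumes s: "s > real CARD('n::finite) / 2" and \<sigma>: "\<sigma> > 0" and M: "M \<ge> 0" and T: "T \<ge> 0"
  shows "\<exists>C>0. \<exists>K0. \<forall>K\<ge>1. K \<ge> K0 \<longrightarrow> (\<forall>t0 (\<psi>::real \<Rightarrow> int^'n \<Rightarrow> complex) u w a b c.
     exact_regular s \<sigma> M {t0..t0 + T} \<psi> u w \<longrightarrow> interpolated_start K t0 \<psi> u w a b c \<longrightarrow>
     (\<forall>j\<in>modes K. continuous_on {t0..t0 + T} (\<lambda>t. a t j) \<and> continuous_on {t0..t0 + T} (\<lambda>t. b t j) \<and> continuous_on {t0..t0 + T} (\<lambda>t. c t j)) \<longrightarrow>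
     (\<forall>t1\<le>t0 + T. (\<forall>t\<in>{t0..t1}. state_error K s (\<psi> t) (u t) (w t) (a t) (b t) (c t) \<le> 1) \<longrightarrow> numeric_system K {t0..t1} a b c) \<longrightarrow>
     numeric_system K {t0..t0 + T} a b c \<and>
     (\<forall>t\<in>{t0..t0 + T}. state_error K s (\<psi> t) (u t) (w t) (a t) (b t) (c t) \<le> C * real K powr (- \<sigma>)))"
proof -
  obtain C where C: "C > 0" and CE: "\<forall>K\<ge>1. \<forall>t0 t1 (\<psi>::real \<Rightarrow> int^'n \<Rightarrow> complex) u w a b c.
     t1 \<le> t0 + T \<longrightarrow> exact_regular s \<sigma> M {t0..t1} \<psi> u w \<longrightarrow> numeric_system K {t0..t1} a b c \<longrightarrow>
     interpolated_start K t0 \<psi> u w a b c \<longrightarrow>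
     (\<forall>t\<in>{t0..t1}. state_error K s (\<psi> t) (u t) (w t) (a t) (b t) (c t) \<le> 1) \<longrightarrow>
     (\<forall>t\<in>{t0..t1}. state_error K s (\<psi> t) (u t) (w t) (a t) (b t) (c t) \<le> C * real K powr (- \<sigma>))"
    using conditional_error_bound[OF s \<sigma> M T] by blast
  obtain G where G: "G > 0" and IE: "\<forall>K\<ge>1. \<forall>(\<psi>::int^'n \<Rightarrow> complex) u w a b c. regular_state s \<sigma> M \<psi> u w \<longrightarrow>
     a = trunc K (aliased K \<psi>) \<longrightarrow> b = trunc K (aliased K u) \<longrightarrow> c = trunc K (aliased K w) \<longrightarrow>
     state_error K s \<psi> u w a b c \<le> G * real K powr (- \<sigma>) \<and>
     (state_error K s \<psi> u w a b c \<le> 1 \<longrightarrow> state_energy K s \<psi> u w a b c \<le> G * (real K powr (- \<sigma>))\<^sup>2)"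
    using initial_error[OF s less_imp_le[OF \<sigma>] M] by (elim exE conjE) blast
  \<comment> \<open>\<open>K\<close> has to be so large that the conditional bound and the initial error are at most \<open>1/2\<close>.\<close>
  have "((\<lambda>K. (C + G) * real K powr (- \<sigma>)) \<longlongrightarrow> (C + G) * 0) sequentially"
    by (intro tendsto_intros tendsto_neg_powr filterlim_real_sequentially) (use \<sigma> in simp)
  then have "\<forall>\<^sub>F K in sequentially. (C + G) * real K powr (- \<sigma>) < 1/2"
    by (intro order_tendstoD(2)) auto
  then obtain K0 where K0: "\<And>K. K \<ge> K0 \<Longrightarrow> (C + G) * real K powr (- \<sigma>) < 1/2"
    by (auto simp: eventually_sequentially)
  have "numeric_system K {t0..t0 + T} a b c \<and>
     (\<forall>t\<in>{t0..t0 + T}. state_error K s (\<psi> t) (u t) (w t) (a t) (b t) (c t) \<le> C * real K powr (- \<sigma>))"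
    if K: "K \<ge> 1" and KK0: "K \<ge> K0" and er: "exact_regular s \<sigma> M {t0..t0 + T} \<psi> u w"
      and st: "interpolated_start K t0 \<psi> u w a b c"
      and cont: "\<forall>j\<in>modes K. continuous_on {t0..t0 + T} (\<lambda>t. a t j) \<and> continuous_on {t0..t0 + T} (\<lambda>t. b t j) \<and> continuous_on {t0..t0 + T} (\<lambda>t. c t j)"
      and ns: "\<forall>t1\<le>t0 + T. (\<forall>t\<in>{t0..t1}. state_error K s (\<psi> t) (u t) (w t) (a t) (b t) (c t) \<le> 1) \<longrightarrow> numeric_system K {t0..t1} a b c"
    for K t0 and \<psi> u w a b c :: "real \<Rightarrow> int^'n \<Rightarrow> complex"
  proof -
    let ?k = "real K powr (- \<sigma>)"
    let ?I = "{t0..t0 + T}"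
    let ?N = "\<lambda>t. state_error K s (\<psi> t) (u t) (w t) (a t) (b t) (c t)"
    have half: "C * ?k \<le> 1/2" "G * ?k \<le> 1/2"
    proof -
      have "C * ?k \<le> (C + G) * ?k" "G * ?k \<le> (C + G) * ?k" using C G by (auto intro!: mult_right_mono)
      then show "C * ?k \<le> 1/2" "G * ?k \<le> 1/2" using K0[OF KK0] by linarith+
    qed
    have t0I: "t0 \<in> ?I" using T by simp
    have N0: "?N t0 \<le> 1/2"
    proof -
      have r: "regular_state s \<sigma> M (\<psi> t0) (u t0) (w t0)" using er t0I unfolding exact_regular_def by blast
      have i3: "a t0 = trunc K (aliased K (\<psi> t0))" "b t0 = trunc K (aliased K (u t0))" "c t0 = trunc K (aliased K (w t0))"
        using st unfolding interpolated_start_def by blast+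
      from IE[rule_format, OF K r i3] have "?N t0 \<le> G * ?k" by (rule conjunct1)
      then show ?thesis using half by linarith
    qed
    have step: "\<forall>t\<in>{t0..r}. ?N t \<le> C * ?k" if r: "r \<in> ?I" and le: "\<forall>t\<in>{t0..r}. ?N t \<le> 1" for r
    proof -
      have r': "r \<le> t0 + T" using r by simp
      have "{t0..r} \<subseteq> ?I" using r by auto
      then have er': "exact_regular s \<sigma> M {t0..r} \<psi> u w"
        using er exact_system_subset unfolding exact_regular_def by blast
      show ?thesis using CE K r' er' ns le st by blast
    qed
    have cN: "continuous_on ?I ?N"
    proof -
      have ex: "exact_system ?I \<psi> u w" using er by (simp add: exact_regular_def)
      have cx: "continuous_on ?I (\<lambda>t. \<psi> t j)" "continuous_on ?I (\<lambda>t. u t j)" "continuous_on ?I (\<lambda>t. w t j)" for j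
        by (rule continuous_on_vector_derivative, use ex in \<open>auto simp: exact_system_def\<close>)+
      show ?thesis unfolding state_error_def total_error_def
        by (intro continuous_on_add continuous_modes_norm continuous_on_diff cx) (use cont in auto)
    qed
    have N1: "?N t \<le> 1" if t: "t \<in> ?I" for t
    proof -
      have "?N t \<le> 1/2"
      proof (rule bootstrap[OF cN N0 _ t])
        fix r assume r: "r \<in> ?I" and le: "\<forall>t\<in>{t0..r}. ?N t \<le> 1"
        have "?N r \<le> C * ?k" using step[OF r le] r by simp
        then show "?N r \<le> 1/2" using half by linarith
      qed
      then show ?thesis by simp
    qed
    have endI: "t0 + T \<in> ?I" using T by simp
    have all1: "\<forall>t\<in>{t0..t0 + T}. ?N t \<le> 1" using N1 by blast
    have "numeric_system K ?I a b c" using ns all1 by blast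
    then show ?thesis using step[OF endI all1] by blast
  qed
  then show ?thesis using C by blast
qed

section \<open>Functions on the torus and their coefficients\<close>

lemma sobolev_norm_nonneg: "0 \<le> sobolev_norm r v"
  unfolding sobolev_norm_def by (intro real_sqrt_ge_zero infsum_nonneg) (simp add: sobolev_term_def)

lemma sobolev_hbound:
  assumes v: "v \<in> sobolev r" and n: "sobolev_norm r v \<le> M"
  shows "hbound r (fourier_coeff v) M"
  unfolding hbound_sq
proof (intro conjI allI impI)
  have st: "sobolev_term r v j = wt j powr (2 * r) * (cmod (fourier_coeff v j))\<^sup>2" for j
    by (simp add: sobolev_term_def wt_def)
  have nn: "0 \<le> (\<Sum>\<^sub>\<infinity>j\<in>UNIV. sobolev_term r v j)" by (rule infsum_nonneg) (simp add: st)
  have sq: "(sobolev_norm r v)\<^sup>2 = (\<Sum>\<^sub>\<infinity>j\<in>UNIV. sobolev_term r v j)"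
    using nn by (simp add: sobolev_norm_def)
  have n0: "0 \<le> sobolev_norm r v" using nn by (simp add: sobolev_norm_def)
  then show "0 \<le> M" using n by linarith
  fix F :: "(int^'a) set" assume F: "finite F"
  have "(\<Sum>j\<in>F. wt j powr (2 * r) * (cmod (fourier_coeff v j))\<^sup>2) \<le> (\<Sum>\<^sub>\<infinity>j\<in>UNIV. sobolev_term r v j)"
    unfolding st[symmetric]
  proof (rule finite_sum_le_infsum[OF _ F])
    show "sobolev_term r v summable_on UNIV" using v by (simp add: sobolev_def)
  qed (auto simp: st)
  also have "\<dots> \<le> M\<^sup>2" unfolding sq[symmetric] using n n0 by (intro power_mono)
  finally show "(\<Sum>j\<in>F. wt j powr (2 * r) * (cmod (fourier_coeff v j))\<^sup>2) \<le> M\<^sup>2" .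
qed

text \<open>
  The converse of \<open>sobolev_hbound\<close>. Measurability and square integrability come with continuity.
\<close>

lemma hbound_sobolev:
  assumes v: "torus_continuous v" and h: "hbound r (fourier_coeff v) B"
  shows "v \<in> sobolev r \<and> sobolev_norm r v \<le> B"
proof -
  have st: "sobolev_term r v = (\<lambda>j. wt j powr (2 * r) * (cmod (fourier_coeff v j))\<^sup>2)"
    by (auto simp: sobolev_term_def wt_def)
  have c: "continuous_on UNIV v" and p: "periodic v" using v by (auto simp: torus_continuous_def)
  have fin: "sum (sobolev_term r v) F \<le> B\<^sup>2" if "finite F" for F
    using h that unfolding hbound_sq st by blast
  have sm: "sobolev_term r v summable_on UNIV"
  proof (rule nonneg_bdd_above_summable_on)
    show "0 \<le> sobolev_term r v x" for x by (simp add: st)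
    show "bdd_above (sum (sobolev_term r v) ` {F. F \<subseteq> UNIV \<and> finite F})"
      by (intro bdd_aboveI2[where M="B\<^sup>2"]) (simp add: fin)
  qed
  have "(\<Sum>\<^sub>\<infinity>j\<in>UNIV. sobolev_term r v j) \<le> B\<^sup>2"
    by (rule infsum_le_finite_sums[OF sm]) (rule fin)
  then have "sobolev_norm r v \<le> B"
    unfolding sobolev_norm_def using hbound_nonneg[OF h] by (intro real_le_lsqrt) (auto intro!: infsum_nonneg simp: st)
  moreover have "set_integrable lborel torus_cell (\<lambda>x. (cmod (v x))\<^sup>2)"
    by (rule set_integrable_cell) (intro continuous_intros c)
  moreover have "v \<in> borel_measurable lborel"
    using borel_measurable_continuous_onI[OF c] by simp
  ultimately show ?thesis using sm p by (simp add: sobolev_def)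
qed

lemma interp_coeff_has_vector_derivative:
  assumes "\<And>x. ((\<lambda>\<tau>. v \<tau> x) has_vector_derivative v' x) F"
  shows "((\<lambda>\<tau>. interp_coeff K (v \<tau>) l) has_vector_derivative interp_coeff K v' l) F"
  unfolding interp_coeff_def
  by (intro has_vector_derivative_divide has_vector_derivative_sum has_vector_derivative_mult_left assms)

lemma interp_coeff_add: "interp_coeff K (\<lambda>x. v x + w x) l = interp_coeff K v l + interp_coeff K w l"
  by (simp add: interp_coeff_def distrib_right sum.distrib add_divide_distrib)

lemma interp_coeff_cmult: "interp_coeff K (\<lambda>x. c * v x) l = c * interp_coeff K v l"
  by (simp add: interp_coeff_def sum_distrib_left mult.assoc)

text \<open>
  The trigonometric polynomial with given coefficients. Values of \<open>c\<close> outside \<open>modes K\<close> are ignored, so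
  \<open>in_modes\<close> is what makes the coefficients unique.
\<close>

definition poly_of :: "nat \<Rightarrow> (int^'n \<Rightarrow> complex) \<Rightarrow> real^'n \<Rightarrow> complex" where
  "poly_of K c x = (\<Sum>j\<in>modes K. c j * fourier_exp j x)"

lemma in_modes_trunc: "in_modes K c \<Longrightarrow> trunc K c = c"
  by (auto simp: in_modes_def trunc_def)

lemma expands_poly_of: "in_modes K c \<Longrightarrow> expands (poly_of K c) c"
  using expands_trig_poly[where K=K and c=c] by (simp add: poly_of_def[abs_def] in_modes_trunc)

lemma interp_eq_poly_of: "K \<ge> 1 \<Longrightarrow> interp K v = poly_of K (trunc K (interp_coeff K v))"
  by (simp add: interp_eq poly_of_def[abs_def] trunc_def cong: sum.cong)

lemma trig_poly_eq_poly_of: "K \<ge> 1 \<Longrightarrow> p \<in> trig_poly K \<Longrightarrow> p = poly_of K (trunc K (interp_coeff K p))"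
  using trig_poly_eq[of K p] by (simp add: poly_of_def[abs_def] trunc_def cong: sum.cong)

lemma interp_coeff_poly_of: "K \<ge> 1 \<Longrightarrow> l \<in> modes K \<Longrightarrow> interp_coeff K (poly_of K c) l = c l"
  unfolding poly_of_def[abs_def] by (rule interp_coeff_trig_poly)

lemma laplacian_poly_of: "laplacian (poly_of K c) = poly_of K (\<lambda>j. - lap j * c j)"
  unfolding poly_of_def[abs_def] laplacian_trig_poly[OF finite_modes] ..

lemma expands_norm_sq_poly_of:
  assumes "in_modes K a"
  shows "expands (cfun (\<lambda>x. (cmod (poly_of K a x))\<^sup>2)) (conv a (conj_coeff a))"
proof -
  have "expands (\<lambda>x. poly_of K a x * cnj (poly_of K a x)) (conv a (conj_coeff a))"
    unfolding conj_coeff_def[abs_def] by (intro expands_mult expands_cnj expands_poly_of assms)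
  then show ?thesis by (simp only: complex_norm_square)
qed

lemma poly_of_has_vector_derivative:
  assumes "\<And>j. j \<in> modes K \<Longrightarrow> ((\<lambda>\<tau>. c \<tau> j) has_vector_derivative c' j) F"
  shows "((\<lambda>\<tau>. poly_of K (c \<tau>) x) has_vector_derivative poly_of K c' x) F"
  unfolding poly_of_def by (intro has_vector_derivative_sum has_vector_derivative_mult_left assms)

lemma poly_of_add: "poly_of K c x + poly_of K d x = poly_of K (\<lambda>j. c j + d j) x"
  by (simp add: poly_of_def sum.distrib distrib_right)

lemma poly_of_cmult: "r * poly_of K c x = poly_of K (\<lambda>j. r * c j) x"
  by (simp add: poly_of_def sum_distrib_left mult.assoc)

lemma poly_of_trunc: "poly_of K (trunc K c) = poly_of K c"
  by (simp add: poly_of_def[abs_def] trunc_def cong: sum.cong)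

text \<open>
  The product of two trigonometric polynomials has the convolution as its coefficients, and interpolation
  folds it by aliasing. Comparing coefficients, the collocation method and \<open>numeric_system\<close> are the same;
  this direction serves the existence of a solution, and \<open>collocation_imp_numeric\<close> the error estimate.
\<close>

lemma numeric_imp_collocation:
  fixes a b c :: "real \<Rightarrow> int^'n \<Rightarrow> complex"
  assumes K: "K \<ge> 1" and im: "\<And>t. in_modes K (a t) \<and> in_modes K (b t) \<and> in_modes K (c t)"
    and sys: "numeric_system K {t0..t0 + T} a b c"
    and ia: "a t0 = trunc K (interp_coeff K \<psi>0)" and ib: "b t0 = trunc K (interp_coeff K u0)" and ic: "c t0 = trunc K (interp_coeff K w0)"
  shows "collocation_solution K t0 T \<psi>0 u0 w0 (\<lambda>t. poly_of K (a t)) (\<lambda>t. poly_of K (b t)) (\<lambda>t. poly_of K (c t))"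
  unfolding collocation_solution_def
proof (intro conjI ballI allI)
  show "poly_of K (a t0) = interp K \<psi>0" "poly_of K (b t0) = interp K u0" "poly_of K (c t0) = interp K w0"
    by (simp_all add: interp_eq_poly_of[OF K] ia ib ic)
  fix t assume t: "t \<in> {t0..t0 + T}"
  let ?I = "{t0..t0 + T}"
  show "poly_of K (a t) \<in> trig_poly K" "poly_of K (b t) \<in> trig_poly K" "poly_of K (c t) \<in> trig_poly K"
    by (auto simp: trig_poly_def poly_of_def[abs_def])
  have i1: "interp K (\<lambda>y. poly_of K (b t) y * poly_of K (a t) y) = poly_of K (aliased K (conv (b t) (a t)))"
  proof -
    have "expands (\<lambda>y. poly_of K (b t) y * poly_of K (a t) y) (conv (b t) (a t))"
      using im by (intro expands_mult expands_poly_of) auto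
    from expands_interp_coeff[OF K this] show ?thesis
      unfolding interp_eq_poly_of[OF K] poly_of_trunc by (simp add: poly_of_def[abs_def])
  qed
  have i2: "interp K (cfun (\<lambda>y. (cmod (poly_of K (a t) y))\<^sup>2)) = poly_of K (aliased K (conv (a t) (conj_coeff (a t))))"
  proof -
    have "expands (cfun (\<lambda>y. (cmod (poly_of K (a t) y))\<^sup>2)) (conv (a t) (conj_coeff (a t)))"
      using im by (intro expands_norm_sq_poly_of) auto
    from expands_interp_coeff[OF K this] show ?thesis
      unfolding interp_eq_poly_of[OF K] poly_of_trunc by (simp add: poly_of_def[abs_def])
  qed
  fix x :: "real^'n"
  have "((\<lambda>\<tau>. \<i> * poly_of K (a \<tau>) x) has_vector_derivative
     \<i> * poly_of K (\<lambda>j. - \<i> * (lap j * a t j + aliased K (conv (b t) (a t)) j)) x) (at t within ?I)"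
    by (intro has_vector_derivative_mult_right poly_of_has_vector_derivative) (use sys t in \<open>auto simp: numeric_system_def psi_rate_num_def trunc_def\<close>)
  moreover have "\<i> * poly_of K (\<lambda>j. - \<i> * (lap j * a t j + aliased K (conv (b t) (a t)) j)) x
     = - laplacian (poly_of K (a t)) x + interp K (\<lambda>y. poly_of K (b t) y * poly_of K (a t) y) x"
  proof -
    have "- laplacian (poly_of K (a t)) x = (-1) * poly_of K (\<lambda>j. - lap j * a t j) x" by (simp add: laplacian_poly_of)
    also have "\<dots> = poly_of K (\<lambda>j. lap j * a t j) x" unfolding poly_of_cmult by simp
    finally have 1: "- laplacian (poly_of K (a t)) x = poly_of K (\<lambda>j. lap j * a t j) x" .
    have "\<i> * poly_of K (\<lambda>j. - \<i> * (lap j * a t j + aliased K (conv (b t) (a t)) j)) x = poly_of K (\<lambda>j. lap j * a t j + aliased K (conv (b t) (a t)) j) x"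
      unfolding poly_of_cmult by (simp add: mult.assoc[symmetric] add.commute)
    then show ?thesis unfolding 1 i1 poly_of_add .
  qed
  ultimately show "((\<lambda>\<tau>. \<i> * poly_of K (a \<tau>) x) has_vector_derivative
     - laplacian (poly_of K (a t)) x + interp K (\<lambda>y. poly_of K (b t) y * poly_of K (a t) y) x) (at t within ?I)" by simp
  show "((\<lambda>\<tau>. poly_of K (b \<tau>) x) has_vector_derivative poly_of K (c t) x) (at t within ?I)"
    by (rule poly_of_has_vector_derivative) (use sys t in \<open>auto simp: numeric_system_def\<close>)
  have "((\<lambda>\<tau>. poly_of K (c \<tau>) x) has_vector_derivative
     poly_of K (\<lambda>j. - lap j * (b t j + aliased K (conv (a t) (conj_coeff (a t))) j)) x) (at t within ?I)"
    by (rule poly_of_has_vector_derivative) (use sys t in \<open>auto simp: numeric_system_def lap_def\<close>)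
  moreover have "poly_of K (\<lambda>j. - lap j * (b t j + aliased K (conv (a t) (conj_coeff (a t))) j)) x
     = laplacian (poly_of K (b t)) x + laplacian (interp K (cfun (\<lambda>y. (cmod (poly_of K (a t) y))\<^sup>2))) x"
    unfolding i2 laplacian_poly_of poly_of_add by (simp add: distrib_left)
  ultimately show "((\<lambda>\<tau>. poly_of K (c \<tau>) x) has_vector_derivative
     laplacian (poly_of K (b t)) x + laplacian (interp K (cfun (\<lambda>y. (cmod (poly_of K (a t) y))\<^sup>2))) x) (at t within ?I)" by simp
qed

text \<open>
  The coefficients are finite linear combinations of grid values (\<open>interp_coeff\<close>), so they inherit
  differentiability in time from the pointwise equations.
\<close>

lemma collocation_imp_numeric:
  fixes \<psi>K uK wK :: "real \<Rightarrow> real^'n \<Rightarrow> complex"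
  assumes K: "K \<ge> 1" and T: "T \<ge> 0" and col: "collocation_solution K t0 T \<psi>0 u0 w0 \<psi>K uK wK"
  defines "a \<equiv> \<lambda>t. trunc K (interp_coeff K (\<psi>K t))" and "b \<equiv> \<lambda>t. trunc K (interp_coeff K (uK t))" and "c \<equiv> \<lambda>t. trunc K (interp_coeff K (wK t))"
  shows "numeric_system K {t0..t0 + T} a b c" 
    and "\<And>t. t \<in> {t0..t0 + T} \<Longrightarrow> \<psi>K t = poly_of K (a t) \<and> uK t = poly_of K (b t) \<and> wK t = poly_of K (c t)"
    and "a t0 = trunc K (interp_coeff K \<psi>0)" "b t0 = trunc K (interp_coeff K u0)" "c t0 = trunc K (interp_coeff K w0)"
proof -
  let ?I = "{t0..t0 + T}"
  have im: "in_modes K (a t) \<and> in_modes K (b t) \<and> in_modes K (c t)" for t by (simp add: in_modes_def a_def b_def c_def trunc_def)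
  show P: "\<psi>K t = poly_of K (a t) \<and> uK t = poly_of K (b t) \<and> wK t = poly_of K (c t)" if "t \<in> ?I" for t
    using col that trig_poly_eq_poly_of[OF K] unfolding collocation_solution_def a_def b_def c_def by blast
  have ii: "trunc K (interp_coeff K (interp K v)) = trunc K (interp_coeff K v)" for v :: "real^'n \<Rightarrow> complex"
    by (rule trunc_cong) (simp add: interp_eq_poly_of[OF K] interp_coeff_poly_of[OF K] trunc_def)
  show "a t0 = trunc K (interp_coeff K \<psi>0)" "b t0 = trunc K (interp_coeff K u0)" "c t0 = trunc K (interp_coeff K w0)"
    using col by (simp_all add: a_def b_def c_def collocation_solution_def ii)
  show "numeric_system K ?I a b c"
    unfolding numeric_system_def
  proof (intro ballI conjI)
    fix t and j :: "int^'n" assume t: "t \<in> ?I" and j: "j \<in> modes K"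
    have e: "a \<tau> j = interp_coeff K (\<psi>K \<tau>) j" "b \<tau> j = interp_coeff K (uK \<tau>) j" "c \<tau> j = interp_coeff K (wK \<tau>) j" for \<tau>
      using j by (simp_all add: a_def b_def c_def trunc_def)
    have i1: "interp_coeff K (interp K (\<lambda>y. uK t y * \<psi>K t y)) j = aliased K (conv (b t) (a t)) j"
    proof -
      have "expands (\<lambda>y. uK t y * \<psi>K t y) (conv (b t) (a t))"
        using im P[OF t] by (auto intro!: expands_mult expands_poly_of)
      from expands_interp_coeff[OF K this] show ?thesis
        using j by (simp add: interp_eq_poly_of[OF K] interp_coeff_poly_of[OF K] trunc_def)
    qed
    have i2: "interp K (cfun (\<lambda>y. (cmod (\<psi>K t y))\<^sup>2)) = poly_of K (aliased K (conv (a t) (conj_coeff (a t))))"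
    proof -
      have "expands (cfun (\<lambda>y. (cmod (poly_of K (a t) y))\<^sup>2)) (conv (a t) (conj_coeff (a t)))"
        using im by (intro expands_norm_sq_poly_of) auto
      then have "expands (cfun (\<lambda>y. (cmod (\<psi>K t y))\<^sup>2)) (conv (a t) (conj_coeff (a t)))" using P[OF t] by simp
      from expands_interp_coeff[OF K this] show ?thesis
        unfolding interp_eq_poly_of[OF K] poly_of_trunc by (simp add: poly_of_def[abs_def])
    qed
    have l: "interp_coeff K (laplacian (poly_of K d)) j = - lap j * d j" for d
      by (simp add: laplacian_poly_of interp_coeff_poly_of[OF K j])
    have "((\<lambda>\<tau>. \<psi>K \<tau> x) has_vector_derivative - \<i> * (- laplacian (\<psi>K t) x + interp K (\<lambda>y. uK t y * \<psi>K t y) x)) (at t within ?I)" for x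
    proof -
      have "((\<lambda>\<tau>. - \<i> * (\<i> * \<psi>K \<tau> x)) has_vector_derivative - \<i> * (- laplacian (\<psi>K t) x + interp K (\<lambda>y. uK t y * \<psi>K t y) x)) (at t within ?I)"
        by (rule has_vector_derivative_mult_right) (use col t in \<open>simp add: collocation_solution_def\<close>)
      then show ?thesis by (simp add: mult.assoc[symmetric])
    qed
    then have "((\<lambda>\<tau>. interp_coeff K (\<psi>K \<tau>) j) has_vector_derivative
       interp_coeff K (\<lambda>x. - \<i> * ((-1) * laplacian (\<psi>K t) x + interp K (\<lambda>y. uK t y * \<psi>K t y) x)) j) (at t within ?I)"
      by (intro interp_coeff_has_vector_derivative) simp
    moreover have "interp_coeff K (\<lambda>x. - \<i> * ((-1) * laplacian (\<psi>K t) x + interp K (\<lambda>y. uK t y * \<psi>K t y) x)) j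
      = - \<i> * (lap j * a t j + aliased K (conv (b t) (a t)) j)"
      unfolding interp_coeff_cmult interp_coeff_add i1 using P[OF t] l[of "a t"] by (simp add: lap_def)
    ultimately show "((\<lambda>\<tau>. a \<tau> j) has_vector_derivative
        psi_rate_num K (b t) (a t) j) (at t within ?I)"
      using j by (simp add: psi_rate_num_def trunc_def e(1))
    show "((\<lambda>\<tau>. b \<tau> j) has_vector_derivative c t j) (at t within ?I)"
      unfolding e by (rule interp_coeff_has_vector_derivative) (use col t in \<open>simp add: collocation_solution_def\<close>)
    have "((\<lambda>\<tau>. interp_coeff K (wK \<tau>) j) has_vector_derivative
       interp_coeff K (\<lambda>x. laplacian (uK t) x + laplacian (interp K (cfun (\<lambda>y. (cmod (\<psi>K t y))\<^sup>2))) x) j) (at t within ?I)"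
      by (rule interp_coeff_has_vector_derivative) (use col t in \<open>simp add: collocation_solution_def\<close>)
    moreover have "interp_coeff K (\<lambda>x. laplacian (uK t) x + laplacian (interp K (cfun (\<lambda>y. (cmod (\<psi>K t y))\<^sup>2))) x) j
      = - lap j * (b t j + aliased K (conv (a t) (conj_coeff (a t))) j)"
    proof -
      have "uK t = poly_of K (b t)" using P[OF t] by simp
      then show ?thesis unfolding interp_coeff_add i2 by (simp add: l lap_def distrib_left)
    qed
    ultimately show "((\<lambda>\<tau>. c \<tau> j) has_vector_derivative
        - lap j * (b t j + aliased K (conv (a t) (conj_coeff (a t))) j)) (at t within ?I)"
      unfolding e(3) by simp
  qed
qed

text \<open>
  The solution has absolutely convergent Fourier series because \<open>s > d/2\<close>, which turns the products in the
  equations into convolutions.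
\<close>

lemma zakharov_imp_exact_system:
  fixes \<psi> :: "real \<Rightarrow> real^'n \<Rightarrow> complex"
  assumes z: "zakharov_solution t0 T \<psi> u w" and s: "s > real CARD('n::finite) / 2"
    and bd: "\<And>t. t \<in> {t0..t0 + T} \<Longrightarrow> hbound s (fourier_coeff (\<psi> t)) M \<and> hbound s (fourier_coeff (cfun (u t))) M"
  shows "exact_system {t0..t0 + T} (\<lambda>t. fourier_coeff (\<psi> t)) (\<lambda>t. fourier_coeff (cfun (u t))) (\<lambda>t. fourier_coeff (cfun (w t)))"
  unfolding exact_system_def
proof (intro ballI allI conjI)
  fix t and j :: "int^'n" assume t: "t \<in> {t0..t0 + T}"
  let ?I = "{t0..t0 + T}"
  let ?P = "fourier_coeff (\<psi> t)" and ?U = "fourier_coeff (cfun (u t))"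
  have tc: "torus_continuous (\<psi> t)" "torus_continuous (cfun (u t))"
    using z t by (auto simp: zakharov_solution_def torus_continuous_def periodic_def intro!: continuous_intros)
  have P: "expands (\<psi> t) ?P" and U: "expands (cfun (u t)) ?U"
    using bd[OF t] by (auto intro!: expands_fourier_series tc hbound_l1[OF s])
  have f: "fourier_coeff (\<lambda>x. complex_of_real (u t x) * \<psi> t x) j = conv ?U ?P j"
    by (rule expands_fourier_coeff[OF expands_mult[OF U P]])
  have g: "fourier_coeff (cfun (\<lambda>x. (cmod (\<psi> t x))\<^sup>2)) j = conv ?P (conj_coeff ?P) j"
  proof -
    have "expands (\<lambda>x. \<psi> t x * cnj (\<psi> t x)) (conv ?P (conj_coeff ?P))"
      unfolding conj_coeff_def[abs_def] by (intro expands_mult expands_cnj P)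
    then have "expands (cfun (\<lambda>x. (cmod (\<psi> t x))\<^sup>2)) (conv ?P (conj_coeff ?P))" by (simp only: complex_norm_square)
    then show ?thesis by (rule expands_fourier_coeff)
  qed
  have "((\<lambda>\<tau>. - \<i> * (\<i> * fourier_coeff (\<psi> \<tau>) j)) has_vector_derivative
     - \<i> * (- laplace_coeff (\<psi> t) j + fourier_coeff (\<lambda>x. complex_of_real (u t x) * \<psi> t x) j)) (at t within ?I)"
    by (rule has_vector_derivative_mult_right) (use z t in \<open>simp add: zakharov_solution_def\<close>)
  then show "((\<lambda>\<tau>. fourier_coeff (\<psi> \<tau>) j) has_vector_derivative psi_rate ?U ?P j) (at t within ?I)"
    unfolding f by (simp add: mult.assoc[symmetric] psi_rate_def laplace_coeff_def lap_def)
  show "((\<lambda>\<tau>. fourier_coeff (cfun (u \<tau>)) j) has_vector_derivative fourier_coeff (cfun (w t)) j) (at t within ?I)"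
    using z t by (simp add: zakharov_solution_def)
  have "((\<lambda>\<tau>. fourier_coeff (cfun (w \<tau>)) j) has_vector_derivative
             laplace_coeff (cfun (u t)) j + laplace_coeff (cfun (\<lambda>x. (cmod (\<psi> t x))\<^sup>2)) j) (at t within ?I)"
    using z t unfolding zakharov_solution_def by blast
  then show "((\<lambda>\<tau>. fourier_coeff (cfun (w \<tau>)) j) has_vector_derivative - lap j * (?U j + conv ?P (conj_coeff ?P) j)) (at t within ?I)"
    by (rule has_vector_derivative_eq_rhs) (simp only: laplace_coeff_def g lap_def distrib_left)
qed

text \<open>
  The error over all frequencies consists of the retained modes and the tail of the exact solution.
\<close>

lemma error_in_sobolev:
  fixes v :: "real^'n \<Rightarrow> complex"
  assumes v: "torus_continuous v" and h: "hbound (r + \<sigma>) (fourier_coeff v) M" and a: "in_modes K a" and "\<sigma> \<ge> 0" "K \<ge> 1"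
    and e: "modes_norm K r (\<lambda>j. fourier_coeff v j - a j) \<le> C * real K powr (- \<sigma>)"
  shows "(\<lambda>x. v x - poly_of K a x) \<in> sobolev r \<and> sobolev_norm r (\<lambda>x. v x - poly_of K a x) \<le> (C + M) * real K powr (- \<sigma>)"
proof (rule hbound_sobolev)
  note pe = expands_poly_of[OF a]
  note pt = expands_torus_continuous[OF pe]
  show "torus_continuous (\<lambda>x. v x - poly_of K a x)"
    using v pt by (auto simp: torus_continuous_def periodic_def intro!: continuous_intros)
  have "fourier_coeff (\<lambda>x. v x - poly_of K a x) = (\<lambda>j. fourier_coeff v j - a j)"
    using v pt expands_fourier_coeff[OF pe] by (auto simp: fourier_coeff_diff torus_continuous_def)
  moreover have "hbound r (\<lambda>j. fourier_coeff v j - a j) (modes_norm K r (\<lambda>j. fourier_coeff v j - a j) + real K powr (- \<sigma>) * M)"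
    by (rule hbound_error[OF h]) (use a assms in \<open>auto simp: in_modes_def\<close>)
  ultimately show "hbound r (fourier_coeff (\<lambda>x. v x - poly_of K a x)) ((C + M) * real K powr (- \<sigma>))"
    using e by (auto elim!: hbound_mono simp: algebra_simps)
qed

text \<open>
  Shows that clipping at \<open>M + 1\<close> is inactive as long as the error is at most 1.
\<close>

lemma coeff_le_of_error:
  assumes x: "hbound s x M" and N: "modes_norm K r (\<lambda>j. x j - y j) \<le> 1" and "0 \<le> s" "0 \<le> r" and j: "j \<in> modes K"
  shows "cmod (y j) \<le> M + 1"
proof -
  have one: "z \<le> B" if "wt j powr q * z \<le> B" "0 \<le> q" "0 \<le> z" for q z B :: real
  proof -
    have "1 * z \<le> wt j powr q * z" using that by (intro mult_right_mono ge_one_powr_ge_zero) auto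
    then show ?thesis using that by simp
  qed
  have "wt j powr r * cmod (x j - y j) \<le> modes_norm K r (\<lambda>j. x j - y j)"
    unfolding modes_norm_def by (rule member_le_L2_set[OF finite_modes j])
  then have "wt j powr r * cmod (x j - y j) \<le> 1" using N by linarith
  then have "cmod (x j - y j) \<le> 1" by (rule one) (simp_all add: assms)
  moreover have "cmod (x j) \<le> M" by (rule one[OF hbound_coeff_le[OF x]]) (simp_all add: assms)
  moreover have "cmod (y j) \<le> cmod (x j) + cmod (x j - y j)"
    using norm_triangle_ineq4[of "x j" "x j - y j"] by simp
  ultimately show ?thesis by linarith
qed

lemma numeric_system_subset: "numeric_system K I a b c \<Longrightarrow> J \<subseteq> I \<Longrightarrow> numeric_system K J a b c"
  unfolding numeric_system_def by (meson has_vector_derivative_within_subset subsetD)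

lemma numeric_system_continuous:
  assumes "numeric_system K I a b c" "j \<in> modes K"
  shows "continuous_on I (\<lambda>t. a t j) \<and> continuous_on I (\<lambda>t. b t j) \<and> continuous_on I (\<lambda>t. c t j)"
  using assms unfolding numeric_system_def continuous_on_eq_continuous_within
  by (blast intro: has_vector_derivative_continuous)

section \<open>The convergence theorem\<close>

lemma zakharov_imp_exact_regular:
  fixes \<psi> :: "real \<Rightarrow> real^'n \<Rightarrow> complex" and u w :: "real \<Rightarrow> real^'n \<Rightarrow> real"
  assumes zak: "zakharov_solution t0 T \<psi> u w" and s: "s > real CARD('n::finite) / 2" and \<sigma>: "\<sigma> \<ge> 0"
    and reg: "\<forall>t\<in>{t0..t0 + T}.
         \<psi> t \<in> sobolev (s + 2 + \<sigma>) \<and> cfun (u t) \<in> sobolev (s + \<sigma> + 1) \<and> cfun (w t) \<in> sobolev (s + \<sigma>) \<and>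
         sobolev_norm (s + 2 + \<sigma>) (\<psi> t) + pair_norm (s + \<sigma>) (cfun (u t)) (cfun (w t)) \<le> M"
  shows "exact_regular s \<sigma> M {t0..t0 + T} (\<lambda>t. fourier_coeff (\<psi> t)) (\<lambda>t. fourier_coeff (cfun (u t))) (\<lambda>t. fourier_coeff (cfun (w t)))"
proof -
  have bd: "hbound (s + 2 + \<sigma>) (fourier_coeff (\<psi> t)) M \<and> hbound (s + 1 + \<sigma>) (fourier_coeff (cfun (u t))) M
      \<and> hbound (s + \<sigma>) (fourier_coeff (cfun (w t))) M" if t: "t \<in> {t0..t0 + T}" for t
  proof -
    let ?a = "sobolev_norm (s + 2 + \<sigma>) (\<psi> t)" and ?b = "sobolev_norm (s + \<sigma> + 1) (cfun (u t))" and ?c = "sobolev_norm (s + \<sigma>) (cfun (w t))"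
    have pn: "pair_norm (s + \<sigma>) (cfun (u t)) (cfun (w t)) = sqrt (?b\<^sup>2 + ?c\<^sup>2)" by (simp add: pair_norm_def)
    have "?b \<le> sqrt (?b\<^sup>2 + ?c\<^sup>2)" "?c \<le> sqrt (?b\<^sup>2 + ?c\<^sup>2)" by (rule real_le_rsqrt, simp)+
    moreover have "?a + sqrt (?b\<^sup>2 + ?c\<^sup>2) \<le> M" using bspec[OF reg t] unfolding pn by blast
    moreover have "0 \<le> ?a" "0 \<le> ?b" by (rule sobolev_norm_nonneg)+
    ultimately have "?a \<le> M" "?b \<le> M" "?c \<le> M" by linarith+
    moreover have "\<psi> t \<in> sobolev (s + 2 + \<sigma>)" "cfun (u t) \<in> sobolev (s + \<sigma> + 1)" "cfun (w t) \<in> sobolev (s + \<sigma>)"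
      using reg t by blast+
    moreover have "s + 1 + \<sigma> = s + \<sigma> + 1" by simp
    ultimately show ?thesis by (simp only: sobolev_hbound simp_thms)
  qed
  have "exact_system {t0..t0 + T} (\<lambda>t. fourier_coeff (\<psi> t)) (\<lambda>t. fourier_coeff (cfun (u t))) (\<lambda>t. fourier_coeff (cfun (w t)))"
  proof (rule zakharov_imp_exact_system[OF zak s])
    fix t assume "t \<in> {t0..t0 + T}"
    then have 1: "hbound (s + 2 + \<sigma>) (fourier_coeff (\<psi> t)) M" and 2: "hbound (s + 1 + \<sigma>) (fourier_coeff (cfun (u t))) M"
      using bd by blast+
    show "hbound s (fourier_coeff (\<psi> t)) M \<and> hbound s (fourier_coeff (cfun (u t))) M"
      using hbound_weaken[OF 1, of s] hbound_weaken[OF 2, of s] \<sigma> by simp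
  qed
  then show ?thesis using bd by (simp add: exact_regular_def regular_state_def)
qed

theorem theorem2p2:
  fixes s \<sigma> M T :: real
  assumes "s > real CARD('n::finite) / 2" and "\<sigma> > 0" and "M \<ge> 1" and "T > 0"
  shows "\<exists>(C::real) (K0::nat).
    \<forall>(t0::real) (\<psi> :: real \<Rightarrow> real^'n \<Rightarrow> complex)
      (u :: real \<Rightarrow> real^'n \<Rightarrow> real) (w :: real \<Rightarrow> real^'n \<Rightarrow> real).
      zakharov_solution t0 T \<psi> u w \<longrightarrow>
      (\<forall>t\<in>{t0..t0 + T}.
         \<psi> t \<in> sobolev (s + 2 + \<sigma>) \<and>
         cfun (u t) \<in> sobolev (s + \<sigma> + 1) \<and>
         cfun (w t) \<in> sobolev (s + \<sigma>) \<and>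
         sobolev_norm (s + 2 + \<sigma>) (\<psi> t) + pair_norm (s + \<sigma>) (cfun (u t)) (cfun (w t)) \<le> M) \<longrightarrow>
      (\<forall>K::nat. K \<ge> 1 \<longrightarrow> K \<ge> K0 \<longrightarrow>
         (\<exists>\<psi>K uK wK.
            collocation_solution K t0 T (\<psi> t0) (cfun (u t0)) (cfun (w t0)) \<psi>K uK wK) \<and>
         (\<forall>\<psi>K uK wK.
            collocation_solution K t0 T (\<psi> t0) (cfun (u t0)) (cfun (w t0)) \<psi>K uK wK \<longrightarrow>
            (\<forall>t\<in>{t0..t0 + T}.
               (\<lambda>x. \<psi> t x - \<psi>K t x) \<in> sobolev (s + 2) \<and>
               (\<lambda>x. cfun (u t) x - uK t x) \<in> sobolev (s + 1) \<and>
               (\<lambda>x. cfun (w t) x - wK t x) \<in> sobolev s \<and>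
               sobolev_norm (s + 2) (\<lambda>x. \<psi> t x - \<psi>K t x)
                 + pair_norm s (\<lambda>x. cfun (u t) x - uK t x) (\<lambda>x. cfun (w t) x - wK t x)
               \<le> C * real K powr (- \<sigma>))))"
proof -
  note s = assms(1)
  have M: "M \<ge> 0" and T: "T \<ge> 0" and \<sigma>: "\<sigma> \<ge> 0" and s0: "s > 0"
    using assms by (auto intro: le_less_trans[of 0 "real CARD('n) / 2"])
  obtain C K0 where C: "C > 0" and CE: "\<forall>K\<ge>1. K \<ge> K0 \<longrightarrow> (\<forall>t0 (\<psi>::real \<Rightarrow> int^'n \<Rightarrow> complex) u w a b c.
     exact_regular s \<sigma> M {t0..t0 + T} \<psi> u w \<longrightarrow> interpolated_start K t0 \<psi> u w a b c \<longrightarrow>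
     (\<forall>j\<in>modes K. continuous_on {t0..t0 + T} (\<lambda>t. a t j) \<and> continuous_on {t0..t0 + T} (\<lambda>t. b t j) \<and> continuous_on {t0..t0 + T} (\<lambda>t. c t j)) \<longrightarrow>
     (\<forall>t1\<le>t0 + T. (\<forall>t\<in>{t0..t1}. state_error K s (\<psi> t) (u t) (w t) (a t) (b t) (c t) \<le> 1) \<longrightarrow> numeric_system K {t0..t1} a b c) \<longrightarrow>
     numeric_system K {t0..t0 + T} a b c \<and>
     (\<forall>t\<in>{t0..t0 + T}. state_error K s (\<psi> t) (u t) (w t) (a t) (b t) (c t) \<le> C * real K powr (- \<sigma>)))"
    using coefficient_error_bound[OF s assms(2) M T] by blast
  show ?thesis
  proof (rule exI[of _ "3 * (C + M)"], rule exI[of _ K0], intro allI impI conjI ballI)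
    fix t0 and \<psi> :: "real \<Rightarrow> real^'n \<Rightarrow> complex" and u w :: "real \<Rightarrow> real^'n \<Rightarrow> real" and K :: nat
    assume zak: "zakharov_solution t0 T \<psi> u w"
      and reg: "\<forall>t\<in>{t0..t0 + T}.
         \<psi> t \<in> sobolev (s + 2 + \<sigma>) \<and> cfun (u t) \<in> sobolev (s + \<sigma> + 1) \<and> cfun (w t) \<in> sobolev (s + \<sigma>) \<and>
         sobolev_norm (s + 2 + \<sigma>) (\<psi> t) + pair_norm (s + \<sigma>) (cfun (u t)) (cfun (w t)) \<le> M"
      and K: "K \<ge> 1" "K \<ge> K0"
    let ?I = "{t0..t0 + T}" and ?k = "real K powr (- \<sigma>)"
    define P U W where "P t = fourier_coeff (\<psi> t)" and "U t = fourier_coeff (cfun (u t))" and "W t = fourier_coeff (cfun (w t))" for t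
    have tc: "torus_continuous (\<psi> t)" "torus_continuous (cfun (u t))" "torus_continuous (cfun (w t))" if "t \<in> ?I" for t
      using zak that by (auto simp: zakharov_solution_def torus_continuous_def periodic_def intro!: continuous_intros)
    have er: "exact_regular s \<sigma> M ?I P U W"
      unfolding P_def[abs_def] U_def[abs_def] W_def[abs_def] by (rule zakharov_imp_exact_regular[OF zak s \<sigma> reg])
    have h3: "hbound (s + 2 + \<sigma>) (P t) M" "hbound (s + 1 + \<sigma>) (U t) M" "hbound (s + \<sigma>) (W t) M" if "t \<in> ?I" for t
      using er that unfolding exact_regular_def regular_state_def by blast+
    have bds: "hbound s (P t) M" "hbound s (U t) M" "hbound s (W t) M" if "t \<in> ?I" for t
    proof -
      show "hbound s (P t) M" by (rule hbound_weaken[OF h3(1)[OF that]]) (use \<sigma> in linarith)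
      show "hbound s (U t) M" by (rule hbound_weaken[OF h3(2)[OF that]]) (use \<sigma> in linarith)
      show "hbound s (W t) M" by (rule hbound_weaken[OF h3(3)[OF that]]) (use \<sigma> in linarith)
    qed
    have t0I: "t0 \<in> ?I" using T by simp
    have init: "interp_coeff K (\<psi> t0) = aliased K (P t0)" "interp_coeff K (cfun (u t0)) = aliased K (U t0)" "interp_coeff K (cfun (w t0)) = aliased K (W t0)"
    proof -
      have ia: "interp_coeff K v = aliased K (fourier_coeff v)" if "torus_continuous v" "hbound s (fourier_coeff v) M" for v :: "real^'n \<Rightarrow> complex"
        by (rule ext) (rule expands_interp_coeff[OF K(1) expands_fourier_series[OF that(1) hbound_l1[OF s that(2)]]])
      show "interp_coeff K (\<psi> t0) = aliased K (P t0)" "interp_coeff K (cfun (u t0)) = aliased K (U t0)" "interp_coeff K (cfun (w t0)) = aliased K (W t0)"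
        using ia[OF tc(1)[OF t0I]] ia[OF tc(2)[OF t0I]] ia[OF tc(3)[OF t0I]] bds[OF t0I] by (simp_all add: P_def U_def W_def)
    qed
    \<comment> \<open>Applied below to the solution of the clipped system and to an arbitrary collocation solution.\<close>
    have core: "numeric_system K ?I a b c \<and> (\<forall>t\<in>?I. state_error K s (P t) (U t) (W t) (a t) (b t) (c t) \<le> C * ?k)"
      if "interpolated_start K t0 P U W a b c"
        and "\<forall>j\<in>modes K. continuous_on ?I (\<lambda>t. a t j) \<and> continuous_on ?I (\<lambda>t. b t j) \<and> continuous_on ?I (\<lambda>t. c t j)"
        and "\<forall>t1\<le>t0 + T. (\<forall>t\<in>{t0..t1}. state_error K s (P t) (U t) (W t) (a t) (b t) (c t) \<le> 1) \<longrightarrow> numeric_system K {t0..t1} a b c" for a b c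
      using CE K er that by blast
    show "\<exists>\<psi>K uK wK. collocation_solution K t0 T (\<psi> t0) (cfun (u t0)) (cfun (w t0)) \<psi>K uK wK"
    proof -
      \<comment> \<open>The clipping radius is the bound for coefficients with error at most 1, see \<open>coeff_le_of_error\<close>.\<close>
      have R: "M + 1 \<ge> 0" using M by simp
      obtain a b c where zero: "\<forall>t. \<forall>j. j \<notin> modes K \<longrightarrow> a t j = 0 \<and> b t j = 0 \<and> c t j = 0"
        and ini: "a t0 = trunc K (aliased K (P t0))" "b t0 = trunc K (aliased K (U t0))" "c t0 = trunc K (aliased K (W t0))"
        and cont: "\<forall>j\<in>modes K. continuous_on ?I (\<lambda>t. a t j) \<and> continuous_on ?I (\<lambda>t. b t j) \<and> continuous_on ?I (\<lambda>t. c t j)"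
        and sol: "\<forall>t1\<le>t0 + T. (\<forall>t\<in>{t0..t1}. \<forall>j\<in>modes K. cmod (a t j) \<le> M + 1 \<and> cmod (b t j) \<le> M + 1 \<and> cmod (c t j) \<le> M + 1)
            \<longrightarrow> numeric_system K {t0..t1} a b c"
        using clipped_solution[OF R T, of K t0 "aliased K (P t0)" "aliased K (U t0)" "aliased K (W t0)"]
        by (elim exE conjE) (rule that; assumption)
      have im: "\<forall>t. in_modes K (a t) \<and> in_modes K (b t) \<and> in_modes K (c t)" using zero by (simp add: in_modes_def)
      have st: "interpolated_start K t0 P U W a b c" using im ini by (simp add: interpolated_start_def)
      have num: "\<forall>t1\<le>t0 + T. (\<forall>t\<in>{t0..t1}. state_error K s (P t) (U t) (W t) (a t) (b t) (c t) \<le> 1)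
        \<longrightarrow> numeric_system K {t0..t1} a b c"
      proof (intro allI impI)
        fix t1 assume t1: "t1 \<le> t0 + T" and le: "\<forall>t\<in>{t0..t1}. state_error K s (P t) (U t) (W t) (a t) (b t) (c t) \<le> 1"
        have "cmod (a t j) \<le> M + 1 \<and> cmod (b t j) \<le> M + 1 \<and> cmod (c t j) \<le> M + 1" if t: "t \<in> {t0..t1}" and j: "j \<in> modes K" for t j
        proof -
          have tI: "t \<in> ?I" using t t1 by auto
          have tot: "total_error K s (\<lambda>j. P t j - a t j) (\<lambda>j. U t j - b t j) (\<lambda>j. W t j - c t j) \<le> 1"
            using le t unfolding state_error_def by blast
          show ?thesis
            using s0 coeff_le_of_error[OF bds(1)[OF tI] total_error_le_imp(1)[OF tot] _ _ j]
              coeff_le_of_error[OF bds(2)[OF tI] total_error_le_imp(2)[OF tot] _ _ j]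
              coeff_le_of_error[OF bds(3)[OF tI] total_error_le_imp(3)[OF tot] _ _ j] by simp
        qed
        then have "\<forall>t\<in>{t0..t1}. \<forall>j\<in>modes K. cmod (a t j) \<le> M + 1 \<and> cmod (b t j) \<le> M + 1 \<and> cmod (c t j) \<le> M + 1"
          by blast
        then show "numeric_system K {t0..t1} a b c" using sol t1 by blast
      qed
      have "numeric_system K ?I a b c"
        using core[OF st cont num]
        by (rule conjunct1)
      then have "collocation_solution K t0 T (\<psi> t0) (cfun (u t0)) (cfun (w t0)) (\<lambda>t. poly_of K (a t)) (\<lambda>t. poly_of K (b t)) (\<lambda>t. poly_of K (c t))"
        using im ini init by (intro numeric_imp_collocation[OF K(1)]) auto
      then show ?thesis by blast
    qed
    fix \<psi>K uK wK t
    assume col: "collocation_solution K t0 T (\<psi> t0) (cfun (u t0)) (cfun (w t0)) \<psi>K uK wK" and t: "t \<in> ?I"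
    define a b c where "a t = trunc K (interp_coeff K (\<psi>K t))" and "b t = trunc K (interp_coeff K (uK t))" and "c t = trunc K (interp_coeff K (wK t))" for t
    have num: "numeric_system K ?I a b c"
      unfolding a_def[abs_def] b_def[abs_def] c_def[abs_def] by (rule collocation_imp_numeric(1)[OF K(1) T col])
    have ini: "a t0 = trunc K (aliased K (P t0))" "b t0 = trunc K (aliased K (U t0))" "c t0 = trunc K (aliased K (W t0))"
      unfolding a_def b_def c_def init[symmetric] by (rule collocation_imp_numeric(3-5)[OF K(1) T col])+
    have rep: "\<psi>K t = poly_of K (a t)" "uK t = poly_of K (b t)" "wK t = poly_of K (c t)"
      using collocation_imp_numeric(2)[OF K(1) T col t] unfolding a_def b_def c_def by blast+
    have im: "\<forall>t. in_modes K (a t) \<and> in_modes K (b t) \<and> in_modes K (c t)" by (simp add: in_modes_def a_def b_def c_def trunc_def)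
    have cont: "\<forall>j\<in>modes K. continuous_on ?I (\<lambda>t. a t j) \<and> continuous_on ?I (\<lambda>t. b t j) \<and> continuous_on ?I (\<lambda>t. c t j)"
      using numeric_system_continuous[OF num] by blast
    have st: "interpolated_start K t0 P U W a b c" using im ini by (simp add: interpolated_start_def)
    have num': "\<forall>t1\<le>t0 + T. (\<forall>t\<in>{t0..t1}. state_error K s (P t) (U t) (W t) (a t) (b t) (c t) \<le> 1)
      \<longrightarrow> numeric_system K {t0..t1} a b c"
    proof (intro allI impI)
      fix t1 assume "t1 \<le> t0 + T"
      then show "numeric_system K {t0..t1} a b c" by (intro numeric_system_subset[OF num]) auto
    qed
    have "\<forall>t\<in>?I. state_error K s (P t) (U t) (W t) (a t) (b t) (c t) \<le> C * ?k"
      using core[OF st cont num']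
      by (rule conjunct2)
    then have tot: "total_error K s (\<lambda>j. P t j - a t j) (\<lambda>j. U t j - b t j) (\<lambda>j. W t j - c t j) \<le> C * ?k"
      using t unfolding state_error_def by blast
    have i3: "in_modes K (a t)" "in_modes K (b t)" "in_modes K (c t)" using im by auto
    let ?B = "(C + M) * ?k"
    have e: "(\<lambda>x. \<psi> t x - \<psi>K t x) \<in> sobolev (s + 2) \<and> sobolev_norm (s + 2) (\<lambda>x. \<psi> t x - \<psi>K t x) \<le> ?B"
      unfolding rep by (rule error_in_sobolev[OF tc(1)[OF t] h3(1)[OF t, unfolded P_def] i3(1) \<sigma> K(1) total_error_le_imp(1)[OF tot, unfolded P_def]])
    have f: "(\<lambda>x. cfun (u t) x - uK t x) \<in> sobolev (s + 1) \<and> sobolev_norm (s + 1) (\<lambda>x. cfun (u t) x - uK t x) \<le> ?B"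
      unfolding rep by (rule error_in_sobolev[OF tc(2)[OF t] h3(2)[OF t, unfolded U_def] i3(2) \<sigma> K(1) total_error_le_imp(2)[OF tot, unfolded U_def]])
    have g: "(\<lambda>x. cfun (w t) x - wK t x) \<in> sobolev s \<and> sobolev_norm s (\<lambda>x. cfun (w t) x - wK t x) \<le> ?B"
      unfolding rep by (rule error_in_sobolev[OF tc(3)[OF t] h3(3)[OF t, unfolded W_def] i3(3) \<sigma> K(1) total_error_le_imp(3)[OF tot, unfolded W_def]])
    have pn: "pair_norm s (\<lambda>x. cfun (u t) x - uK t x) (\<lambda>x. cfun (w t) x - wK t x) \<le> ?B + ?B"
    proof -
      let ?x = "sobolev_norm (s + 1) (\<lambda>x. cfun (u t) x - uK t x)" and ?y = "sobolev_norm s (\<lambda>x. cfun (w t) x - wK t x)"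
      have "0 \<le> ?x" "0 \<le> ?y" by (rule sobolev_norm_nonneg)+
      then have "sqrt (?x\<^sup>2 + ?y\<^sup>2) \<le> ?x + ?y" by (rule sqrt_sum_squares_le_sum)
      then show ?thesis unfolding pair_norm_def using f g by linarith
    qed
    have "sobolev_norm (s + 2) (\<lambda>x. \<psi> t x - \<psi>K t x) + pair_norm s (\<lambda>x. cfun (u t) x - uK t x) (\<lambda>x. cfun (w t) x - wK t x) \<le> ?B + (?B + ?B)"
      using e pn by (intro add_mono) auto
    also have "\<dots> = 3 * (C + M) * ?k" by (simp add: algebra_simps)
    finally show "sobolev_norm (s + 2) (\<lambda>x. \<psi> t x - \<psi>K t x)
        + pair_norm s (\<lambda>x. cfun (u t) x - uK t x) (\<lambda>x. cfun (w t) x - wK t x) \<le> 3 * (C + M) * ?k" .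
    show "(\<lambda>x. \<psi> t x - \<psi>K t x) \<in> sobolev (s + 2)" "(\<lambda>x. cfun (u t) x - uK t x) \<in> sobolev (s + 1)"
      "(\<lambda>x. cfun (w t) x - wK t x) \<in> sobolev s" using e f g by blast+
  qed
qed

end
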